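(* (Inner bound, noise-forward, no common message.) Consider random variables $(U,V_1,V_2,X,X_1,Y,Y_1,Z)$ on finite alphabets with joint distribution of the form $P_{Y,Z,Y_1|X,X_1}(y,z,y_1|x,x_1)\,P_{X|U,V_1,V_2}(x|u,v_1,v_2)\,P_{U,V_1,V_2}(u,v_1,v_2)\,P_{X_1}(x_1)$, with $P_{Y,Z,Y_1|X,X_1}$ the channel. Then $\mathcal L^5\cup\mathcal L^6\subseteq\mathcal R^{(B)}$, where: $\mathcal L^5$ is the union, over such distributions with $I(X_1;Y)\ge I(X_1;Z|U,V_2)$, of the set of quadruples $(R_1,R_2,R_{e1},R_{e2})$ of positive reals satisfying, with $M_1=\min\{I(U;Y|X_1),I(U;Z)\}$, \begin{align*} &R_{e1}\le R_1,\ R_{e2}\le R_2,\\ &R_1\le M_1+I(V_1;Y|U,X_1),\quad R_2\le M_1+I(V_2;Z|U),\\ &R_1+R_2\le M_1+I(V_1;Y|U,X_1)+I(V_2;Z|U)-I(V_1;V_2|U),\\ &R_{e1}\le \min\{I(X_1;Z|U,V_1,V_2),I(X_1;Y)\}+I(V_1;Y|U,X_1)-I(V_1;V_2|U)-I(X_1,V_1;Z|U,V_2),\\ &R_{e2}\le I(V_2;Z|U)-I(V_1;V_2|U)-I(V_2;Y|U,X_1,V_1); \end{align*} $\mathcal L^6$ is the union, over such distributions with $I(X_1;Z)\ge I(X_1;Y|U,V_1)$, of the set of quadruples of positive reals satisfying, with $M_2=\min\{I(U;Z|X_1),I(U;Y)\}$, \begin{align*} &R_{e1}\le R_1,\ R_{e2}\le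 R_2,\\ &R_1\le M_2+I(V_1;Y|U),\quad R_2\le M_2+I(V_2;Z|U,X_1),\\ &R_1+R_2\le M_2+I(V_1;Y|U)+I(V_2;Z|U,X_1)-I(V_1;V_2|U),\\ &R_{e1}\le I(V_1;Y|U)-I(V_1;V_2|U)-I(V_1;Z|U,V_2,X_1),\\ &R_{e2}\le \min\{I(X_1;Y|U,V_1,V_2),I(X_1;Z)\}+I(V_2;Z|U,X_1)-I(V_1;V_2|U)-I(X_1,V_2;Y|U,V_1). \end{align*}
   Context: Discrete memoryless relay broadcast channel with two confidential messages (no common message): finite alphabets $\mathcal X,\mathcal X_1,\mathcal Y,\mathcal Y_1,\mathcal Z$ and a transition probability $p(y,y_1,z|x,x_1)$, used memorylessly over $N$ channel uses. $X$ is the transmitter input, $X_1$ the relay input, $Y$ the output at receiver 1, $Y_1$ the output at the relay, $Z$ the output at receiver 2. Messages $W_1,W_2$ are independent and uniform over finite sets $\mathcal W_1,\mathcal W_2$. A code of length $N$: a stochastic encoder mapping $(w_1,w_2)$ to $x^N$; a stochastic relay encoder producing $x_{1,i}$ from $(y_{1,1},\dots,y_{1,i-1})$; a decoder at receiver 1 mapping $y^N$ to an estimate of $W_1$ with error probability $P_{e1}$; a decoder at receiver 2 mapping $z^N$ to an estimate of $W_2$ with error probability $P_{e2}$. Equivocations $\Delta_1=\frac1N H(W_1|Z^N)$, $\Delta_2=\frac1N H(W_2|Y^N)$. A quadruple $(R_1,R_2,R_{e1},R_{e2})$ of positive reals is achievable if for every $\epsilon>0$ there exist codes with $\lim_{N}\frac{\log|\mathcal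 W_j|}{N}=R_j$ ($j=1,2$), $\lim_N\Delta_1\ge R_{e1}$, $\lim_N\Delta_2\ge R_{e2}$, $P_{e1},P_{e2}\le\epsilon$. $\mathcal R^{(B)}$ is the set of achievable quadruples. Logarithms are base 2. *)

theory Defs
  imports "HOL-Probability.Probability_Mass_Function"
begin

text \<open>Shannon entropy (base 2) of a discrete distribution (meant for finite support).\<close>
definition disc_H :: "'a pmf \<Rightarrow> real" where
  "disc_H p = - (\<Sum>a\<in>set_pmf p. pmf p a * log 2 (pmf p a))"

definition ent :: "'o pmf \<Rightarrow> ('o \<Rightarrow> 'a) \<Rightarrow> real" where
  "ent p A = disc_H (map_pmf A p)"

definition cent :: "'o pmf \<Rightarrow> ('o \<Rightarrow> 'a) \<Rightarrow> ('o \<Rightarrow> 'c) \<Rightarrow> real" where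
  "cent p A C = ent p (\<lambda>w. (A w, C w)) - ent p C"

definition cmi :: "'o pmf \<Rightarrow> ('o \<Rightarrow> 'a) \<Rightarrow> ('o \<Rightarrow> 'b) \<Rightarrow> ('o \<Rightarrow> 'c) \<Rightarrow> real" where
  "cmi p A B C = ent p (\<lambda>w. (A w, C w)) + ent p (\<lambda>w. (B w, C w))
                 - ent p (\<lambda>w. (A w, B w, C w)) - ent p C"

definition mi :: "'o pmf \<Rightarrow> ('o \<Rightarrow> 'a) \<Rightarrow> ('o \<Rightarrow> 'b) \<Rightarrow> real" where
  "mi p A B = cmi p A B (\<lambda>_. ())"

type_synonym ('x,'x1,'y,'y1,'z) channel = "'x \<Rightarrow> 'x1 \<Rightarrow> ('y \<times> 'y1 \<times> 'z) pmf"

text \<open>Outcome of the single-letter joint distribution of (U,V1,V2,X,X1,Y,Y1,Z).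
  Auxiliary alphabets are (finite, by assumption on the support) subsets of nat.\<close>
record ('x,'x1,'y,'y1,'z) smp =
  sU :: nat
  sV1 :: nat
  sV2 :: nat
  sX :: 'x
  sX1 :: 'x1
  sY :: 'y
  sY1 :: 'y1
  sZ :: 'z

definition joint ::
  "('x,'x1,'y,'y1,'z) channel \<Rightarrow> (nat \<times> nat \<times> nat) pmf \<Rightarrow> (nat \<times> nat \<times> nat \<Rightarrow> 'x pmf)
   \<Rightarrow> 'x1 pmf \<Rightarrow> ('x,'x1,'y,'y1,'z) smp pmf" where
  "joint W PUV PX PX1 =
     bind_pmf PUV (\<lambda>(u,v1,v2).
     bind_pmf (PX (u,v1,v2)) (\<lambda>x.
     bind_pmf PX1 (\<lambda>x1.
     map_pmf (\<lambda>(y,y1,z). \<lparr>sU = u, sV1 = v1, sV2 = v2, sX = x, sX1 = x1,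
                            sY = y, sY1 = y1, sZ = z\<rparr>) (W x x1))))"

definition L5 :: "('x,'x1,'y,'y1,'z) channel \<Rightarrow> (real \<times> real \<times> real \<times> real) set" where
  "L5 W = {(R1, R2, Re1, Re2). \<exists>PUV PX PX1.
     finite (set_pmf PUV) \<and>
     (let J = joint W PUV PX PX1;
          M1 = min (cmi J sU sY sX1) (mi J sU sZ)
      in mi J sX1 sY \<ge> cmi J sX1 sZ (\<lambda>w. (sU w, sV2 w)) \<and>
         R1 > 0 \<and> R2 > 0 \<and> Re1 > 0 \<and> Re2 > 0 \<and>
         Re1 \<le> R1 \<and> Re2 \<le> R2 \<and>
         R1 \<le> M1 + cmi J sV1 sY (\<lambda>w. (sU w, sX1 w)) \<and>
         R2 \<le> M1 + cmi J sV2 sZ sU \<and>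
         R1 + R2 \<le> M1 + cmi J sV1 sY (\<lambda>w. (sU w, sX1 w)) + cmi J sV2 sZ sU
                   - cmi J sV1 sV2 sU \<and>
         Re1 \<le> min (cmi J sX1 sZ (\<lambda>w. (sU w, sV1 w, sV2 w))) (mi J sX1 sY)
               + cmi J sV1 sY (\<lambda>w. (sU w, sX1 w)) - cmi J sV1 sV2 sU
               - cmi J (\<lambda>w. (sX1 w, sV1 w)) sZ (\<lambda>w. (sU w, sV2 w)) \<and>
         Re2 \<le> cmi J sV2 sZ sU - cmi J sV1 sV2 sU
               - cmi J sV2 sY (\<lambda>w. (sU w, sX1 w, sV1 w)))}"

definition L6 :: "('x,'x1,'y,'y1,'z) channel \<Rightarrow> (real \<times> real \<times> real \<times> real) set" where
  "L6 W = {(R1, R2, Re1, Re2). \<exists>PUV PX PX1.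
     finite (set_pmf PUV) \<and>
     (let J = joint W PUV PX PX1;
          M2 = min (cmi J sU sZ sX1) (mi J sU sY)
      in mi J sX1 sZ \<ge> cmi J sX1 sY (\<lambda>w. (sU w, sV1 w)) \<and>
         R1 > 0 \<and> R2 > 0 \<and> Re1 > 0 \<and> Re2 > 0 \<and>
         Re1 \<le> R1 \<and> Re2 \<le> R2 \<and>
         R1 \<le> M2 + cmi J sV1 sY sU \<and>
         R2 \<le> M2 + cmi J sV2 sZ (\<lambda>w. (sU w, sX1 w)) \<and>
         R1 + R2 \<le> M2 + cmi J sV1 sY sU + cmi J sV2 sZ (\<lambda>w. (sU w, sX1 w))
                   - cmi J sV1 sV2 sU \<and>
         Re1 \<le> cmi J sV1 sY sU - cmi J sV1 sV2 sU
               - cmi J sV1 sZ (\<lambda>w. (sU w, sV2 w, sX1 w)) \<and>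
         Re2 \<le> min (cmi J sX1 sY (\<lambda>w. (sU w, sV1 w, sV2 w))) (mi J sX1 sZ)
               + cmi J sV2 sZ (\<lambda>w. (sU w, sX1 w)) - cmi J sV1 sV2 sU
               - cmi J (\<lambda>w. (sX1 w, sV2 w)) sY (\<lambda>w. (sU w, sV1 w)))}"

text \<open>Memoryless use of the channel with a deterministic causal relay strategy s:
  at time i the relay sends s (y1_1 ... y1_{i-1}).  Output list of (x1_i, y_i, y1_i, z_i).\<close>
fun chan_run :: "('x,'x1,'y,'y1,'z) channel \<Rightarrow> ('y1 list \<Rightarrow> 'x1) \<Rightarrow> 'y1 list \<Rightarrow> 'x list
                 \<Rightarrow> ('x1 \<times> 'y \<times> 'y1 \<times> 'z) list pmf" where
  "chan_run W s past [] = return_pmf []"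
| "chan_run W s past (x # xs) =
     bind_pmf (W x (s past)) (\<lambda>(y, y1, z).
       map_pmf (\<lambda>rest. (s past, y, y1, z) # rest) (chan_run W s (past @ [y1]) xs))"

text \<open>Full distribution of (W1, W2, channel trace) for a code: messages uniform on
  {..<M1}, {..<M2}; stochastic encoder enc; stochastic relay given as a random
  causal strategy rel (independent of everything else).\<close>
definition code_pmf ::
  "('x,'x1,'y,'y1,'z) channel \<Rightarrow> nat \<Rightarrow> nat \<Rightarrow> (nat \<Rightarrow> nat \<Rightarrow> 'x list pmf)
   \<Rightarrow> ('y1 list \<Rightarrow> 'x1) pmf \<Rightarrow> (nat \<times> nat \<times> ('x1 \<times> 'y \<times> 'y1 \<times> 'z) list) pmf" where
  "code_pmf W M1 M2 enc rel =
     bind_pmf (pmf_of_set {..<M1}) (\<lambda>w1.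
     bind_pmf (pmf_of_set {..<M2}) (\<lambda>w2.
     bind_pmf (enc w1 w2) (\<lambda>xs.
     bind_pmf rel (\<lambda>s.
     map_pmf (\<lambda>os. (w1, w2, os)) (chan_run W s [] xs)))))"

definition outY :: "nat \<times> nat \<times> ('x1 \<times> 'y \<times> 'y1 \<times> 'z) list \<Rightarrow> 'y list" where
  "outY t = map (\<lambda>(x1, y, y1, z). y) (snd (snd t))"

definition outZ :: "nat \<times> nat \<times> ('x1 \<times> 'y \<times> 'y1 \<times> 'z) list \<Rightarrow> 'z list" where
  "outZ t = map (\<lambda>(x1, y, y1, z). z) (snd (snd t))"

definition valid_code :: "nat \<Rightarrow> nat \<Rightarrow> nat \<Rightarrow> (nat \<Rightarrow> nat \<Rightarrow> 'x list pmf) \<Rightarrow> bool" where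
  "valid_code N M1 M2 enc \<longleftrightarrow> M1 \<ge> 1 \<and> M2 \<ge> 1 \<and>
     (\<forall>w1<M1. \<forall>w2<M2. \<forall>xs\<in>set_pmf (enc w1 w2). length xs = N)"

definition Pe1 :: "('x,'x1,'y,'y1,'z) channel \<Rightarrow> nat \<Rightarrow> nat \<Rightarrow> (nat \<Rightarrow> nat \<Rightarrow> 'x list pmf)
   \<Rightarrow> ('y1 list \<Rightarrow> 'x1) pmf \<Rightarrow> ('y list \<Rightarrow> nat) \<Rightarrow> real" where
  "Pe1 W M1 M2 enc rel dec1 =
     measure_pmf.prob (code_pmf W M1 M2 enc rel) {t. dec1 (outY t) \<noteq> fst t}"

definition Pe2 :: "('x,'x1,'y,'y1,'z) channel \<Rightarrow> nat \<Rightarrow> nat \<Rightarrow> (nat \<Rightarrow> nat \<Rightarrow> 'x list pmf)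
   \<Rightarrow> ('y1 list \<Rightarrow> 'x1) pmf \<Rightarrow> ('z list \<Rightarrow> nat) \<Rightarrow> real" where
  "Pe2 W M1 M2 enc rel dec2 =
     measure_pmf.prob (code_pmf W M1 M2 enc rel) {t. dec2 (outZ t) \<noteq> fst (snd t)}"

definition Delta1 :: "('x,'x1,'y,'y1,'z) channel \<Rightarrow> nat \<Rightarrow> nat \<Rightarrow> nat
   \<Rightarrow> (nat \<Rightarrow> nat \<Rightarrow> 'x list pmf) \<Rightarrow> ('y1 list \<Rightarrow> 'x1) pmf \<Rightarrow> real" where
  "Delta1 W N M1 M2 enc rel = cent (code_pmf W M1 M2 enc rel) fst outZ / real N"

definition Delta2 :: "('x,'x1,'y,'y1,'z) channel \<Rightarrow> nat \<Rightarrow> nat \<Rightarrow> nat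
   \<Rightarrow> (nat \<Rightarrow> nat \<Rightarrow> 'x list pmf) \<Rightarrow> ('y1 list \<Rightarrow> 'x1) pmf \<Rightarrow> real" where
  "Delta2 W N M1 M2 enc rel = cent (code_pmf W M1 M2 enc rel) (\<lambda>t. fst (snd t)) outY / real N"

text \<open>Achievable region R^(B).  "lim Delta \<ge> Re" is read as liminf Delta \<ge> Re.\<close>
definition achievable_region :: "('x,'x1,'y,'y1,'z) channel \<Rightarrow> (real \<times> real \<times> real \<times> real) set" where
  "achievable_region W = {(R1, R2, Re1, Re2).
     R1 > 0 \<and> R2 > 0 \<and> Re1 > 0 \<and> Re2 > 0 \<and>
     (\<forall>\<epsilon>>0. \<exists>(M1 :: nat \<Rightarrow> nat) (M2 :: nat \<Rightarrow> nat)
                (enc :: nat \<Rightarrow> nat \<Rightarrow> nat \<Rightarrow> 'x list pmf)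
                (rel :: nat \<Rightarrow> ('y1 list \<Rightarrow> 'x1) pmf)
                (dec1 :: nat \<Rightarrow> 'y list \<Rightarrow> nat) (dec2 :: nat \<Rightarrow> 'z list \<Rightarrow> nat).
        (\<forall>N. valid_code N (M1 N) (M2 N) (enc N)) \<and>
        (\<lambda>N. log 2 (real (M1 N)) / real N) \<longlonglongrightarrow> R1 \<and>
        (\<lambda>N. log 2 (real (M2 N)) / real N) \<longlonglongrightarrow> R2 \<and>
        (\<forall>\<delta>>0. eventually (\<lambda>N. Delta1 W N (M1 N) (M2 N) (enc N) (rel N) \<ge> Re1 - \<delta>) sequentially) \<and>
        (\<forall>\<delta>>0. eventually (\<lambda>N. Delta2 W N (M1 N) (M2 N) (enc N) (rel N) \<ge> Re2 - \<delta>) sequentially) \<and>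
        eventually (\<lambda>N. Pe1 W (M1 N) (M2 N) (enc N) (rel N) (dec1 N) \<le> \<epsilon> \<and>
                        Pe2 W (M1 N) (M2 N) (enc N) (rel N) (dec2 N) \<le> \<epsilon>) sequentially)}"

end

theory Submission
  imports Defs "HOL-Probability.Product_PMF"
begin

text \<open>
  The proof is output statistics of random binning rather than a codebook construction.  Take an
  i.i.d. source \<open>(U, V1, V2, X1)\<close>, its channel outputs, and random hash functions \<open>h0, h1, h2, h3\<close> of
  the blocks of \<open>U, V1, V2, X1\<close>.  A hash value consists of a public part \<open>f\<close>, known to all terminals,
  and message parts: \<open>c1, c2\<close> (hashed from \<open>U\<close>), \<open>s1, t1\<close> (from \<open>V1\<close>), \<open>s2, t2\<close> (from \<open>V2\<close>);
  \<open>W1 = (c1, s1, t1)\<close>, \<open>W2 = (c2, s2, t2)\<close>, and \<open>s1, s2\<close> are the secret parts.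
  Receivers decode by Slepian--Wolf when the public rates exceed the conditional entropies.  By the
  leftover hash lemma the message parts are nearly uniform given the public parts, and \<open>s1\<close> (\<open>s2\<close>) is
  nearly uniform given all that receiver 2 (1) sees, when the rates are below the conditional
  entropies.  Hence drawing the messages uniformly and then the blocks from the source conditioned
  on their hash values (the relay draws \<open>X1\<close> conditioned on its public hash value, which is the
  noise-forward strategy) changes the joint law little in total variation, and averaging
  provides one good value of hash functions and public parts.  Marton coding needs no separate covering
  lemma: it is the two-source leftover hash lemma for \<open>(V1, V2)\<close> given \<open>U\<close>.
  The region \<open>L6\<close> is \<open>L5\<close> with the receivers exchanged.
\<close>

section \<open>Total variation distance\<close>

text \<open>Each public rate is set just above the conditional entropy that a decoder must resolve.
  Since X1 is independent of (U,V1,V2), a quantity such as I(V1;Y|U,X1) is then H(V1|U) minus the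
  public rate of V1, up to the slack. Both receivers decode U from the same public hash, which costs
  the larger of two conditional entropies; this is the origin of the minimum M1. The two-source
  leftover hash lemma for (V1,X1) given (Z,U,V2) has three conditions: two of them are the two terms
  of the minimum in the bound on Re1, and the third is the constraint I(X1;Y) >= I(X1;Z|U,V2). The
  equivocation is bounded through s1 and s2 alone; the parts c and t carry the remaining rate and
  may leak. Every hashing step asks for strict slack, while the inequalities of the region are not
  strict. Slack is bought by lowering rates a little, with two exceptions: if M1 = 0 there is no
  rate on U to lower, and the constraint on X1 contains no rate at all. Both cases get an
  alternative hypothesis that is carried through the proof.\<close>

abbreviation prob :: "'a pmf \<Rightarrow> 'a set \<Rightarrow> real" where
  "prob p \<equiv> measure_pmf.prob p"

abbreviation expectation :: "'a pmf \<Rightarrow> ('a \<Rightarrow> real) \<Rightarrow> real" where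
  "expectation p \<equiv> measure_pmf.expectation p"

abbreviation fan :: "('o \<Rightarrow> 'a) \<Rightarrow> ('o \<Rightarrow> 'b) \<Rightarrow> 'o \<Rightarrow> 'a \<times> 'b" (infixr "\<star>" 75) where
  "A \<star> B \<equiv> \<lambda>w. (A w, B w)"

type_synonym triple = "nat \<times> nat \<times> nat"

text \<open>Twice the total variation distance. A sum over an infinite set is 0 by convention, so
  the value is meaningful for finite supports, and these are assumed in the inequalities
  below.\<close>

definition l1 :: "'a pmf \<Rightarrow> 'a pmf \<Rightarrow> real" where
  "l1 p q = (\<Sum>x\<in>set_pmf p \<union> set_pmf q. \<bar>pmf p x - pmf q x\<bar>)"

lemma expectation_sum:
  fixes f :: "'a \<Rightarrow> real"
  assumes "finite S" "set_pmf p \<subseteq> S"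
  shows "expectation p f = (\<Sum>x\<in>S. pmf p x * f x)"
  using integral_measure_pmf_real[of S p f] assms by (auto simp: mult.commute)

lemma pmf_bind_sum:
  assumes "finite S" "set_pmf p \<subseteq> S"
  shows "pmf (bind_pmf p K) y = (\<Sum>x\<in>S. pmf p x * pmf (K x) y)"
  by (simp add: pmf_bind expectation_sum[OF assms])

lemma prob_sum:
  assumes "finite S" "set_pmf p \<subseteq> S"
  shows "prob p E = (\<Sum>x\<in>S. pmf p x * of_bool (x \<in> E))"
proof -
  have "prob p E = expectation p (indicator E)" by simp
  also have "\<dots> = (\<Sum>x\<in>S. pmf p x * indicator E x)" by (rule expectation_sum[OF assms])
  also have "\<dots> = (\<Sum>x\<in>S. pmf p x * of_bool (x \<in> E))" by (simp add: indicator_def)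
  finally show ?thesis .
qed

lemma pmf_map_sum:
  assumes "finite S" "set_pmf p \<subseteq> S"
  shows "pmf (map_pmf f p) y = (\<Sum>x\<in>S. pmf p x * of_bool (f x = y))"
  by (simp add: pmf_map prob_sum[OF assms] vimage_def)

lemma sum_pmf_map:
  fixes g :: "'b \<Rightarrow> real"
  assumes "finite (set_pmf p)" "finite T" "f ` set_pmf p \<subseteq> T"
  shows "(\<Sum>y\<in>T. pmf (map_pmf f p) y * g y) = (\<Sum>x\<in>set_pmf p. pmf p x * g (f x))"
  using expectation_sum[of T "map_pmf f p" g] expectation_sum[of "set_pmf p" p "g \<circ> f"] assms
  by (simp add: o_def)

lemma l1_superset:
  assumes "finite S" "set_pmf p \<subseteq> S" "set_pmf q \<subseteq> S"
  shows "l1 p q = (\<Sum>x\<in>S. \<bar>pmf p x - pmf q x\<bar>)"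
  unfolding l1_def using assms by (intro sum.mono_neutral_left) (auto simp: set_pmf_iff)

lemma l1_nonneg: "0 \<le> l1 p q"
  unfolding l1_def by (simp add: sum_nonneg)

lemma l1_refl [simp]: "l1 p p = 0"
  unfolding l1_def by simp

lemma l1_commute: "l1 p q = l1 q p"
  unfolding l1_def by (simp add: Un_commute abs_minus_commute)

lemma l1_triangle:
  assumes "finite (set_pmf p)" "finite (set_pmf q)" "finite (set_pmf r)"
  shows "l1 p r \<le> l1 p q + l1 q r"
proof -
  let ?S = "set_pmf p \<union> set_pmf q \<union> set_pmf r"
  have "l1 p r = (\<Sum>x\<in>?S. \<bar>pmf p x - pmf r x\<bar>)"
       "l1 p q = (\<Sum>x\<in>?S. \<bar>pmf p x - pmf q x\<bar>)"
       "l1 q r = (\<Sum>x\<in>?S. \<bar>pmf q x - pmf r x\<bar>)"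
    by (rule l1_superset; use assms in auto)+
  then show ?thesis by (simp add: sum.distrib[symmetric] sum_mono)
qed

lemma prob_le_l1:
  assumes "finite (set_pmf p)" "finite (set_pmf q)"
  shows "prob p E \<le> prob q E + l1 p q"
proof -
  let ?S = "set_pmf p \<union> set_pmf q"
  have "prob p E = (\<Sum>x\<in>?S. pmf p x * of_bool (x \<in> E))"
       "prob q E = (\<Sum>x\<in>?S. pmf q x * of_bool (x \<in> E))"
    by (rule prob_sum; use assms in auto)+
  then show ?thesis
    by (auto simp: l1_def sum.distrib[symmetric] of_bool_def intro!: sum_mono)
qed

text \<open>Data processing: the triangle inequality moves the absolute value inside the mixture,
  and each \<open>K x\<close> has total mass 1.\<close>

lemma l1_bind:
  assumes fin: "finite (set_pmf p)" "finite (set_pmf q)"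
    and finK: "\<And>x. x \<in> set_pmf p \<union> set_pmf q \<Longrightarrow> finite (set_pmf (K x))"
  shows "l1 (bind_pmf p K) (bind_pmf q K) \<le> l1 p q"
proof -
  let ?S = "set_pmf p \<union> set_pmf q"
  let ?T = "\<Union>x\<in>?S. set_pmf (K x)"
  have fT: "finite ?T" using fin finK by auto
  have "l1 (bind_pmf p K) (bind_pmf q K)
      = (\<Sum>y\<in>?T. \<bar>(\<Sum>x\<in>?S. pmf p x * pmf (K x) y) - (\<Sum>x\<in>?S. pmf q x * pmf (K x) y)\<bar>)"
    using fin fT by (subst l1_superset[of ?T]) (auto simp: pmf_bind_sum[of ?S])
  also have "\<dots> \<le> (\<Sum>y\<in>?T. \<Sum>x\<in>?S. \<bar>pmf p x - pmf q x\<bar> * pmf (K x) y)"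
  proof (rule sum_mono)
    fix y
    have "\<bar>(\<Sum>x\<in>?S. pmf p x * pmf (K x) y) - (\<Sum>x\<in>?S. pmf q x * pmf (K x) y)\<bar>
        = \<bar>\<Sum>x\<in>?S. (pmf p x - pmf q x) * pmf (K x) y\<bar>"
      by (simp add: sum_subtractf algebra_simps)
    also have "\<dots> \<le> (\<Sum>x\<in>?S. \<bar>(pmf p x - pmf q x) * pmf (K x) y\<bar>)" by (rule sum_abs)
    also have "\<dots> = (\<Sum>x\<in>?S. \<bar>pmf p x - pmf q x\<bar> * pmf (K x) y)" by (simp add: abs_mult)
    finally show "\<bar>(\<Sum>x\<in>?S. pmf p x * pmf (K x) y) - (\<Sum>x\<in>?S. pmf q x * pmf (K x) y)\<bar>
      \<le> (\<Sum>x\<in>?S. \<bar>pmf p x - pmf q x\<bar> * pmf (K x) y)" .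
  qed
  also have "\<dots> = (\<Sum>x\<in>?S. \<bar>pmf p x - pmf q x\<bar> * (\<Sum>y\<in>?T. pmf (K x) y))"
    by (subst sum.swap) (simp add: sum_distrib_left)
  also have "\<dots> = (\<Sum>x\<in>?S. \<bar>pmf p x - pmf q x\<bar>)"
    using fT by (intro sum.cong refl) (subst sum_pmf_eq_1; auto)
  finally show ?thesis by (simp add: l1_def)
qed

lemma l1_map:
  assumes "finite (set_pmf p)" "finite (set_pmf q)"
  shows "l1 (map_pmf f p) (map_pmf f q) \<le> l1 p q"
  unfolding map_pmf_def using assms by (intro l1_bind) auto

lemma l1_pair_right:
  assumes "finite (set_pmf p)" "finite (set_pmf q)" "finite (set_pmf u)"
  shows "l1 (pair_pmf u p) (pair_pmf u q) \<le> l1 p q"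
proof -
  have "pair_pmf u r = bind_pmf r (\<lambda>y. map_pmf (\<lambda>x. (x, y)) u)" for r :: "'a pmf"
    unfolding pair_pmf_def map_pmf_def by (subst bind_commute_pmf) simp
  then show ?thesis using assms by (auto intro!: l1_bind)
qed

text \<open>Hashing bounds compare with a product whose second factor is convenient, secrecy asks
  for the true marginal. Projecting to the second component shows that \<open>r\<close> is as close
  to that marginal as \<open>p\<close> is to the product, which doubles the bound.\<close>

lemma l1_snd_marginal:
  assumes "finite (set_pmf p)" "finite (set_pmf u)" "finite (set_pmf r)"
  shows "l1 p (pair_pmf u (map_pmf snd p)) \<le> 2 * l1 p (pair_pmf u r)"
proof -
  have "l1 p (pair_pmf u (map_pmf snd p)) \<le> l1 p (pair_pmf u r) + l1 (pair_pmf u r) (pair_pmf u (map_pmf snd p))"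
    by (rule l1_triangle) (use assms in auto)
  also have "l1 (pair_pmf u r) (pair_pmf u (map_pmf snd p)) \<le> l1 r (map_pmf snd p)"
    by (rule l1_pair_right) (use assms in auto)
  also have "\<dots> = l1 (map_pmf snd p) (map_pmf snd (pair_pmf u r))"
    by (simp add: map_snd_pair_pmf l1_commute)
  also have "\<dots> \<le> l1 p (pair_pmf u r)" by (rule l1_map) (use assms in auto)
  finally show ?thesis by simp
qed

text \<open>Keeping \<open>x\<close> in the output separates the supports of the pieces, so nothing
  cancels in the mixture. An average over public randomness thereby becomes one distance between
  joint laws.\<close>

lemma l1_bind_expectation:
  assumes "finite (set_pmf p)" "\<And>x. x \<in> set_pmf p \<Longrightarrow> finite (set_pmf (K x))"
    "\<And>x. x \<in> set_pmf p \<Longrightarrow> finite (set_pmf (L x))"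
  shows "expectation p (\<lambda>x. l1 (K x) (L x))
       = l1 (bind_pmf p (\<lambda>x. map_pmf (Pair x) (K x))) (bind_pmf p (\<lambda>x. map_pmf (Pair x) (L x)))"
proof -
  let ?T = "\<Union>x\<in>set_pmf p. set_pmf (K x) \<union> set_pmf (L x)"
  have fT: "finite ?T" using assms by auto
  have pm: "pmf (bind_pmf p (\<lambda>x. map_pmf (Pair x) (F x))) (x, y) = pmf p x * pmf (F x) y"
    if "x \<in> set_pmf p" for F :: "'a \<Rightarrow> 'b pmf" and x y
  proof -
    have *: "pmf (map_pmf (Pair x') (F x')) (x, y) = (if x' = x then pmf (F x) y else 0)" for x'
    proof (cases "x' = x")
      case True
      then show ?thesis by (simp add: pmf_map_inj' inj_def)
    next
      case False
      then have "(x, y) \<notin> set_pmf (map_pmf (Pair x') (F x'))" by auto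
      then have "pmf (map_pmf (Pair x') (F x')) (x, y) = 0" by (simp only: set_pmf_iff not_not)
      then show ?thesis using False by simp
    qed
    have "pmf (bind_pmf p (\<lambda>x. map_pmf (Pair x) (F x))) (x, y)
        = (\<Sum>x'\<in>set_pmf p. pmf p x' * (if x' = x then pmf (F x) y else 0))"
      using assms(1) by (simp only: pmf_bind_sum[OF assms(1) subset_refl] *)
    also have "\<dots> = (\<Sum>x'\<in>set_pmf p. if x' = x then pmf p x * pmf (F x) y else 0)"
      by (intro sum.cong) auto
    finally show ?thesis using assms(1) that by simp
  qed
  have "l1 (bind_pmf p (\<lambda>x. map_pmf (Pair x) (K x))) (bind_pmf p (\<lambda>x. map_pmf (Pair x) (L x)))
      = (\<Sum>(x, y)\<in>set_pmf p \<times> ?T. \<bar>pmf p x * pmf (K x) y - pmf p x * pmf (L x) y\<bar>)"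
    using assms fT by (subst l1_superset[of "set_pmf p \<times> ?T"]) (auto simp: pm intro!: sum.cong)
  also have "\<dots> = (\<Sum>x\<in>set_pmf p. pmf p x * (\<Sum>y\<in>?T. \<bar>pmf (K x) y - pmf (L x) y\<bar>))"
    by (simp add: sum.cartesian_product[symmetric] right_diff_distrib[symmetric] abs_mult sum_distrib_left)
  also have "\<dots> = (\<Sum>x\<in>set_pmf p. pmf p x * l1 (K x) (L x))"
    using fT by (intro sum.cong refl) (subst l1_superset[of ?T]; auto)
  also have "\<dots> = expectation p (\<lambda>x. l1 (K x) (L x))"
    using assms by (simp add: expectation_sum[of "set_pmf p"])
  finally show ?thesis by simp
qed

lemma pmf_of_set_Times:
  assumes "finite A" "A \<noteq> {}" "finite B" "B \<noteq> {}"
  shows "pmf_of_set (A \<times> B) = pair_pmf (pmf_of_set A) (pmf_of_set B)"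
proof (rule pmf_eqI)
  fix x show "pmf (pmf_of_set (A \<times> B)) x = pmf (pair_pmf (pmf_of_set A) (pmf_of_set B)) x"
    using assms by (cases x) (auto simp: pmf_pair indicator_def card_cartesian_product)
qed

lemma ex_le_expectation:
  fixes f :: "'a \<Rightarrow> real"
  assumes "finite (set_pmf p)"
  shows "\<exists>x\<in>set_pmf p. f x \<le> expectation p f"
proof (rule ccontr)
  assume "\<not> ?thesis"
  then have *: "\<And>x. x \<in> set_pmf p \<Longrightarrow> expectation p f < f x" by force
  have "(\<Sum>x\<in>set_pmf p. pmf p x * expectation p f) < (\<Sum>x\<in>set_pmf p. pmf p x * f x)"
    using assms * by (intro sum_strict_mono) (auto simp: set_pmf_not_empty pmf_pos set_pmf_iff)
  then show False using assms
    by (simp add: expectation_sum[of "set_pmf p"] sum_distrib_right[symmetric] sum_pmf_eq_1)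
qed

section \<open>Random hashing\<close>

text \<open>Conditional probability; 0 if the condition has probability 0.\<close>
definition cp :: "'o pmf \<Rightarrow> ('o \<Rightarrow> 'a) \<Rightarrow> ('o \<Rightarrow> 'e) \<Rightarrow> 'a \<Rightarrow> 'e \<Rightarrow> real" where
  "cp J A E a e = pmf (map_pmf (A \<star> E) J) (a, e) / pmf (map_pmf E J) e"

text \<open>A pairwise independent hash family with values distributed as \<open>U\<close>.
  Independence concerns arguments in \<open>S\<close>, but the range condition concerns all
  arguments, so that every hash value lies in the intended set.\<close>

definition uhash :: "('a \<Rightarrow> 'k) pmf \<Rightarrow> 'a set \<Rightarrow> 'k pmf \<Rightarrow> bool" where
  "uhash H S U \<longleftrightarrow> finite (set_pmf H) \<and> (\<forall>h\<in>set_pmf H. range h \<subseteq> set_pmf U) \<and>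
     (\<forall>a\<in>S. map_pmf (\<lambda>h. h a) H = U) \<and>
     (\<forall>a\<in>S. \<forall>b\<in>S. a \<noteq> b \<longrightarrow> map_pmf (\<lambda>h. (h a, h b)) H = pair_pmf U U)"

lemma uhash_exists:
  assumes "finite S" "finite (set_pmf U)"
  shows "\<exists>H. uhash H S U"
proof -
  obtain d where d: "d \<in> set_pmf U" using set_pmf_not_empty by fast
  \<comment> \<open>Independent values on \<open>S\<close>. The default \<open>d\<close> is taken
    from the support of \<open>U\<close>, which gives the range condition outside
    \<open>S\<close>.\<close>
  let ?H = "Pi_pmf S d (\<lambda>_. U)"
  have set: "set_pmf ?H \<subseteq> PiE_dflt S d (\<lambda>_. set_pmf U)"
    using set_Pi_pmf[OF assms(1), of d "\<lambda>_. U"] by (auto simp: o_def)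
  have fin: "finite (PiE_dflt S d (\<lambda>_. set_pmf U))" using assms by auto
  have one: "map_pmf (\<lambda>h. h a) (Pi_pmf T d (\<lambda>_. U)) = U" if "finite T" "a \<in> T" for a T
    using Pi_pmf_component[OF that(1), of a d "\<lambda>_. U"] that by simp
  have two: "map_pmf (\<lambda>h. (h a, h b)) ?H = pair_pmf U U" if "a \<in> S" "b \<in> S" "a \<noteq> b" for a b
  proof -
    have S: "S = insert a (S - {a})" using that by auto
    have "map_pmf (\<lambda>h. (h a, h b)) (Pi_pmf (insert a (S - {a})) d (\<lambda>_. U))
        = map_pmf (\<lambda>(y, f). (y, f b)) (pair_pmf U (Pi_pmf (S - {a}) d (\<lambda>_. U)))"
      using that assms by (subst Pi_pmf_insert) (auto simp: pmf.map_comp o_def case_prod_unfold intro!: map_pmf_cong)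
    also have "\<dots> = pair_pmf U (map_pmf (\<lambda>f. f b) (Pi_pmf (S - {a}) d (\<lambda>_. U)))"
      using map_pair[of "\<lambda>y. y" "\<lambda>f. f b"] by simp
    also have "\<dots> = pair_pmf U U" using that assms by (subst one) auto
    finally show ?thesis using S by simp
  qed
  have "uhash ?H S U"
    unfolding uhash_def
  proof (intro conjI ballI impI)
    show "finite (set_pmf ?H)" using set fin by (rule finite_subset)
    fix h assume "h \<in> set_pmf ?H"
    then have "h \<in> PiE_dflt S d (\<lambda>_. set_pmf U)" using set by auto
    then show "range h \<subseteq> set_pmf U" using d by (auto simp: PiE_dflt_def)
  qed (use one two assms in auto)
  then show ?thesis by blast
qed

text \<open>Applied to projections: the public part of a hash value, or its public and secret parts
  together, again form a pairwise independent hash. One random function can thus serve decoding,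
  uniformity and secrecy.\<close>

lemma uhash_comp:
  assumes "uhash H S U"
  shows "uhash (map_pmf (\<lambda>h. g \<circ> h) H) S (map_pmf g U)"
proof -
  have "map_pmf (\<lambda>h. (g (h a), g (h b))) H = pair_pmf (map_pmf g U) (map_pmf g U)"
    if "a \<in> S" "b \<in> S" "a \<noteq> b" for a b
  proof -
    have "map_pmf (\<lambda>h. (g (h a), g (h b))) H = map_pmf (\<lambda>(x, y). (g x, g y)) (map_pmf (\<lambda>h. (h a, h b)) H)"
      by (simp add: pmf.map_comp o_def)
    also have "\<dots> = pair_pmf (map_pmf g U) (map_pmf g U)"
      using assms that by (simp add: uhash_def map_pair)
    finally show ?thesis .
  qed
  moreover have "map_pmf (\<lambda>h. g (h a)) H = map_pmf g U" if "a \<in> S" for a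
  proof -
    have "map_pmf (\<lambda>h. g (h a)) H = map_pmf g (map_pmf (\<lambda>h. h a) H)" by (simp add: pmf.map_comp o_def)
    then show ?thesis using assms that by (simp add: uhash_def)
  qed
  moreover have "range (g \<circ> h) \<subseteq> set_pmf (map_pmf g U)" if "h \<in> set_pmf H" for h
  proof -
    have "range h \<subseteq> set_pmf U" using assms that by (simp add: uhash_def)
    then show ?thesis by auto
  qed
  ultimately show ?thesis using assms
    unfolding uhash_def by (simp add: pmf.map_comp o_def)
qed

lemma pmf_marginal_sum:
  assumes fin: "finite (set_pmf J)"
  shows "(\<Sum>c\<in>C ` set_pmf J. of_bool (f c = a) * pmf (map_pmf (C \<star> E) J) (c, e))
       = pmf (map_pmf (\<lambda>w. (f (C w), E w)) J) (a, e)"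
proof -
  have "(\<Sum>c\<in>C ` set_pmf J. of_bool (f c = a) * pmf (map_pmf (C \<star> E) J) (c, e))
      = (\<Sum>c\<in>C ` set_pmf J. \<Sum>w\<in>set_pmf J. if C w = c then pmf J w * of_bool (f (C w) = a \<and> E w = e) else 0)"
    unfolding pmf_map_sum[OF fin subset_refl] sum_distrib_left by (intro sum.cong refl) auto
  also have "\<dots> = (\<Sum>w\<in>set_pmf J. pmf J w * of_bool (f (C w) = a \<and> E w = e))"
    using fin by (subst sum.swap) (auto simp: sum.delta' intro!: sum.cong)
  finally show ?thesis by (simp add: pmf_map_sum[OF fin subset_refl])
qed

lemma pmf_marginal:
  assumes "finite (set_pmf J)"
  shows "(\<Sum>a\<in>A ` set_pmf J. pmf (map_pmf (A \<star> E) J) (a, e)) = pmf (map_pmf E J) e"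
proof -
  have "map_pmf (\<lambda>w. ((), E w)) J = map_pmf (Pair ()) (map_pmf E J)" by (simp add: pmf.map_comp o_def)
  then show ?thesis
    using pmf_marginal_sum[OF assms, of "\<lambda>_. ()" "()" A E e] by (simp add: pmf_map_inj' inj_def)
qed

lemma sum_cp_eq_1:
  assumes "finite (set_pmf J)" "e \<in> E ` set_pmf J"
  shows "(\<Sum>a\<in>A ` set_pmf J. cp J A E a e) = 1"
proof -
  have "0 < pmf (map_pmf E J) e" using assms(2) by (intro pmf_positive) auto
  then show ?thesis by (simp add: cp_def sum_divide_distrib[symmetric] pmf_marginal[OF assms(1)])
qed

lemma cp_nonneg: "0 \<le> cp J A E a e"
  by (simp add: cp_def)

lemma expectation_finite_sum:
  fixes f :: "'i \<Rightarrow> 'a \<Rightarrow> real"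
  assumes "finite (set_pmf H)"
  shows "expectation H (\<lambda>h. \<Sum>i\<in>I. f i h) = (\<Sum>i\<in>I. expectation H (f i))"
  by (rule Bochner_Integration.integral_sum) (auto intro: integrable_measure_pmf_finite[OF assms])

lemma expectation_mono:
  fixes f g :: "'a \<Rightarrow> real"
  assumes "finite (set_pmf H)" "\<And>h. h \<in> set_pmf H \<Longrightarrow> f h \<le> g h"
  shows "expectation H f \<le> expectation H g"
  using assms by (intro integral_mono_AE integrable_measure_pmf_finite) (auto simp: AE_measure_pmf_iff)

lemma expectation_of_bool:
  "expectation H (\<lambda>h. of_bool (P h)) = prob H {h. P h}"
proof -
  have "(\<lambda>h. of_bool (P h) :: real) = indicator {h. P h}" by (auto simp: indicator_def)
  then show ?thesis by simp
qed

text \<open>Slepian--Wolf: the true value is confused with another likely value of the same hash.\<close>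
lemma hash_collision:
  fixes \<theta> :: real
  assumes fin: "finite (set_pmf J)" and Ks: "finite Ks" "Ks \<noteq> {}"
    and H: "uhash H (A ` set_pmf J) (pmf_of_set Ks)" and th: "\<theta> > 0"
  shows "expectation H (\<lambda>h. prob J
           {w. \<exists>a\<in>A ` set_pmf J. a \<noteq> A w \<and> \<theta> \<le> cp J A E a (E w) \<and> h a = h (A w)})
         \<le> 1 / (card Ks * \<theta>)"
proof -
  let ?S = "A ` set_pmf J"
  have finH: "finite (set_pmf H)" using H by (simp add: uhash_def)
  have coll: "prob H {h. h a = h b} = 1 / card Ks" if "a \<in> ?S" "b \<in> ?S" "a \<noteq> b" for a b
  proof -
    have pair: "map_pmf (\<lambda>h. (h a, h b)) H = pmf_of_set (Ks \<times> Ks)"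
      using H that Ks unfolding uhash_def by (subst pmf_of_set_Times) auto
    have "prob H {h. h a = h b} = prob (map_pmf (\<lambda>h. (h a, h b)) H) {x. fst x = snd x}"
      by (simp add: vimage_def)
    also have "\<dots> = prob (pmf_of_set (Ks \<times> Ks)) {x. fst x = snd x}"
      by (simp only: pair)
    also have "\<dots> = card (Ks \<times> Ks \<inter> {x. fst x = snd x}) / card (Ks \<times> Ks)"
      using Ks by (subst measure_pmf_of_set) auto
    also have "Ks \<times> Ks \<inter> {x. fst x = snd x} = (\<lambda>k. (k, k)) ` Ks" by auto
    also have "card \<dots> = card Ks" by (rule card_image) (auto simp: inj_on_def)
    finally show ?thesis using Ks by (simp add: card_cartesian_product)
  qed
  let ?g = "\<lambda>w a. of_bool (a \<noteq> A w \<and> \<theta> \<le> cp J A E a (E w)) :: real"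
  have "expectation H (\<lambda>h. prob J
           {w. \<exists>a\<in>?S. a \<noteq> A w \<and> \<theta> \<le> cp J A E a (E w) \<and> h a = h (A w)})
     \<le> expectation H (\<lambda>h. \<Sum>w\<in>set_pmf J. \<Sum>a\<in>?S. pmf J w * ?g w a * of_bool (h a = h (A w)))"
  proof (rule expectation_mono[OF finH])
    fix h
    have le: "of_bool (\<exists>a\<in>?S. a \<noteq> A w \<and> \<theta> \<le> cp J A E a (E w) \<and> h a = h (A w))
        \<le> (\<Sum>a\<in>?S. ?g w a * of_bool (h a = h (A w)))" for w
    proof (cases "\<exists>a\<in>?S. a \<noteq> A w \<and> \<theta> \<le> cp J A E a (E w) \<and> h a = h (A w)")
      case True
      then obtain a where a: "a \<in> ?S" "a \<noteq> A w" "\<theta> \<le> cp J A E a (E w)" "h a = h (A w)" by blast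
      have "?g w a * of_bool (h a = h (A w)) \<le> (\<Sum>a\<in>?S. ?g w a * of_bool (h a = h (A w)))"
        using a(1) fin by (intro member_le_sum) auto
      then show ?thesis using a by (auto split: if_splits)
    qed (auto intro!: sum_nonneg)
    have "prob J {w. \<exists>a\<in>?S. a \<noteq> A w \<and> \<theta> \<le> cp J A E a (E w) \<and> h a = h (A w)}
      = (\<Sum>w\<in>set_pmf J. pmf J w * of_bool (\<exists>a\<in>?S. a \<noteq> A w \<and> \<theta> \<le> cp J A E a (E w) \<and> h a = h (A w)))"
      using fin by (subst prob_sum[of "set_pmf J"]) auto
    also have "\<dots> \<le> (\<Sum>w\<in>set_pmf J. pmf J w * (\<Sum>a\<in>?S. ?g w a * of_bool (h a = h (A w))))"
      by (intro sum_mono mult_left_mono le) auto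
    finally show "prob J {w. \<exists>a\<in>?S. a \<noteq> A w \<and> \<theta> \<le> cp J A E a (E w) \<and> h a = h (A w)}
      \<le> (\<Sum>w\<in>set_pmf J. \<Sum>a\<in>?S. pmf J w * ?g w a * of_bool (h a = h (A w)))"
      by (simp add: sum_distrib_left mult.assoc)
  qed
  also have "\<dots> = (\<Sum>w\<in>set_pmf J. \<Sum>a\<in>?S. pmf J w * ?g w a * prob H {h. h a = h (A w)})"
    by (simp add: expectation_finite_sum[OF finH] expectation_of_bool)
  also have "\<dots> = (\<Sum>w\<in>set_pmf J. \<Sum>a\<in>?S. pmf J w * ?g w a * (1 / card Ks))"
    by (intro sum.cong refl) (auto simp: coll)
  \<comment> \<open>An indicator of \<open>\<theta> \<le> cp\<close> is at most
    \<open>cp / \<theta>\<close>. Conditional probabilities sum to 1, so on average at most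
    \<open>1 / \<theta>\<close> values compete with the true one.\<close>
  also have "\<dots> \<le> (\<Sum>w\<in>set_pmf J. \<Sum>a\<in>?S. pmf J w * (cp J A E a (E w) / \<theta>) * (1 / card Ks))"
    using th by (intro sum_mono mult_right_mono mult_left_mono) (auto simp: field_simps cp_nonneg)
  also have "\<dots> = (\<Sum>w\<in>set_pmf J. pmf J w * (\<Sum>a\<in>?S. cp J A E a (E w)) * (1 / (card Ks * \<theta>)))"
    by (simp add: sum_distrib_left sum_distrib_right sum_divide_distrib mult.commute)
  also have "\<dots> = 1 / (card Ks * \<theta>)"
    using fin by (simp add: sum_cp_eq_1 sum_distrib_right[symmetric] sum_divide_distrib[symmetric] sum_pmf_eq_1)
  finally show ?thesis .
qed

text \<open>The variance of the absolute value of \<open>X\<close> is nonnegative.\<close>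

lemma expectation_le_sqrt:
  fixes X :: "'a \<Rightarrow> real"
  assumes "finite (set_pmf H)"
  shows "expectation H (\<lambda>h. \<bar>X h\<bar>) \<le> sqrt (expectation H (\<lambda>h. (X h)\<^sup>2))"
proof (rule real_le_rsqrt)
  let ?m = "expectation H (\<lambda>h. \<bar>X h\<bar>)"
  note int = integrable_measure_pmf_finite[OF assms]
  have "0 \<le> expectation H (\<lambda>h. (\<bar>X h\<bar> - ?m)\<^sup>2)"
    by (rule Bochner_Integration.integral_nonneg) auto
  also have "\<dots> = expectation H (\<lambda>h. (X h)\<^sup>2 - 2 * ?m * \<bar>X h\<bar> + ?m\<^sup>2)"
    by (intro Bochner_Integration.integral_cong refl) (simp add: power2_diff algebra_simps)
  also have "\<dots> = expectation H (\<lambda>h. (X h)\<^sup>2) - 2 * ?m * ?m + ?m\<^sup>2"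
    by (simp add: int)
  finally show "?m\<^sup>2 \<le> expectation H (\<lambda>h. (X h)\<^sup>2)"
    by (simp add: power2_eq_square)
qed

text \<open>
  Leftover hash lemma.  \<open>G c d\<close> is the collision probability of \<open>c, d\<close> relative to independence,
  \<open>T\<close> is the set of typical pairs.
\<close>
lemma hash_uniform_gen:
  fixes ch :: "'h \<Rightarrow> 'c \<Rightarrow> 'k" and C :: "'o \<Rightarrow> 'c" and E :: "'o \<Rightarrow> 'e"
  assumes fin: "finite (set_pmf J)" and Ks: "finite Ks" "Ks \<noteq> {}" and finH: "finite (set_pmf H)"
    and rng: "\<And>h c. h \<in> set_pmf H \<Longrightarrow> ch h c \<in> Ks"
    and m1: "\<And>c k. c \<in> C ` set_pmf J \<Longrightarrow> k \<in> Ks \<Longrightarrow> prob H {h. ch h c = k} = 1 / card Ks"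
    and m2: "\<And>c d k. c \<in> C ` set_pmf J \<Longrightarrow> d \<in> C ` set_pmf J \<Longrightarrow> k \<in> Ks \<Longrightarrow>
        prob H {h. ch h c = k \<and> ch h d = k} = G c d / (card Ks)\<^sup>2"
    and T: "\<And>c e. c \<in> C ` set_pmf J \<Longrightarrow> e \<in> E ` set_pmf J \<Longrightarrow> T c e \<Longrightarrow>
        (\<Sum>d\<in>C ` set_pmf J. of_bool (T d e) * pmf (map_pmf (C \<star> E) J) (d, e) * (G c d - 1))
          \<le> \<tau> * pmf (map_pmf E J) e"
    and tau: "0 \<le> \<tau>"
  shows "expectation H (\<lambda>h. l1 (map_pmf (\<lambda>w. (ch h (C w), E w)) J)
             (pair_pmf (pmf_of_set Ks) (map_pmf E J)))
       \<le> 2 * prob J {w. \<not> T (C w) (E w)} + sqrt \<tau>"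
proof -
  let ?S = "C ` set_pmf J" and ?R = "E ` set_pmf J" and ?K = "real (card Ks)"
  have K: "?K > 0" using Ks by (simp add: card_gt_0_iff)
  note int = integrable_measure_pmf_finite[OF finH]
  define p where "p c e = pmf (map_pmf (C \<star> E) J) (c, e)" for c e
  define pe where "pe e = pmf (map_pmf E J) e" for e
  \<comment> \<open>The mass of typical pairs. The second moment is controlled on these only; the
    atypical mass is split off before squaring and enters linearly.\<close>
  define q where "q c e = of_bool (T c e) * p c e" for c e
  define X where "X h k e = (\<Sum>c\<in>?S. q c e * of_bool (ch h c = k))" for h k e
  define qe where "qe e = (\<Sum>c\<in>?S. q c e)" for e
  have p0: "0 \<le> p c e" for c e by (simp add: p_def)
  have q0: "0 \<le> q c e" "q c e \<le> p c e" for c e by (auto simp: q_def p0)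
  have sump: "(\<Sum>c\<in>?S. p c e) = pe e" for e
    by (simp only: p_def pe_def pmf_marginal[OF fin])
  have joint: "pmf (map_pmf (\<lambda>w. (ch h (C w), E w)) J) (k, e) = (\<Sum>c\<in>?S. p c e * of_bool (ch h c = k))" for h k e
    unfolding p_def using pmf_marginal_sum[OF fin, of "ch h" k C E e] by (simp add: mult.commute)
  have bad: "(\<Sum>e\<in>?R. \<Sum>c\<in>?S. p c e - q c e) = prob J {w. \<not> T (C w) (E w)}"
  proof -
    have "(\<Sum>e\<in>?R. \<Sum>c\<in>?S. p c e - q c e) = (\<Sum>(e, c)\<in>?R \<times> ?S. p c e - q c e)"
      by (simp add: sum.cartesian_product)
    also have "\<dots> = (\<Sum>x\<in>?S \<times> ?R. pmf (map_pmf (C \<star> E) J) x * of_bool (\<not> T (fst x) (snd x)))"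
      by (rule sum.reindex_bij_witness[of _ prod.swap prod.swap]) (auto simp: p_def q_def)
    also have "\<dots> = (\<Sum>w\<in>set_pmf J. pmf J w * of_bool (\<not> T (C w) (E w)))"
      using fin by (subst sum_pmf_map) auto
    finally show ?thesis using fin by (simp add: prob_sum[of "set_pmf J"])
  qed
  \<comment> \<open>The removed mass is paid for twice, once in the hashed law and once in the
    uniform law that it is compared with.\<close>
  have point: "l1 (map_pmf (\<lambda>w. (ch h (C w), E w)) J) (pair_pmf (pmf_of_set Ks) (map_pmf E J))
     \<le> (\<Sum>k\<in>Ks. \<Sum>e\<in>?R. \<bar>X h k e - qe e / ?K\<bar>) + 2 * prob J {w. \<not> T (C w) (E w)}"
    if h: "h \<in> set_pmf H" for h
  proof -
    have "l1 (map_pmf (\<lambda>w. (ch h (C w), E w)) J) (pair_pmf (pmf_of_set Ks) (map_pmf E J))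
        = (\<Sum>k\<in>Ks. \<Sum>e\<in>?R. \<bar>(\<Sum>c\<in>?S. p c e * of_bool (ch h c = k)) - pe e / ?K\<bar>)"
      using fin Ks rng[OF h]
      by (subst l1_superset[of "Ks \<times> ?R"])
         (auto simp: sum.cartesian_product joint pmf_pair pe_def pmf_of_set[OF Ks(2,1)] intro!: sum.cong)
    also have "\<dots> \<le> (\<Sum>k\<in>Ks. \<Sum>e\<in>?R. \<bar>X h k e - qe e / ?K\<bar>
        + ((\<Sum>c\<in>?S. (p c e - q c e) * of_bool (ch h c = k)) + (\<Sum>c\<in>?S. p c e - q c e) / ?K))"
    proof (intro sum_mono)
      fix k e
      have a: "(\<Sum>c\<in>?S. p c e * of_bool (ch h c = k)) = X h k e + (\<Sum>c\<in>?S. (p c e - q c e) * of_bool (ch h c = k))"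
        by (simp add: X_def sum.distrib[symmetric] algebra_simps)
      have b: "pe e / ?K = qe e / ?K + (\<Sum>c\<in>?S. p c e - q c e) / ?K"
        by (simp add: qe_def sum_subtractf sump add_divide_distrib[symmetric])
      have c: "0 \<le> (\<Sum>c\<in>?S. (p c e - q c e) * of_bool (ch h c = k))" "0 \<le> (\<Sum>c\<in>?S. p c e - q c e) / ?K"
        using q0 by (auto intro!: sum_nonneg divide_nonneg_nonneg)
      show "\<bar>(\<Sum>c\<in>?S. p c e * of_bool (ch h c = k)) - pe e / ?K\<bar> \<le> \<bar>X h k e - qe e / ?K\<bar>
        + ((\<Sum>c\<in>?S. (p c e - q c e) * of_bool (ch h c = k)) + (\<Sum>c\<in>?S. p c e - q c e) / ?K)"
        unfolding a b using c by linarith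
    qed
    also have "\<dots> = (\<Sum>k\<in>Ks. \<Sum>e\<in>?R. \<bar>X h k e - qe e / ?K\<bar>)
        + ((\<Sum>k\<in>Ks. \<Sum>e\<in>?R. \<Sum>c\<in>?S. (p c e - q c e) * of_bool (ch h c = k))
        + (\<Sum>k\<in>Ks. \<Sum>e\<in>?R. (\<Sum>c\<in>?S. p c e - q c e) / ?K))"
      by (simp only: sum.distrib)
    also have "(\<Sum>k\<in>Ks. \<Sum>e\<in>?R. (\<Sum>c\<in>?S. p c e - q c e) / ?K) = prob J {w. \<not> T (C w) (E w)}"
      using K by (simp add: bad sum_divide_distrib[symmetric])
    also have "(\<Sum>k\<in>Ks. \<Sum>e\<in>?R. \<Sum>c\<in>?S. (p c e - q c e) * of_bool (ch h c = k))
        = (\<Sum>e\<in>?R. \<Sum>c\<in>?S. \<Sum>k\<in>Ks. (p c e - q c e) * of_bool (ch h c = k))"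
      by (subst sum.swap, rule sum.cong, rule refl, subst sum.swap, rule refl)
    also have "\<dots> = (\<Sum>e\<in>?R. \<Sum>c\<in>?S. p c e - q c e)"
      using rng[OF h] Ks by (intro sum.cong refl) (simp add: of_bool_def if_distrib sum.delta cong: if_cong)
    also have "\<dots> = prob J {w. \<not> T (C w) (E w)}" by (rule bad)
    finally show ?thesis by simp
  qed
  \<comment> \<open>The indicators of \<open>ch h c = k\<close> and \<open>ch h d = k\<close> have
    covariance \<open>(G c d - 1) / K^2\<close> for \<open>K = card Ks\<close>. For a typical
    \<open>c\<close> the sum over \<open>d\<close> is bounded by hypothesis, and summing over
    \<open>c\<close> gives a second factor \<open>pe e\<close>.\<close>
  have second: "expectation H (\<lambda>h. (X h k e - qe e / ?K)\<^sup>2) \<le> (sqrt \<tau> * pe e / ?K)\<^sup>2"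
    if k: "k \<in> Ks" and e: "e \<in> ?R" for k e
  proof -
    have m1': "expectation H (\<lambda>h. of_bool (ch h c = k)) = 1 / ?K" if "c \<in> ?S" for c
      by (simp only: expectation_of_bool m1[OF that k])
    have m2': "expectation H (\<lambda>h. of_bool (ch h c = k) * of_bool (ch h d = k)) = G c d / ?K\<^sup>2"
      if "c \<in> ?S" "d \<in> ?S" for c d
      using m2[OF that k] by (simp only: of_bool_conj[symmetric] expectation_of_bool of_nat_power)
    have cov: "expectation H (\<lambda>h. (of_bool (ch h c = k) - 1 / ?K) * (of_bool (ch h d = k) - 1 / ?K))
        = (G c d - 1) / ?K\<^sup>2" if cd: "c \<in> ?S" "d \<in> ?S" for c d
    proof -
      have gen: "(x - a) * (y - a) = x * y - a * x - a * y + a * a" for x y a :: real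
        by (simp add: algebra_simps)
      have "expectation H (\<lambda>h. (of_bool (ch h c = k) - 1 / ?K) * (of_bool (ch h d = k) - 1 / ?K))
        = expectation H (\<lambda>h. of_bool (ch h c = k) * of_bool (ch h d = k)
            - 1 / ?K * of_bool (ch h c = k) - 1 / ?K * of_bool (ch h d = k) + 1 / ?K * (1 / ?K))"
        by (simp only: gen)
      also have "\<dots> = expectation H (\<lambda>h. of_bool (ch h c = k) * of_bool (ch h d = k))
          - 1 / ?K * expectation H (\<lambda>h. of_bool (ch h c = k))
          - 1 / ?K * expectation H (\<lambda>h. of_bool (ch h d = k)) + 1 / ?K * (1 / ?K)"
        by (subst Bochner_Integration.integral_add Bochner_Integration.integral_diff integral_mult_right_zero,
            (rule int)+)+ simp
      also have "\<dots> = (G c d - 1) / ?K\<^sup>2"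
        unfolding m1'[OF cd(1)] m1'[OF cd(2)] m2'[OF cd] by (simp add: diff_divide_distrib power2_eq_square)
      finally show ?thesis .
    qed
    have "expectation H (\<lambda>h. (X h k e - qe e / ?K)\<^sup>2)
       = expectation H (\<lambda>h. \<Sum>c\<in>?S. \<Sum>d\<in>?S. q c e * q d e *
            ((of_bool (ch h c = k) - 1 / ?K) * (of_bool (ch h d = k) - 1 / ?K)))"
    proof (intro Bochner_Integration.integral_cong refl)
      fix h
      have "X h k e - qe e / ?K = (\<Sum>c\<in>?S. q c e * (of_bool (ch h c = k) - 1 / ?K))"
        by (simp add: X_def qe_def right_diff_distrib sum_subtractf sum_divide_distrib)
      then show "(X h k e - qe e / ?K)\<^sup>2 = (\<Sum>c\<in>?S. \<Sum>d\<in>?S. q c e * q d e *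
            ((of_bool (ch h c = k) - 1 / ?K) * (of_bool (ch h d = k) - 1 / ?K)))"
        by (simp add: power2_eq_square sum_product mult_ac)
    qed
    also have "\<dots> = (\<Sum>c\<in>?S. \<Sum>d\<in>?S. q c e * q d e * ((G c d - 1) / ?K\<^sup>2))"
      unfolding expectation_finite_sum[OF finH] integral_mult_right_zero
      by (intro sum.cong refl) (simp add: cov)
    also have "\<dots> = (\<Sum>c\<in>?S. q c e * (\<Sum>d\<in>?S. q d e * (G c d - 1))) / ?K\<^sup>2"
      by (simp add: sum_distrib_left sum_divide_distrib mult.assoc)
    also have "\<dots> \<le> (\<Sum>c\<in>?S. p c e * (\<tau> * pe e)) / ?K\<^sup>2"
    proof (intro divide_right_mono sum_mono)
      fix c assume c: "c \<in> ?S"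
      show "q c e * (\<Sum>d\<in>?S. q d e * (G c d - 1)) \<le> p c e * (\<tau> * pe e)"
      proof (cases "T c e")
        case True
        have "(\<Sum>d\<in>?S. q d e * (G c d - 1)) \<le> \<tau> * pe e"
          using T[OF c e True] by (simp add: q_def p_def pe_def)
        then have "q c e * (\<Sum>d\<in>?S. q d e * (G c d - 1)) \<le> q c e * (\<tau> * pe e)"
          using q0 by (intro mult_left_mono) auto
        also have "\<dots> = p c e * (\<tau> * pe e)" using True by (simp add: q_def)
        finally show ?thesis .
      next
        case False
        then show ?thesis using p0 tau by (simp add: q_def pe_def)
      qed
    qed auto
    also have "\<dots> = (sqrt \<tau> * pe e / ?K)\<^sup>2"
      using tau by (simp add: sum_distrib_right[symmetric] sump power_divide power_mult_distrib power2_eq_square)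
    finally show ?thesis .
  qed
  have "expectation H (\<lambda>h. l1 (map_pmf (\<lambda>w. (ch h (C w), E w)) J)
             (pair_pmf (pmf_of_set Ks) (map_pmf E J)))
     \<le> expectation H (\<lambda>h. (\<Sum>k\<in>Ks. \<Sum>e\<in>?R. \<bar>X h k e - qe e / ?K\<bar>)
          + 2 * prob J {w. \<not> T (C w) (E w)})"
    by (rule expectation_mono[OF finH point])
  also have "\<dots> = (\<Sum>k\<in>Ks. \<Sum>e\<in>?R. expectation H (\<lambda>h. \<bar>X h k e - qe e / ?K\<bar>))
          + 2 * prob J {w. \<not> T (C w) (E w)}"
    by (subst Bochner_Integration.integral_add) (auto simp: int expectation_finite_sum[OF finH])
  also have "(\<Sum>k\<in>Ks. \<Sum>e\<in>?R. expectation H (\<lambda>h. \<bar>X h k e - qe e / ?K\<bar>))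
      \<le> (\<Sum>k\<in>Ks. \<Sum>e\<in>?R. sqrt \<tau> * pe e / ?K)"
  proof (intro sum_mono)
    fix k e assume "k \<in> Ks" "e \<in> ?R"
    have "expectation H (\<lambda>h. \<bar>X h k e - qe e / ?K\<bar>)
        \<le> sqrt (expectation H (\<lambda>h. (X h k e - qe e / ?K)\<^sup>2))"
      by (rule expectation_le_sqrt[OF finH])
    also have "\<dots> \<le> sqrt ((sqrt \<tau> * pe e / ?K)\<^sup>2)"
      using second[OF \<open>k \<in> Ks\<close> \<open>e \<in> ?R\<close>] by (rule real_sqrt_le_mono)
    also have "\<dots> = sqrt \<tau> * pe e / ?K" using tau by (simp add: pe_def)
    finally show "expectation H (\<lambda>h. \<bar>X h k e - qe e / ?K\<bar>) \<le> sqrt \<tau> * pe e / ?K" .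
  qed
  also have "\<dots> = sqrt \<tau> * (\<Sum>e\<in>?R. pe e)"
    using K by (simp add: sum_distrib_left)
  also have "(\<Sum>e\<in>?R. pe e) = 1" unfolding pe_def using fin by (intro sum_pmf_eq_1) auto
  finally show ?thesis by simp
qed

lemma prob_pair_Times:
  assumes "finite (set_pmf p)" "finite (set_pmf q)"
  shows "prob (pair_pmf p q) (A \<times> B) = prob p A * prob q B"
proof -
  have "prob (pair_pmf p q) (A \<times> B)
      = (\<Sum>x\<in>set_pmf p \<times> set_pmf q. pmf (pair_pmf p q) x * of_bool (x \<in> A \<times> B))"
    using assms by (intro prob_sum) auto
  also have "\<dots> = (\<Sum>(x, y)\<in>set_pmf p \<times> set_pmf q. (pmf p x * of_bool (x \<in> A)) * (pmf q y * of_bool (y \<in> B)))"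
    by (intro sum.cong) (auto simp: pmf_pair)
  also have "\<dots> = (\<Sum>x\<in>set_pmf p. pmf p x * of_bool (x \<in> A)) * (\<Sum>y\<in>set_pmf q. pmf q y * of_bool (y \<in> B))"
    by (simp only: sum_product sum.cartesian_product)
  also have "\<dots> = prob p A * prob q B"
    using assms by (simp only: prob_sum[OF _ subset_refl])
  finally show ?thesis .
qed

lemma uhash_prob:
  assumes H: "uhash H S (pmf_of_set Ks)" and Ks: "finite Ks" "Ks \<noteq> {}" and k: "k \<in> Ks"
    and ab: "a \<in> S" "b \<in> S"
  shows "prob H {h. h a = k \<and> h b = k} = (if a = b then card Ks else 1) / (card Ks)\<^sup>2"
proof (cases "a = b")
  case True
  have "prob H {h. h a = k} = pmf (map_pmf (\<lambda>h. h a) H) k"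
    by (simp add: pmf_map vimage_def)
  then show ?thesis using True H ab Ks k
    by (simp add: uhash_def power2_eq_square)
next
  case False
  have "prob H {h. h a = k \<and> h b = k} = pmf (map_pmf (\<lambda>h. (h a, h b)) H) (k, k)"
    by (simp add: pmf_map vimage_def)
  also have "\<dots> = pmf (pair_pmf (pmf_of_set Ks) (pmf_of_set Ks)) (k, k)"
  proof -
    have "map_pmf (\<lambda>h. (h a, h b)) H = pair_pmf (pmf_of_set Ks) (pmf_of_set Ks)"
      using H ab False by (simp add: uhash_def)
    then show ?thesis by (simp only:)
  qed
  finally show ?thesis using False Ks k by (simp add: pmf_pair power2_eq_square)
qed

text \<open>For independent hashes the collision factor is a product, and \<open>G - 1\<close> is a
  sum of three terms: first components agree, second components agree, both agree. Each term has its
  own typicality condition, whence \<open>3 * \<tau>\<close>; asymptotically they bound the two hash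
  rates and their sum by conditional entropies. The factors \<open>card - 1\<close> instead of
  \<open>card\<close> make a hash with a single value free of charge.\<close>

lemma hash_uniform2:
  assumes fin: "finite (set_pmf J)"
    and KA: "finite KA" "KA \<noteq> {}" and KB: "finite KB" "KB \<noteq> {}"
    and HA: "uhash HA (A ` set_pmf J) (pmf_of_set KA)"
    and HB: "uhash HB (B ` set_pmf J) (pmf_of_set KB)" and tau: "0 \<le> \<tau>"
  shows "expectation (pair_pmf HA HB) (\<lambda>h. l1 (map_pmf (\<lambda>w. ((fst h (A w), snd h (B w)), E w)) J)
             (pair_pmf (pmf_of_set (KA \<times> KB)) (map_pmf E J)))
       \<le> 2 * (prob J {w. \<tau> < (real (card KA) - 1) * cp J A E (A w) (E w)}
            + prob J {w. \<tau> < (real (card KB) - 1) * cp J B E (B w) (E w)}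
            + prob J {w. \<tau> < (real (card KA) - 1) * (real (card KB) - 1) *
                 cp J (A \<star> B) E (A w, B w) (E w)})
         + sqrt (3 * \<tau>)"
proof -
  let ?H = "pair_pmf HA HB" and ?C = "A \<star> B"
  let ?ka = "real (card KA)" and ?kb = "real (card KB)"
  let ?T = "\<lambda>c e. (?ka - 1) * cp J A E (fst c) e \<le> \<tau> \<and> (?kb - 1) * cp J B E (snd c) e \<le> \<tau>
      \<and> (?ka - 1) * (?kb - 1) * cp J ?C E c e \<le> \<tau>"
  let ?G = "\<lambda>c d. (if fst c = fst d then ?ka else 1) * (if snd c = snd d then ?kb else 1)"
  have finA: "finite (set_pmf HA)" and finB: "finite (set_pmf HB)"
    using HA HB by (auto simp: uhash_def)
  have ka: "?ka \<ge> 1" and kb: "?kb \<ge> 1"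
    using KA KB by (simp_all add: Suc_le_eq card_gt_0_iff)
  have pm: "prob ?H {h. (fst h (fst c), snd h (snd c)) = k \<and> (fst h (fst d), snd h (snd d)) = k}
      = ?G c d / (card (KA \<times> KB))\<^sup>2"
    if c: "c \<in> ?C ` set_pmf J" and d: "d \<in> ?C ` set_pmf J" and k: "k \<in> KA \<times> KB" for c d k
  proof -
    have "{h. (fst h (fst c), snd h (snd c)) = k \<and> (fst h (fst d), snd h (snd d)) = k}
        = {f. f (fst c) = fst k \<and> f (fst d) = fst k} \<times> {g. g (snd c) = snd k \<and> g (snd d) = snd k}"
      by (auto simp: prod_eq_iff)
    then have "prob ?H {h. (fst h (fst c), snd h (snd c)) = k \<and> (fst h (fst d), snd h (snd d)) = k}
        = prob HA {f. f (fst c) = fst k \<and> f (fst d) = fst k}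
        * prob HB {g. g (snd c) = snd k \<and> g (snd d) = snd k}"
      by (simp add: prob_pair_Times finA finB)
    also have "\<dots> = ?G c d / (card (KA \<times> KB))\<^sup>2"
    proof -
      have cd: "fst c \<in> A ` set_pmf J" "fst d \<in> A ` set_pmf J" "snd c \<in> B ` set_pmf J" "snd d \<in> B ` set_pmf J"
        "fst k \<in> KA" "snd k \<in> KB"
        using c d k by auto
      show ?thesis
        unfolding uhash_prob[OF HA KA cd(5,1,2)] uhash_prob[OF HB KB cd(6,3,4)]
        by (simp add: card_cartesian_product power_mult_distrib)
    qed
    finally show ?thesis .
  qed
  have "expectation ?H (\<lambda>h. l1 (map_pmf (\<lambda>w. ((\<lambda>c. (fst h (fst c), snd h (snd c))) (A w, B w), E w)) J)
             (pair_pmf (pmf_of_set (KA \<times> KB)) (map_pmf E J)))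
       \<le> 2 * prob J {w. \<not> ?T (A w, B w) (E w)} + sqrt (3 * \<tau>)"
  proof (rule hash_uniform_gen[where G = ?G])
    show "finite (KA \<times> KB)" "KA \<times> KB \<noteq> {}" using KA KB by auto
    fix h c assume "h \<in> set_pmf ?H"
    then have "fst h \<in> set_pmf HA" "snd h \<in> set_pmf HB" by auto
    then have "range (fst h) \<subseteq> KA" "range (snd h) \<subseteq> KB"
      using HA HB KA KB by (auto simp: uhash_def)
    then show "(fst h (fst c), snd h (snd c)) \<in> KA \<times> KB" by auto
  next
    fix c k assume c: "c \<in> ?C ` set_pmf J" and k: "k \<in> KA \<times> KB"
    show "prob ?H {h. (fst h (fst c), snd h (snd c)) = k} = 1 / real (card (KA \<times> KB))"
      using pm[OF c c k] ka kb by (simp add: card_cartesian_product power2_eq_square)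
  next
    fix c e assume c: "c \<in> ?C ` set_pmf J" and e: "e \<in> E ` set_pmf J" and T: "?T c e"
    let ?P = "\<lambda>d. pmf (map_pmf (?C \<star> E) J) (d, e)"
    have pe: "pmf (map_pmf E J) e > 0"
      using e by (intro pmf_positive) auto
    have "(\<Sum>d\<in>?C ` set_pmf J. of_bool (?T d e) * ?P d * (?G c d - 1))
       \<le> (\<Sum>d\<in>?C ` set_pmf J. (?ka - 1) * (of_bool (fst d = fst c) * ?P d) + (?kb - 1) * (of_bool (snd d = snd c) * ?P d)
            + (?ka - 1) * (?kb - 1) * (of_bool (d = c) * ?P d))"
    proof (rule sum_mono)
      fix d
      have G: "?G c d - 1 = (?ka - 1) * of_bool (fst d = fst c) + (?kb - 1) * of_bool (snd d = snd c)
            + (?ka - 1) * (?kb - 1) * of_bool (d = c)"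
        by (cases c; cases d; auto simp: algebra_simps)
      have G0: "0 \<le> ?G c d - 1" unfolding G using ka kb by (intro add_nonneg_nonneg mult_nonneg_nonneg) auto
      have "of_bool (?T d e) * ?P d * (?G c d - 1) \<le> ?P d * (?G c d - 1)"
        using G0 by (intro mult_right_mono) auto
      also have "\<dots> = (?ka - 1) * (of_bool (fst d = fst c) * ?P d) + (?kb - 1) * (of_bool (snd d = snd c) * ?P d)
            + (?ka - 1) * (?kb - 1) * (of_bool (d = c) * ?P d)"
        unfolding G by (simp add: algebra_simps)
      finally show "of_bool (?T d e) * ?P d * (?G c d - 1) \<le> (?ka - 1) * (of_bool (fst d = fst c) * ?P d)
            + (?kb - 1) * (of_bool (snd d = snd c) * ?P d) + (?ka - 1) * (?kb - 1) * (of_bool (d = c) * ?P d)" .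
    qed
    also have "\<dots> = (?ka - 1) * pmf (map_pmf (A \<star> E) J) (fst c, e)
        + (?kb - 1) * pmf (map_pmf (B \<star> E) J) (snd c, e) + (?ka - 1) * (?kb - 1) * ?P c"
      unfolding sum.distrib sum_distrib_left[symmetric]
      using pmf_marginal_sum[OF fin, of fst "fst c" ?C E e] pmf_marginal_sum[OF fin, of snd "snd c" ?C E e]
        pmf_marginal_sum[OF fin, of "\<lambda>x. x" "c" ?C E e] by simp
    also have "\<dots> = ((?ka - 1) * cp J A E (fst c) e + (?kb - 1) * cp J B E (snd c) e
        + (?ka - 1) * (?kb - 1) * cp J ?C E c e) * pmf (map_pmf E J) e"
      using pe by (simp add: cp_def field_simps)
    also have "\<dots> \<le> (3 * \<tau>) * pmf (map_pmf E J) e"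
      using T by (intro mult_right_mono) auto
    finally show "(\<Sum>d\<in>?C ` set_pmf J. of_bool (?T d e) * ?P d * (?G c d - 1)) \<le> (3 * \<tau>) * pmf (map_pmf E J) e" .
  qed (use fin tau pm finA finB in auto)
  also have "prob J {w. \<not> ?T (A w, B w) (E w)}
      \<le> prob J {w. \<tau> < (?ka - 1) * cp J A E (A w) (E w)}
            + prob J {w. \<tau> < (?kb - 1) * cp J B E (B w) (E w)}
            + prob J {w. \<tau> < (?ka - 1) * (?kb - 1) * cp J ?C E (A w, B w) (E w)}"
  proof -
    have "{w. \<not> ?T (A w, B w) (E w)} = {w. \<tau> < (?ka - 1) * cp J A E (A w) (E w)}
            \<union> {w. \<tau> < (?kb - 1) * cp J B E (B w) (E w)}
            \<union> {w. \<tau> < (?ka - 1) * (?kb - 1) * cp J ?C E (A w, B w) (E w)}" by auto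
    then show ?thesis
      by (simp only:) (intro order_trans[OF measure_Un_le] add_right_mono; simp)
  qed
  finally show ?thesis by simp
qed

text \<open>The two-source bound with a trivial second source: its range has one element, so two of
  the three exceptional events become \<open>\<tau> < 0\<close>.\<close>

lemma hash_uniform1:
  assumes fin: "finite (set_pmf J)" and KA: "finite KA" "KA \<noteq> {}"
    and HA: "uhash HA (A ` set_pmf J) (pmf_of_set KA)" and tau: "0 \<le> \<tau>"
  shows "expectation HA (\<lambda>h. l1 (map_pmf (\<lambda>w. (h (A w), E w)) J)
             (pair_pmf (pmf_of_set KA) (map_pmf E J)))
       \<le> 2 * prob J {w. \<tau> < (real (card KA) - 1) * cp J A E (A w) (E w)} + sqrt (3 * \<tau>)"
proof -
  let ?HB = "return_pmf (\<lambda>_::unit. ())"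
  have HB: "uhash ?HB ((\<lambda>_. ()) ` set_pmf J) (pmf_of_set {()})"
    by (auto simp: uhash_def pmf_of_set_singleton)
  have "expectation HA (\<lambda>h. l1 (map_pmf (\<lambda>w. (h (A w), E w)) J)
             (pair_pmf (pmf_of_set KA) (map_pmf E J)))
     \<le> expectation HA (\<lambda>h. l1 (map_pmf (\<lambda>w. ((h (A w), ()), E w)) J)
             (pair_pmf (pmf_of_set (KA \<times> {()})) (map_pmf E J)))"
  proof (rule expectation_mono)
    show "finite (set_pmf HA)" using HA by (simp add: uhash_def)
    fix h assume "h \<in> set_pmf HA"
    have "pair_pmf (pmf_of_set KA) (map_pmf E J)
        = map_pmf (\<lambda>(x, e). (fst x, e)) (pair_pmf (pmf_of_set (KA \<times> {()})) (map_pmf E J))"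
      using KA map_pair[of fst "\<lambda>x. x" "pmf_of_set (KA \<times> {()})" "map_pmf E J"]
      by (simp add: pmf_of_set_Times map_fst_pair_pmf)
    moreover have "map_pmf (\<lambda>w. (h (A w), E w)) J = map_pmf (\<lambda>(x, e). (fst x, e)) (map_pmf (\<lambda>w. ((h (A w), ()), E w)) J)"
      by (simp add: pmf.map_comp o_def)
    ultimately show "l1 (map_pmf (\<lambda>w. (h (A w), E w)) J) (pair_pmf (pmf_of_set KA) (map_pmf E J))
       \<le> l1 (map_pmf (\<lambda>w. ((h (A w), ()), E w)) J) (pair_pmf (pmf_of_set (KA \<times> {()})) (map_pmf E J))"
      using fin KA by (simp only:) (rule l1_map; simp)
  qed
  also have "\<dots> = expectation (pair_pmf HA ?HB) (\<lambda>h. l1 (map_pmf (\<lambda>w. ((fst h (A w), snd h ()), E w)) J)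
             (pair_pmf (pmf_of_set (KA \<times> {()})) (map_pmf E J)))"
    by (simp add: pair_return_pmf2)
  also have "\<dots> \<le> 2 * prob J {w. \<tau> < (real (card KA) - 1) * cp J A E (A w) (E w)} + sqrt (3 * \<tau>)"
    using hash_uniform2[OF fin KA _ _ HA HB tau, of E] tau by simp
  finally show ?thesis .
qed

section \<open>From the source to codes\<close>

text \<open>The default \<open>Q\<close> for impossible values keeps the support inside that of
  \<open>Q\<close>. A code built from it therefore produces blocks of the right length for every
  message and every public value.\<close>

definition condp :: "'q pmf \<Rightarrow> ('q \<Rightarrow> 'x) \<Rightarrow> 'x \<Rightarrow> 'q pmf" where
  "condp Q X x = (if x \<in> X ` set_pmf Q then cond_pmf Q {q. X q = x} else Q)"

lemma set_condp: "set_pmf (condp Q X x) \<subseteq> set_pmf Q"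
proof (cases "x \<in> X ` set_pmf Q")
  case True
  then have "set_pmf Q \<inter> {q. X q = x} \<noteq> {}" by auto
  then show ?thesis using True using set_cond_pmf[of Q "{q. X q = x}"] by (auto simp add: condp_def)
qed (simp add: condp_def)

lemma finite_condp [simp]: "finite (set_pmf Q) \<Longrightarrow> finite (set_pmf (condp Q X x))"
  by (rule finite_subset[OF set_condp])

lemma pmf_condp:
  assumes "x \<in> X ` set_pmf Q"
  shows "pmf (map_pmf X Q) x * pmf (condp Q X x) q = of_bool (X q = x) * pmf Q q"
proof -
  have ne: "set_pmf Q \<inter> {q. X q = x} \<noteq> {}" using assms by auto
  have P: "pmf (map_pmf X Q) x = prob Q {q. X q = x}"
    by (simp add: pmf_map vimage_def)
  have "x \<in> set_pmf (map_pmf X Q)" using assms by simp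
  then have "pmf (map_pmf X Q) x \<noteq> 0" by (metis set_pmf_iff)
  then show ?thesis using assms P by (simp add: condp_def pmf_cond[OF ne])
qed

lemma bind_condp:
  assumes "finite (set_pmf Q)"
  shows "bind_pmf (map_pmf X Q) (\<lambda>x. bind_pmf (condp Q X x) (F x)) = bind_pmf Q (\<lambda>q. F (X q) q)"
proof (rule pmf_eqI)
  fix y
  have "pmf (bind_pmf (map_pmf X Q) (\<lambda>x. bind_pmf (condp Q X x) (F x))) y
     = (\<Sum>x\<in>X ` set_pmf Q. pmf (map_pmf X Q) x * (\<Sum>q\<in>set_pmf Q. pmf (condp Q X x) q * pmf (F x q) y))"
    using assms by (subst pmf_bind_sum[of "X ` set_pmf Q"], simp, simp, subst pmf_bind_sum[OF assms set_condp], simp)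
  also have "\<dots> = (\<Sum>x\<in>X ` set_pmf Q. \<Sum>q\<in>set_pmf Q. pmf (map_pmf X Q) x * pmf (condp Q X x) q * pmf (F x q) y)"
    by (simp add: sum_distrib_left mult.assoc)
  also have "\<dots> = (\<Sum>x\<in>X ` set_pmf Q. \<Sum>q\<in>set_pmf Q. if X q = x then pmf Q q * pmf (F (X q) q) y else 0)"
    by (intro sum.cong refl) (auto simp: pmf_condp)
  also have "\<dots> = (\<Sum>q\<in>set_pmf Q. pmf Q q * pmf (F (X q) q) y)"
    using assms by (subst sum.swap) (auto simp: sum.delta' intro!: sum.cong)
  finally show "pmf (bind_pmf (map_pmf X Q) (\<lambda>x. bind_pmf (condp Q X x) (F x))) y
      = pmf (bind_pmf Q (\<lambda>q. F (X q) q)) y"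
    by (simp add: pmf_bind_sum[OF assms subset_refl])
qed

definition source :: "'q pmf \<Rightarrow> 'r pmf \<Rightarrow> ('q \<Rightarrow> 'r \<Rightarrow> 'o pmf) \<Rightarrow> ('q \<times> 'r \<times> 'o) pmf" where
  "source Q R \<kappa> = bind_pmf Q (\<lambda>q. bind_pmf R (\<lambda>r. map_pmf (\<lambda>c. (q, r, c)) (\<kappa> q r)))"

text \<open>
  The law induced by a code with public randomness \<open>fg\<close>.  In \<open>l1_coded\<close> the public randomness has the
  law of the source hashes instead of the uniform law, so that only the messages have to be nearly
  uniform; this matters when no message can be put on \<open>U\<close>.
\<close>
definition coded :: "'q pmf \<Rightarrow> 'r pmf \<Rightarrow> ('q \<Rightarrow> 'r \<Rightarrow> 'o pmf) \<Rightarrow> ('q \<Rightarrow> 'f) \<Rightarrow> ('q \<Rightarrow> 'm) \<Rightarrow> ('r \<Rightarrow> 'g)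
    \<Rightarrow> 'm pmf \<Rightarrow> 'f \<times> 'g \<Rightarrow> ('m \<times> 'q \<times> 'r \<times> 'o) pmf" where
  "coded Q R \<kappa> fq mq fr U fg = bind_pmf U (\<lambda>m. map_pmf (Pair m)
     (source (condp Q (\<lambda>q. (fq q, mq q)) (fst fg, m)) (condp R fr (snd fg)) \<kappa>))"

lemma finite_source:
  assumes "finite (set_pmf Q)" "finite (set_pmf R)" "\<And>q r. finite (set_pmf (\<kappa> q r))"
  shows "finite (set_pmf (source Q R \<kappa>))"
  using assms by (auto simp: source_def)

lemma finite_coded:
  assumes "finite (set_pmf Q)" "finite (set_pmf R)" "\<And>q r. finite (set_pmf (\<kappa> q r))" "finite (set_pmf U)"
  shows "finite (set_pmf (coded Q R \<kappa> fq mq fr U fg))"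
  using assms by (auto simp: coded_def intro!: finite_source)

text \<open>The source can be regenerated from its hash values by the kernel \<open>Kern\<close>,
  and the coded law is the same kernel applied to other hash values. Data processing leaves the
  distance between the two inputs. The hash of the relay block is drawn inside \<open>Kern\<close>,
  with its exact law on both sides.\<close>

lemma l1_coded:
  assumes fin: "finite (set_pmf Q)" "finite (set_pmf R)" "\<And>q r. finite (set_pmf (\<kappa> q r))" "finite (set_pmf U)"
  shows "l1 (map_pmf (\<lambda>(q, r, c). ((fq q, fr r), mq q, q, r, c)) (source Q R \<kappa>))
            (bind_pmf (pair_pmf (map_pmf fq Q) (map_pmf fr R)) (\<lambda>fg. map_pmf (Pair fg) (coded Q R \<kappa> fq mq fr U fg)))
       \<le> l1 (map_pmf (\<lambda>q. (fq q, mq q)) Q) (pair_pmf (map_pmf fq Q) U)"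
proof -
  define Kern where "Kern = (\<lambda>fm. bind_pmf (condp Q (\<lambda>q. (fq q, mq q)) fm) (\<lambda>q. bind_pmf (map_pmf fr R)
      (\<lambda>g. bind_pmf (condp R fr g) (\<lambda>r. map_pmf (\<lambda>c. ((fst fm, g), snd fm, q, r, c)) (\<kappa> q r)))))"
  have 1: "map_pmf (\<lambda>(q, r, c). ((fq q, fr r), mq q, q, r, c)) (source Q R \<kappa>)
      = bind_pmf (map_pmf (\<lambda>q. (fq q, mq q)) Q) Kern"
    unfolding Kern_def source_def
    by (subst bind_condp[OF fin(1)], subst bind_condp[OF fin(2)])
       (simp add: map_bind_pmf pmf.map_comp o_def)
  have 2: "bind_pmf (pair_pmf (map_pmf fq Q) (map_pmf fr R)) (\<lambda>fg. map_pmf (Pair fg) (coded Q R \<kappa> fq mq fr U fg))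
      = bind_pmf (pair_pmf (map_pmf fq Q) U) Kern"
  proof -
    have "bind_pmf (pair_pmf (map_pmf fq Q) (map_pmf fr R)) (\<lambda>fg. map_pmf (Pair fg) (coded Q R \<kappa> fq mq fr U fg))
       = bind_pmf (map_pmf fq Q) (\<lambda>f. bind_pmf (map_pmf fr R) (\<lambda>g. bind_pmf U (\<lambda>m.
           bind_pmf (condp Q (\<lambda>q. (fq q, mq q)) (f, m)) (\<lambda>q. bind_pmf (condp R fr g)
             (\<lambda>r. map_pmf (\<lambda>c. ((f, g), m, q, r, c)) (\<kappa> q r))))))"
      by (simp add: pair_pmf_def bind_assoc_pmf bind_return_pmf coded_def source_def map_bind_pmf pmf.map_comp o_def)
    also have "\<dots> = bind_pmf (map_pmf fq Q) (\<lambda>f. bind_pmf U (\<lambda>m. bind_pmf (map_pmf fr R) (\<lambda>g.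
           bind_pmf (condp Q (\<lambda>q. (fq q, mq q)) (f, m)) (\<lambda>q. bind_pmf (condp R fr g)
             (\<lambda>r. map_pmf (\<lambda>c. ((f, g), m, q, r, c)) (\<kappa> q r))))))"
      by (subst bind_commute_pmf[of "map_pmf fr R"]) (rule refl)
    also have "\<dots> = bind_pmf (map_pmf fq Q) (\<lambda>f. bind_pmf U (\<lambda>m. 
           bind_pmf (condp Q (\<lambda>q. (fq q, mq q)) (f, m)) (\<lambda>q. bind_pmf (map_pmf fr R) (\<lambda>g. bind_pmf (condp R fr g)
             (\<lambda>r. map_pmf (\<lambda>c. ((f, g), m, q, r, c)) (\<kappa> q r))))))"
      by (subst bind_commute_pmf[of "map_pmf fr R"]) (rule refl)
    also have "\<dots> = bind_pmf (pair_pmf (map_pmf fq Q) U) Kern"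
      by (simp add: pair_pmf_def bind_assoc_pmf bind_return_pmf Kern_def)
    finally show ?thesis .
  qed
  show ?thesis unfolding 1 2
    by (rule l1_bind) (use fin in \<open>auto simp: Kern_def\<close>)
qed

lemma expectation_bind_pmf:
  fixes g :: "'b \<Rightarrow> real"
  assumes "finite (set_pmf p)" "\<And>x. x \<in> set_pmf p \<Longrightarrow> finite (set_pmf (K x))"
  shows "expectation (bind_pmf p K) g = expectation p (\<lambda>x. expectation (K x) g)"
proof -
  let ?T = "\<Union>x\<in>set_pmf p. set_pmf (K x)"
  have fT: "finite ?T" using assms by auto
  have "expectation (bind_pmf p K) g
      = (\<Sum>y\<in>?T. (\<Sum>x\<in>set_pmf p. pmf p x * pmf (K x) y) * g y)"
    using fT by (subst expectation_sum[of ?T]) (auto simp: pmf_bind_sum[OF assms(1) subset_refl])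
  also have "\<dots> = (\<Sum>x\<in>set_pmf p. pmf p x * (\<Sum>y\<in>?T. pmf (K x) y * g y))"
    unfolding sum_distrib_left sum_distrib_right by (subst sum.swap) (simp only: mult.assoc)
  also have "\<dots> = (\<Sum>x\<in>set_pmf p. pmf p x * expectation (K x) g)"
    using fT by (intro sum.cong refl arg_cong2[where f = times], subst expectation_sum[of ?T]) auto
  finally show ?thesis using assms by (simp add: expectation_sum[of "set_pmf p"])
qed

text \<open>Four nonnegative quantities are averaged over the public values at once, so one value is
  good for all of them. The factor 6 counts \<open>D\<close> once for each error probability and
  twice for each secrecy distance, where both the joint law and the product of marginals are
  replaced.\<close>

lemma coded_exists:
  fixes fq :: "'q \<Rightarrow> 'f" and mq :: "'q \<Rightarrow> 'm" and fr :: "'r \<Rightarrow> 'g"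
  assumes fin: "finite (set_pmf Q)" "finite (set_pmf R)" "\<And>q r. finite (set_pmf (\<kappa> q r))" "finite (set_pmf U)"
    "finite (set_pmf V1)" "finite (set_pmf V2)"
  defines "A \<equiv> map_pmf (\<lambda>(q, r, c). ((fq q, fr r), mq q, q, r, c)) (source Q R \<kappa>)"
    and "B \<equiv> coded Q R \<kappa> fq mq fr U"
    and "D \<equiv> l1 (map_pmf (\<lambda>q. (fq q, mq q)) Q) (pair_pmf (map_pmf fq Q) U)"
  shows "\<exists>fg. prob (B fg) {w. (fg, w) \<in> E1} + prob (B fg) {w. (fg, w) \<in> E2}
       + l1 (map_pmf (s1 \<star> z1) (B fg)) (pair_pmf V1 (map_pmf z1 (B fg)))
       + l1 (map_pmf (s2 \<star> z2) (B fg)) (pair_pmf V2 (map_pmf z2 (B fg)))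
     \<le> prob A E1 + prob A E2
       + l1 (map_pmf (\<lambda>(fg, w). (s1 w, (fg, z1 w))) A) (pair_pmf V1 (map_pmf (\<lambda>(fg, w). (fg, z1 w)) A))
       + l1 (map_pmf (\<lambda>(fg, w). (s2 w, (fg, z2 w))) A) (pair_pmf V2 (map_pmf (\<lambda>(fg, w). (fg, z2 w)) A))
       + 6 * D"
proof -
  let ?FG = "pair_pmf (map_pmf fq Q) (map_pmf fr R)"
  let ?B = "bind_pmf ?FG (\<lambda>fg. map_pmf (Pair fg) (B fg))"
  have finB: "finite (set_pmf (B fg))" for fg
    unfolding B_def using fin by (intro finite_coded) auto
  have finFG: "finite (set_pmf ?FG)" using fin by auto
  have finBB: "finite (set_pmf ?B)" using finB finFG by auto
  have finA: "finite (set_pmf A)" unfolding A_def using fin by (auto intro!: finite_source)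
  have AB: "l1 A ?B \<le> D" unfolding A_def B_def D_def by (rule l1_coded[OF fin(1-4)])
  note int = integrable_measure_pmf_finite[OF finFG]
  have err: "expectation ?FG (\<lambda>fg. prob (B fg) {w. (fg, w) \<in> E})
      \<le> prob A E + D" for E
  proof -
    have "prob ?B E = expectation ?FG (\<lambda>fg. prob (map_pmf (Pair fg) (B fg)) E)"
      using finB finFG expectation_bind_pmf[of ?FG "\<lambda>fg. map_pmf (Pair fg) (B fg)" "indicator E"] by simp
    also have "\<dots> = expectation ?FG (\<lambda>fg. prob (B fg) {w. (fg, w) \<in> E})"
      by (simp add: vimage_def)
    finally show ?thesis using prob_le_l1[OF finBB finA, of E] AB by (simp add: l1_commute)
  qed
  have sec: "expectation ?FG (\<lambda>fg. l1 (map_pmf (s \<star> z) (B fg)) (pair_pmf V (map_pmf z (B fg))))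
     \<le> l1 (map_pmf (\<lambda>(fg, w). (s w, (fg, z w))) A) (pair_pmf V (map_pmf (\<lambda>(fg, w). (fg, z w)) A)) + 2 * D"
    if finV: "finite (set_pmf V)" for V :: "'v pmf" and s :: "_ \<Rightarrow> 'v" and z :: "_ \<Rightarrow> 'z"
  proof -
    let ?g = "\<lambda>(s, (fg, z)). (fg, (s, z))"
    let ?x = "map_pmf (\<lambda>(fg, w). (s w, (fg, z w)))" and ?y = "map_pmf (\<lambda>(fg, w). (fg, z w))"
    have "expectation ?FG (\<lambda>fg. l1 (map_pmf (s \<star> z) (B fg)) (pair_pmf V (map_pmf z (B fg))))
      = l1 (bind_pmf ?FG (\<lambda>fg. map_pmf (Pair fg) (map_pmf (s \<star> z) (B fg))))
           (bind_pmf ?FG (\<lambda>fg. map_pmf (Pair fg) (pair_pmf V (map_pmf z (B fg)))))"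
      using finB finFG finV by (intro l1_bind_expectation) auto
    also have "bind_pmf ?FG (\<lambda>fg. map_pmf (Pair fg) (map_pmf (s \<star> z) (B fg))) = map_pmf ?g (?x ?B)"
      by (simp add: map_bind_pmf pmf.map_comp o_def)
    also have "bind_pmf ?FG (\<lambda>fg. map_pmf (Pair fg) (pair_pmf V (map_pmf z (B fg))))
        = bind_pmf ?FG (\<lambda>fg. bind_pmf V (\<lambda>v. map_pmf (\<lambda>w. (fg, (v, z w))) (B fg)))"
      by (simp add: pair_pmf_def map_pmf_def bind_assoc_pmf bind_return_pmf)
    also have "\<dots> = bind_pmf V (\<lambda>v. bind_pmf ?FG (\<lambda>fg. map_pmf (\<lambda>w. (fg, (v, z w))) (B fg)))"
      by (rule bind_commute_pmf)
    also have "\<dots> = map_pmf ?g (pair_pmf V (?y ?B))"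
      by (simp add: pair_pmf_def map_pmf_def bind_assoc_pmf bind_return_pmf)
    also have "l1 (map_pmf ?g (?x ?B)) (map_pmf ?g (pair_pmf V (?y ?B))) \<le> l1 (?x ?B) (pair_pmf V (?y ?B))"
      using finBB finV by (intro l1_map) auto
    also have "\<dots> \<le> l1 (?x ?B) (?x A) + l1 (?x A) (pair_pmf V (?y ?B))"
      using finBB finA finV by (intro l1_triangle) auto
    also have "l1 (?x A) (pair_pmf V (?y ?B)) \<le> l1 (?x A) (pair_pmf V (?y A)) + l1 (pair_pmf V (?y A)) (pair_pmf V (?y ?B))"
      using finBB finA finV by (intro l1_triangle) auto
    also have "l1 (pair_pmf V (?y A)) (pair_pmf V (?y ?B)) \<le> l1 (?y A) (?y ?B)"
      using finBB finA finV by (intro l1_pair_right) auto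
    also have "l1 (?y A) (?y ?B) \<le> l1 A ?B" using finBB finA by (intro l1_map) auto
    also have "l1 (?x ?B) (?x A) \<le> l1 ?B A" using finBB finA by (intro l1_map) auto
    finally show ?thesis using AB by (simp add: l1_commute)
  qed
  let ?F = "\<lambda>fg. prob (B fg) {w. (fg, w) \<in> E1} + prob (B fg) {w. (fg, w) \<in> E2}
       + l1 (map_pmf (s1 \<star> z1) (B fg)) (pair_pmf V1 (map_pmf z1 (B fg)))
       + l1 (map_pmf (s2 \<star> z2) (B fg)) (pair_pmf V2 (map_pmf z2 (B fg)))"
  obtain fg where "?F fg \<le> expectation ?FG ?F"
    using ex_le_expectation[OF finFG, of ?F] by blast
  also have "expectation ?FG ?F
     = expectation ?FG (\<lambda>fg. prob (B fg) {w. (fg, w) \<in> E1})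
     + expectation ?FG (\<lambda>fg. prob (B fg) {w. (fg, w) \<in> E2})
     + expectation ?FG (\<lambda>fg. l1 (map_pmf (s1 \<star> z1) (B fg)) (pair_pmf V1 (map_pmf z1 (B fg))))
     + expectation ?FG (\<lambda>fg. l1 (map_pmf (s2 \<star> z2) (B fg)) (pair_pmf V2 (map_pmf z2 (B fg))))"
    by (simp add: int)
  also note add_mono[OF add_mono[OF add_mono[OF err err] sec[OF fin(5)]] sec[OF fin(6)]]
  finally show ?thesis by (intro exI[of _ fg]) simp
qed

section \<open>Equivocation from near-uniformity\<close>

lemma ent_expectation:
  assumes "finite (set_pmf P)"
  shows "ent P A = expectation P (\<lambda>w. - log 2 (pmf (map_pmf A P) (A w)))"
proof -
  have "ent P A = - (\<Sum>a\<in>set_pmf (map_pmf A P). pmf (map_pmf A P) a * log 2 (pmf (map_pmf A P) a))"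
    by (simp only: ent_def disc_H_def)
  also have "(\<Sum>a\<in>set_pmf (map_pmf A P). pmf (map_pmf A P) a * log 2 (pmf (map_pmf A P) a))
    = (\<Sum>w\<in>set_pmf P. pmf P w * log 2 (pmf (map_pmf A P) (A w)))"
    using assms by (intro sum_pmf_map) auto
  finally show ?thesis using assms
    by (simp add: expectation_sum[of "set_pmf P"] sum_negf)
qed

lemma pmf_map_pos: "w \<in> set_pmf P \<Longrightarrow> 0 < pmf (map_pmf A P) (A w)"
  by (intro pmf_positive) auto

lemma pmf_map_mono: "pmf (map_pmf A P) (A w) \<le> pmf (map_pmf (\<lambda>w. f (A w)) P) (f (A w))"
  unfolding pmf_map by (intro measure_pmf.finite_measure_mono) (auto simp: vimage_def)

lemma cp_pos: "w \<in> set_pmf P \<Longrightarrow> 0 < cp P A E (A w) (E w)"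
  using pmf_map_pos[of w P "A \<star> E"] pmf_map_pos[of w P E] by (simp add: cp_def)

lemma cp_le_1: "w \<in> set_pmf P \<Longrightarrow> cp P A E (A w) (E w) \<le> 1"
  using pmf_map_mono[of "A \<star> E" P w snd] pmf_map_pos[of w P E] by (simp add: cp_def)

lemma cp_comp_mono: "w \<in> set_pmf P \<Longrightarrow> cp P A E (A w) (E w) \<le> cp P (\<lambda>w. g (A w)) E (g (A w)) (E w)"
  using pmf_map_mono[of "A \<star> E" P w "\<lambda>x. (g (fst x), snd x)"] pmf_map_pos[of w P E]
  by (simp add: cp_def divide_right_mono)

lemma cent_expectation:
  assumes fin: "finite (set_pmf P)"
  shows "cent P A E = expectation P (\<lambda>w. - log 2 (cp P A E (A w) (E w)))"
proof -
  have "- log 2 (pmf (map_pmf (A \<star> E) P) (A w, E w)) - - log 2 (pmf (map_pmf E P) (E w))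
      = - log 2 (cp P A E (A w) (E w))" if "w \<in> set_pmf P" for w
    using pmf_map_pos[OF that, of "A \<star> E"] pmf_map_pos[OF that, of E]
    by (simp add: cp_def log_divide)
  then show ?thesis
    unfolding cent_def ent_expectation[OF fin]
    by (simp add: expectation_sum[OF fin subset_refl] sum_subtractf[symmetric] right_diff_distrib[symmetric] sum_negf)
qed

text \<open>Where the posterior exceeds \<open>2 / card S\<close>, the joint probability is more
  than twice the product probability, hence at most twice their difference. Uniformity in l1
  distance is thereby turned into a statement about posteriors, which bounds the equivocation
  linearly in the distance.\<close>

lemma prob_cp_large:
  assumes fin: "finite (set_pmf P)" and S: "finite S" "S \<noteq> {}"
  shows "prob P {w. 2 / card S < cp P A E (A w) (E w)}
      \<le> 2 * l1 (map_pmf (A \<star> E) P) (pair_pmf (pmf_of_set S) (map_pmf E P))"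
proof -
  let ?p = "map_pmf (A \<star> E) P" and ?q = "pair_pmf (pmf_of_set S) (map_pmf E P)"
  let ?T = "set_pmf ?p \<union> set_pmf ?q"
  have aux: "2 * b \<le> a \<Longrightarrow> a \<le> 2 * \<bar>a - b\<bar>" for a b :: real
    by (simp add: abs_if)
  have cS: "real (card S) > 0" using S by (simp add: card_gt_0_iff)
  have fT: "finite ?T" using fin S by auto
  have "prob P {w. 2 / card S < cp P A E (A w) (E w)}
      = prob ?p {x. 2 / card S < cp P A E (fst x) (snd x)}"
    by (simp add: vimage_def)
  also have "\<dots> = (\<Sum>x\<in>?T. pmf ?p x * of_bool (2 / card S < cp P A E (fst x) (snd x)))"
    using fT by (subst prob_sum[of ?T]) auto
  also have "\<dots> \<le> (\<Sum>x\<in>?T. 2 * \<bar>pmf ?p x - pmf ?q x\<bar>)"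
  proof (rule sum_mono)
    fix x assume "x \<in> ?T"
    obtain a e where x: "x = (a, e)" by (cases x)
    have q: "pmf ?q x \<le> pmf (map_pmf E P) e / card S"
      using S by (simp add: x pmf_pair indicator_def)
    show "pmf ?p x * of_bool (2 / card S < cp P A E (fst x) (snd x)) \<le> 2 * \<bar>pmf ?p x - pmf ?q x\<bar>"
    proof (cases "2 / card S < cp P A E a e")
      case True
      then have "pmf (map_pmf E P) e \<noteq> 0" using cS by (auto simp: cp_def divide_less_0_iff)
      then have pe: "pmf (map_pmf E P) e > 0" by (simp add: less_le)
      have "2 / card S * pmf (map_pmf E P) e < pmf ?p x"
        using True pe by (simp add: cp_def x pos_less_divide_eq)
      then have "2 * pmf ?q x \<le> pmf ?p x" using q by simp
      then have "pmf ?p x \<le> 2 * \<bar>pmf ?p x - pmf ?q x\<bar>"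
        by (rule aux)
      then show ?thesis using True by (simp add: x)
    qed (simp add: x)
  qed
  finally show ?thesis by (simp add: l1_def sum_distrib_left)
qed

text \<open>The bad event is that the posterior of the secret exceeds twice its uniform probability.\<close>
lemma cent_ge_uniform:
  assumes fin: "finite (set_pmf P)" and S: "2 \<le> card S"
    and t: "l1 (map_pmf (\<lambda>w. (g (A w), E w)) P) (pair_pmf (pmf_of_set S) (map_pmf E P)) \<le> t"
  shows "(1 - 2 * t) * (log 2 (card S) - 1) \<le> cent P A E"
proof -
  have S': "finite S" "S \<noteq> {}" using S by (auto simp: card_ge_0_finite)
  let ?B = "{w. 2 / card S < cp P (\<lambda>w. g (A w)) E (g (A w)) (E w)}"
  let ?c = "log 2 (card S) - 1"
  have c: "0 \<le> ?c" using S by (simp add: le_log_iff)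
  have B: "prob P ?B \<le> 2 * t"
    using prob_cp_large[OF fin S', of "\<lambda>w. g (A w)" E] t by simp
  have "(1 - 2 * t) * ?c \<le> (1 - prob P ?B) * ?c"
    using B c by (intro mult_right_mono) auto
  also have "1 - prob P ?B = prob P (- ?B)"
    using measure_pmf.prob_compl[of ?B P] by (simp add: Compl_eq_Diff_UNIV)
  also have "\<dots> * ?c = (\<Sum>w\<in>set_pmf P. pmf P w * (of_bool (w \<in> - ?B) * ?c))"
    by (simp add: prob_sum[OF fin subset_refl] sum_distrib_right mult.assoc)
  also have "\<dots> \<le> (\<Sum>w\<in>set_pmf P. pmf P w * (- log 2 (cp P A E (A w) (E w))))"
  proof (intro sum_mono mult_left_mono)
    fix w assume w: "w \<in> set_pmf P"
    note pos = cp_pos[OF w, of A E]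
    \<comment> \<open>On the bad event the logarithm is only known to be nonnegative. Off it, the
      posterior of \<open>A\<close> is at most that of its function \<open>g\<close> of
      \<open>A\<close>, so the whole message is at least as uncertain as its secret part.\<close>
    show "of_bool (w \<in> - ?B) * ?c \<le> - log 2 (cp P A E (A w) (E w))"
    proof (cases "w \<in> ?B")
      case True
      then show ?thesis using cp_le_1[OF w, of A E] pos by simp
    next
      case False
      then have "cp P A E (A w) (E w) \<le> 2 / card S"
        using cp_comp_mono[OF w, of A E g] by simp
      then have "log 2 (cp P A E (A w) (E w)) \<le> log 2 (2 / card S)"
        using pos S by (subst log_le_cancel_iff) auto
      also have "\<dots> = - ?c" using S by (simp add: log_divide)
      finally show ?thesis using False by simp
    qed
  qed auto
  also have "\<dots> = cent P A E"
    by (simp add: cent_expectation[OF fin] expectation_sum[OF fin subset_refl] sum_negf)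
  finally show ?thesis .
qed

section \<open>Conditional probabilities of i.i.d. blocks\<close>

lemma finite_replicate_pmf [simp]: "finite (set_pmf p) \<Longrightarrow> finite (set_pmf (replicate_pmf n p))"
  using finite_lists_length_eq[of "set_pmf p" n] by (simp add: set_replicate_pmf conj_commute in_lists_conv_set subset_eq)

lemma map_replicate_pmf: "map_pmf (map f) (replicate_pmf n p) = replicate_pmf n (map_pmf f p)"
proof (induction n)
  case (Suc n)
  have "map_pmf (map f) (replicate_pmf (Suc n) p)
      = bind_pmf p (\<lambda>x. bind_pmf (map_pmf (map f) (replicate_pmf n p)) (\<lambda>xs. return_pmf (f x # xs)))"
    by (simp add: map_bind_pmf bind_map_pmf)
  then show ?case by (simp add: Suc bind_map_pmf)
qed simp

lemma pmf_replicate: "length xs = n \<Longrightarrow> pmf (replicate_pmf n p) xs = prod_list (map (pmf p) xs)"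
proof (induction n arbitrary: xs)
  case (Suc n)
  then obtain y ys where xs: "xs = y # ys" "length ys = n" by (cases xs) auto
  have "replicate_pmf (Suc n) p = map_pmf (\<lambda>(x, xs). x # xs) (pair_pmf p (replicate_pmf n p))"
    by (simp add: pair_pmf_def map_bind_pmf)
  then have "pmf (replicate_pmf (Suc n) p) xs
      = pmf (map_pmf (\<lambda>(x, xs). x # xs) (pair_pmf p (replicate_pmf n p))) ((\<lambda>(x, xs). x # xs) (y, ys))"
    by (simp add: xs)
  also have "\<dots> = pmf p y * pmf (replicate_pmf n p) ys"
    by (subst pmf_map_inj') (auto simp: inj_def pmf_pair)
  finally show ?case by (simp add: xs Suc.IH)
qed simp

lemma cp_replicate:
  assumes "ws \<in> set_pmf (replicate_pmf n J)"
  shows "cp (replicate_pmf n J) (map a) (map e) (map a ws) (map e ws) = prod_list (map (\<lambda>w. cp J a e (a w) (e w)) ws)"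
proof -
  let ?\<iota> = "\<lambda>l. (map fst l, map snd l)"
  have len: "length ws = n" using assms by (simp add: set_replicate_pmf)
  have inj: "inj ?\<iota>"
    by (rule injI) (metis prod.inject zip_map_fst_snd)
  have "map_pmf (\<lambda>ws. (map a ws, map e ws)) (replicate_pmf n J)
      = map_pmf ?\<iota> (map_pmf (map (a \<star> e)) (replicate_pmf n J))"
    by (simp add: pmf.map_comp o_def)
  also have "\<dots> = map_pmf ?\<iota> (replicate_pmf n (map_pmf (a \<star> e) J))"
    by (simp only: map_replicate_pmf)
  finally have "pmf (map_pmf (\<lambda>ws. (map a ws, map e ws)) (replicate_pmf n J)) (map a ws, map e ws)
      = pmf (map_pmf ?\<iota> (replicate_pmf n (map_pmf (a \<star> e) J))) (?\<iota> (map (a \<star> e) ws))"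
    by (simp add: o_def)
  also have "\<dots> = prod_list (map (\<lambda>w. pmf (map_pmf (a \<star> e) J) (a w, e w)) ws)"
    unfolding pmf_map_inj'[OF inj] using len by (simp add: pmf_replicate o_def)
  finally have 1: "pmf (map_pmf (\<lambda>ws. (map a ws, map e ws)) (replicate_pmf n J)) (map a ws, map e ws)
      = prod_list (map (\<lambda>w. pmf (map_pmf (a \<star> e) J) (a w, e w)) ws)" .
  have 2: "pmf (map_pmf (map e) (replicate_pmf n J)) (map e ws) = prod_list (map (\<lambda>w. pmf (map_pmf e J) (e w)) ws)"
    using len by (simp add: map_replicate_pmf pmf_replicate o_def)
  have "prod_list (map (\<lambda>w. f w / g w) ws) = prod_list (map f ws) / prod_list (map g ws)" for f g :: "'a \<Rightarrow> real"
    by (induction ws) auto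
  then show ?thesis by (simp add: cp_def 1 2)
qed

section \<open>Memoryless sources\<close>

lemma sum_list_second_moment:
  fixes g :: "'a \<Rightarrow> real"
  assumes fin: "finite (set_pmf p)" and mean: "expectation p g = 0"
  shows "expectation (replicate_pmf n p) (\<lambda>xs. sum_list (map g xs)) = 0"
    and "expectation (replicate_pmf n p) (\<lambda>xs. (sum_list (map g xs))\<^sup>2)
        = n * expectation p (\<lambda>x. (g x)\<^sup>2)"
proof (induction n)
  case (Suc n)
  note int = integrable_measure_pmf_finite[OF fin]
    integrable_measure_pmf_finite[OF finite_replicate_pmf[OF fin]]
  have rep: "expectation (replicate_pmf (Suc n) p) f
      = expectation p (\<lambda>x. expectation (replicate_pmf n p) (\<lambda>xs. f (x # xs)))"
    for f :: "'a list \<Rightarrow> real"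
    using fin by (subst replicate_pmf.simps(2), subst expectation_bind_pmf[OF fin])
      (auto simp: map_pmf_def[symmetric])
  {
    case 1
    show ?case unfolding rep using Suc.IH(1) mean by (simp add: int)
  next
    case 2
    have "expectation (replicate_pmf (Suc n) p) (\<lambda>xs. (sum_list (map g xs))\<^sup>2)
       = expectation p (\<lambda>x. expectation (replicate_pmf n p)
           (\<lambda>xs. (g x)\<^sup>2 + 2 * g x * sum_list (map g xs) + (sum_list (map g xs))\<^sup>2))"
      unfolding rep by (simp add: power2_sum add_ac)
    also have "\<dots> = expectation p (\<lambda>x. (g x)\<^sup>2 + n * expectation p (\<lambda>x. (g x)\<^sup>2))"
      by (simp add: int Suc.IH)
    also have "\<dots> = Suc n * expectation p (\<lambda>x. (g x)\<^sup>2)"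
      by (simp add: int algebra_simps)
    finally show ?case .
  }
qed simp_all

text \<open>Chebyshev's inequality: the centred sum has second moment \<open>n * v\<close>, against
  a squared deviation \<open>(n * \<delta>)^2\<close>.\<close>

lemma weak_law:
  fixes g :: "'a \<Rightarrow> real" and \<delta> :: real
  assumes fin: "finite (set_pmf p)" and d: "\<delta> > 0"
  shows "(\<lambda>n. prob (replicate_pmf n p)
           {xs. n * \<delta> \<le> \<bar>sum_list (map g xs) - n * expectation p g\<bar>}) \<longlonglongrightarrow> 0"
proof -
  let ?\<mu> = "expectation p g"
  define v where "v = expectation p (\<lambda>x. (g x - ?\<mu>)\<^sup>2)"
  note int = integrable_measure_pmf_finite[OF fin]
  have bound: "prob (replicate_pmf n p) {xs. n * \<delta> \<le> \<bar>sum_list (map g xs) - n * ?\<mu>\<bar>}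
     \<le> v / \<delta>\<^sup>2 * (1 / n)" if n: "n > 0" for n
  proof -
    let ?P = "replicate_pmf n p"
    have finP: "finite (set_pmf ?P)" using fin by simp
    have "prob ?P {xs. n * \<delta> \<le> \<bar>sum_list (map g xs) - n * ?\<mu>\<bar>}
       = (\<Sum>xs\<in>set_pmf ?P. pmf ?P xs * of_bool (n * \<delta> \<le> \<bar>sum_list (map g xs) - n * ?\<mu>\<bar>))"
      by (simp add: prob_sum[OF finP subset_refl])
    also have "\<dots> \<le> (\<Sum>xs\<in>set_pmf ?P. pmf ?P xs * ((sum_list (map (\<lambda>x. g x - ?\<mu>) xs))\<^sup>2 / (n * \<delta>)\<^sup>2))"
    proof (intro sum_mono mult_left_mono)
      fix xs assume "xs \<in> set_pmf ?P"
      then have "length xs = n" by (simp add: set_replicate_pmf)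
      then have s: "sum_list (map (\<lambda>x. g x - ?\<mu>) xs) = sum_list (map g xs) - n * ?\<mu>"
        by (simp add: sum_list_subtractf sum_list_triv)
      have "0 < n * \<delta>" using n d by simp
      then show "of_bool (n * \<delta> \<le> \<bar>sum_list (map g xs) - n * ?\<mu>\<bar>)
         \<le> (sum_list (map (\<lambda>x. g x - ?\<mu>) xs))\<^sup>2 / (n * \<delta>)\<^sup>2"
        unfolding s using n power_mono[of "n * \<delta>" "\<bar>sum_list (map g xs) - n * ?\<mu>\<bar>" 2]
        by (auto simp: le_divide_eq_1)
    qed auto
    also have "\<dots> = expectation ?P (\<lambda>xs. (sum_list (map (\<lambda>x. g x - ?\<mu>) xs))\<^sup>2) / (n * \<delta>)\<^sup>2"
      by (simp add: expectation_sum[OF finP subset_refl] sum_divide_distrib)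
    also have "\<dots> = n * v / (n * \<delta>)\<^sup>2"
      by (subst sum_list_second_moment(2)[OF fin]) (simp_all add: int v_def)
    also have "\<dots> = v / \<delta>\<^sup>2 * (1 / n)" using n by (simp add: power2_eq_square field_simps)
    finally show ?thesis .
  qed
  have "(\<lambda>n. v / \<delta>\<^sup>2 * (1 / real n)) \<longlonglongrightarrow> v / \<delta>\<^sup>2 * 0"
    by (intro tendsto_intros lim_1_over_n)
  then have lim: "(\<lambda>n. v / \<delta>\<^sup>2 * (1 / real n)) \<longlonglongrightarrow> 0" by simp
  have ev: "\<forall>\<^sub>F n in sequentially. prob (replicate_pmf n p)
      {xs. n * \<delta> \<le> \<bar>sum_list (map g xs) - n * ?\<mu>\<bar>} \<le> v / \<delta>\<^sup>2 * (1 / n)"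
    using eventually_gt_at_top[of 0] by (rule eventually_mono) (rule bound)
  show ?thesis
    by (rule tendsto_sandwich[OF _ ev tendsto_const lim]) simp
qed

text \<open>Conditional probabilities do not change under injective relabelling. This identifies
  tuples of lists, as seen by the one-shot code, with lists of tuples, as produced by the i.i.d.
  sample.\<close>

lemma cp_encode:
  assumes "inj \<iota>" "inj \<kappa>" "\<And>w. A (f w) = \<iota> (A' w)" "\<And>w. E (f w) = \<kappa> (E' w)"
  shows "cp (map_pmf f P) A E (\<iota> a) (\<kappa> e) = cp P A' E' a e"
proof -
  have "map_pmf (A \<star> E) (map_pmf f P) = map_pmf (map_prod \<iota> \<kappa>) (map_pmf (A' \<star> E') P)"
    "map_pmf E (map_pmf f P) = map_pmf \<kappa> (map_pmf E' P)"
    using assms(3,4) by (simp_all add: pmf.map_comp o_def)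
  moreover have "inj (map_prod \<iota> \<kappa>)" using assms(1,2) by (rule prod.inj_map)
  ultimately show ?thesis
    using pmf_map_inj'[of "map_prod \<iota> \<kappa>" "map_pmf (A' \<star> E') P" "(a, e)"]
    by (simp add: cp_def pmf_map_inj'[OF assms(2)])
qed

text \<open>Asymptotic equipartition: the negative logarithm of the conditional probability of a
  block is a sum of independent terms with mean \<open>cent J a e\<close>. The first tail is fatal
  to decoding, the second to uniformity of hashes.\<close>

lemma cp_tails:
  fixes J :: "'o pmf" and \<delta> :: real
  assumes fin: "finite (set_pmf J)" and inj: "inj \<iota>" "inj \<kappa>"
    and A: "\<And>ws. A (f ws) = \<iota> (map a ws)" and E: "\<And>ws. E (f ws) = \<kappa> (map e ws)" and d: "\<delta> > 0"
  defines "P \<equiv> \<lambda>n. map_pmf f (replicate_pmf n J)"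
  shows "(\<lambda>n. prob (P n) {w. cp (P n) A E (A w) (E w) < 2 powr - (n * (cent J a e + \<delta>))}) \<longlonglongrightarrow> 0"
    and "(\<lambda>n. prob (P n) {w. 2 powr - (n * (cent J a e - \<delta>)) < cp (P n) A E (A w) (E w)}) \<longlonglongrightarrow> 0"
proof -
  define g where "g w = - log 2 (cp J a e (a w) (e w))" for w
  have mean: "expectation J g = cent J a e"
    by (simp add: cent_expectation[OF fin] g_def[abs_def])
  let ?bad = "\<lambda>n. {ws. n * \<delta> \<le> \<bar>sum_list (map g ws) - n * cent J a e\<bar>}"
  have lim: "(\<lambda>n. prob (replicate_pmf n J) (?bad n)) \<longlonglongrightarrow> 0"
    using weak_law[OF fin d, of g] by (simp add: mean)
  have cp: "cp (P n) A E (A (f ws)) (E (f ws)) = 2 powr - sum_list (map g ws)"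
    if ws: "ws \<in> set_pmf (replicate_pmf n J)" for n ws
  proof -
    have "cp (P n) A E (A (f ws)) (E (f ws)) = cp (replicate_pmf n J) (map a) (map e) (map a ws) (map e ws)"
      unfolding P_def A E by (rule cp_encode[where f = f and A' = "map a" and E' = "map e", OF inj A E])
    also have "\<dots> = prod_list (map (\<lambda>w. cp J a e (a w) (e w)) ws)"
      by (rule cp_replicate[OF ws])
    also have "\<dots> = 2 powr - sum_list (map g ws)"
    proof -
      have "set ws \<subseteq> set_pmf J" using ws by (auto simp: set_replicate_pmf)
      then show ?thesis
      proof (induction ws)
        case (Cons w ws)
        have "0 < cp J a e (a w) (e w)" using Cons.prems by (intro cp_pos) auto
        then have "2 powr - g w = cp J a e (a w) (e w)" by (simp add: g_def)
        then show ?case using Cons by (simp add: powr_add powr_minus powr_diff divide_inverse)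
      qed simp
    qed
    finally show ?thesis .
  qed
  have le: "prob (P n) S \<le> prob (replicate_pmf n J) (?bad n)"
    if "\<And>ws. ws \<in> set_pmf (replicate_pmf n J) \<Longrightarrow> f ws \<in> S \<Longrightarrow> ws \<in> ?bad n" for n S
  proof -
    have "prob (P n) S = prob (replicate_pmf n J) (f -` S)"
      by (simp add: P_def)
    also have "\<dots> \<le> prob (replicate_pmf n J) (?bad n)"
      using that by (intro measure_pmf.finite_measure_mono_AE) (auto simp: AE_measure_pmf_iff)
    finally show ?thesis .
  qed
  have "prob (P n) {w. cp (P n) A E (A w) (E w) < 2 powr - (n * (cent J a e + \<delta>))} \<le> prob (replicate_pmf n J) (?bad n)" for n
  proof (rule le)
    fix ws assume ws: "ws \<in> set_pmf (replicate_pmf n J)" and "f ws \<in> {w. cp (P n) A E (A w) (E w) < 2 powr - (n * (cent J a e + \<delta>))}"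
    then show "ws \<in> ?bad n" by (simp add: cp[OF ws] algebra_simps)
  qed
  then show "(\<lambda>n. prob (P n) {w. cp (P n) A E (A w) (E w) < 2 powr - (n * (cent J a e + \<delta>))}) \<longlonglongrightarrow> 0"
    by (intro tendsto_sandwich[OF _ _ tendsto_const lim] always_eventually allI) simp_all
  have "prob (P n) {w. 2 powr - (n * (cent J a e - \<delta>)) < cp (P n) A E (A w) (E w)} \<le> prob (replicate_pmf n J) (?bad n)" for n
  proof (rule le)
    fix ws assume ws: "ws \<in> set_pmf (replicate_pmf n J)" and "f ws \<in> {w. 2 powr - (n * (cent J a e - \<delta>)) < cp (P n) A E (A w) (E w)}"
    then show "ws \<in> ?bad n" by (simp add: cp[OF ws] algebra_simps)
  qed
  then show "(\<lambda>n. prob (P n) {w. 2 powr - (n * (cent J a e - \<delta>)) < cp (P n) A E (A w) (E w)}) \<longlonglongrightarrow> 0"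
    by (intro tendsto_sandwich[OF _ _ tendsto_const lim] always_eventually allI) simp_all
qed

section \<open>The one-shot code\<close>

text \<open>A full hash value \<open>k\<close> splits into a secret part \<open>s\<close> and a part
  \<open>a\<close> that may be known. If \<open>k\<close> is nearly uniform given \<open>E\<close>,
  then \<open>s\<close> is nearly uniform even for an observer of any function \<open>g\<close> of
  \<open>a\<close> and \<open>E\<close>.\<close>

lemma l1_pair_marginal:
  assumes fin: "finite (set_pmf J)" "finite (set_pmf UK)"
    and UK: "map_pmf (\<lambda>k. (s k, a k)) UK = pair_pmf US UA"
  shows "l1 (map_pmf (\<lambda>w. (s (k w), g (a (k w)) (E w))) J)
            (pair_pmf US (map_pmf (\<lambda>w. g (a (k w)) (E w)) J))
       \<le> 2 * l1 (map_pmf (k \<star> E) J) (pair_pmf UK (map_pmf E J))"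
proof -
  let ?p = "map_pmf (\<lambda>w. (s (k w), g (a (k w)) (E w))) J"
  let ?r = "map_pmf (\<lambda>(a, e). g a e) (pair_pmf UA (map_pmf E J))"
  let ?f = "\<lambda>(k, e). (s k, g (a k) e)"
  have finS: "finite (set_pmf US)" "finite (set_pmf UA)"
  proof -
    have "finite (set_pmf (pair_pmf US UA))" unfolding UK[symmetric] using fin by simp
    then show "finite (set_pmf US)" "finite (set_pmf UA)"
      by (auto simp: finite_cartesian_product_iff set_pmf_not_empty)
  qed
  have "pair_pmf US ?r = map_pmf (\<lambda>((s, a), e). (s, g a e)) (pair_pmf (pair_pmf US UA) (map_pmf E J))"
    by (simp add: pair_pmf_def map_pmf_def bind_assoc_pmf bind_return_pmf)
  also have "\<dots> = map_pmf ?f (pair_pmf UK (map_pmf E J))"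
    unfolding UK[symmetric] by (simp add: pair_map_pmf1 pmf.map_comp o_def case_prod_unfold apfst_def)
  finally have r: "pair_pmf US ?r = map_pmf ?f (pair_pmf UK (map_pmf E J))" .
  have p: "?p = map_pmf ?f (map_pmf (k \<star> E) J)"
    by (simp add: pmf.map_comp o_def)
  have "l1 ?p (pair_pmf US (map_pmf snd ?p)) \<le> 2 * l1 ?p (pair_pmf US ?r)"
    by (rule l1_snd_marginal) (use fin finS in auto)
  also have "l1 ?p (pair_pmf US ?r) \<le> l1 (map_pmf (k \<star> E) J) (pair_pmf UK (map_pmf E J))"
    unfolding r unfolding p by (rule l1_map) (use fin in auto)
  finally show ?thesis by (simp add: pmf.map_comp o_def)
qed

text \<open>Threshold decoding. The choice operator makes it total; \<open>decode_correct\<close>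
  concerns the case of a unique candidate.\<close>

definition decode :: "real \<Rightarrow> 'o pmf \<Rightarrow> ('o \<Rightarrow> 'a) \<Rightarrow> ('o \<Rightarrow> 'e) \<Rightarrow> ('a \<Rightarrow> 'k) \<Rightarrow> 'e \<Rightarrow> 'k \<Rightarrow> 'a" where
  "decode \<theta> J A E h e k = (SOME a. a \<in> A ` set_pmf J \<and> \<theta> \<le> cp J A E a e \<and> h a = k)"

definition collide :: "real \<Rightarrow> 'o pmf \<Rightarrow> ('o \<Rightarrow> 'a) \<Rightarrow> ('o \<Rightarrow> 'e) \<Rightarrow> ('a \<Rightarrow> 'k) \<Rightarrow> 'o set" where
  "collide \<theta> J A E h = {w. \<exists>a\<in>A ` set_pmf J. a \<noteq> A w \<and> \<theta> \<le> cp J A E a (E w) \<and> h a = h (A w)}"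

lemma decode_correct:
  assumes "w \<in> set_pmf J" "\<not> cp J A E (A w) (E w) < \<theta>" "w \<notin> collide \<theta> J A E h"
  shows "decode \<theta> J A E h (E w) (h (A w)) = A w"
  unfolding decode_def
proof (rule some_equality)
  show "A w \<in> A ` set_pmf J \<and> \<theta> \<le> cp J A E (A w) (E w) \<and> h (A w) = h (A w)"
    using assms by auto
  show "a = A w" if "a \<in> A ` set_pmf J \<and> \<theta> \<le> cp J A E a (E w) \<and> h a = h (A w)" for a
    using that assms(3) unfolding collide_def by blast
qed

definition rvU :: "('u \<times> 'v \<times> 'w) \<times> 'r \<times> 'o \<Rightarrow> 'u" where "rvU w = fst (fst w)"
definition rvV1 :: "('u \<times> 'v \<times> 'w) \<times> 'r \<times> 'o \<Rightarrow> 'v" where "rvV1 w = fst (snd (fst w))"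
definition rvV2 :: "('u \<times> 'v \<times> 'w) \<times> 'r \<times> 'o \<Rightarrow> 'w" where "rvV2 w = snd (snd (fst w))"
definition rvX1 :: "('u \<times> 'v \<times> 'w) \<times> 'r \<times> 'o \<Rightarrow> 'r" where "rvX1 w = fst (snd w)"
definition rvO :: "('o \<Rightarrow> 'y) \<Rightarrow> ('u \<times> 'v \<times> 'w) \<times> 'r \<times> 'o \<Rightarrow> 'y" where "rvO f w = f (snd (snd w))"

text \<open>The two ways of being atypical: in \<open>miss\<close> the true value is too unlikely
  for the threshold decoder to accept it, in \<open>peak\<close> it is too likely for its hash to be
  nearly uniform.\<close>

definition miss :: "'o pmf \<Rightarrow> ('o \<Rightarrow> 'a) \<Rightarrow> ('o \<Rightarrow> 'e) \<Rightarrow> real \<Rightarrow> real" where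
  "miss J A E \<theta> = prob J {w. cp J A E (A w) (E w) < \<theta>}"

definition peak :: "'o pmf \<Rightarrow> ('o \<Rightarrow> 'a) \<Rightarrow> ('o \<Rightarrow> 'e) \<Rightarrow> real \<Rightarrow> real" where
  "peak J A E \<theta> = prob J {w. \<theta> < cp J A E (A w) (E w)}"

text \<open>Quantified over all \<open>K\<close> up to \<open>b\<close> because hash ranges are
  products of rounded integers, known only through an upper bound.\<close>

definition flat :: "'o pmf \<Rightarrow> ('o \<Rightarrow> 'a) \<Rightarrow> ('o \<Rightarrow> 'e) \<Rightarrow> real \<Rightarrow> real \<Rightarrow> real \<Rightarrow> bool" where
  "flat J A E \<tau> \<eta> b \<longleftrightarrow> (\<forall>K. 0 < K \<longrightarrow> K \<le> b \<longrightarrow> peak J A E (\<tau> / K) \<le> \<eta>)"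

text \<open>An outcome is \<open>((W1, W2), w)\<close> with each message a triple (c, s, t). Secrecy
  is demanded of the middle components: s1 against \<open>z\<close>, s2 against
  \<open>y\<close>.\<close>

definition reliable_secret :: "((triple \<times> triple) \<times> 'o) pmf \<Rightarrow> ('o \<Rightarrow> 'y) \<Rightarrow> ('o \<Rightarrow> 'z)
    \<Rightarrow> ('y \<Rightarrow> triple) \<Rightarrow> ('z \<Rightarrow> triple) \<Rightarrow> nat \<Rightarrow> nat \<Rightarrow> real \<Rightarrow> bool" where
  "reliable_secret B y z d1 d2 S1 S2 \<epsilon> \<longleftrightarrow>
     prob B {w. d1 (y (snd w)) \<noteq> fst (fst w)} \<le> \<epsilon> \<and>
     prob B {w. d2 (z (snd w)) \<noteq> snd (fst w)} \<le> \<epsilon> \<and>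
     l1 (map_pmf (\<lambda>w. (fst (snd (fst (fst w))), z (snd w))) B)
        (pair_pmf (pmf_of_set {..<S1}) (map_pmf (\<lambda>w. z (snd w)) B)) \<le> \<epsilon> \<and>
     l1 (map_pmf (\<lambda>w. (fst (snd (snd (fst w))), y (snd w))) B)
        (pair_pmf (pmf_of_set {..<S2}) (map_pmf (\<lambda>w. y (snd w)) B)) \<le> \<epsilon>"

text \<open>\<open>Q\<close> and \<open>R\<close> will be laws of whole blocks; rates enter only
  through the ten sizes. A letter names the part of a hash value as in the overview, an index its
  source: 0 for U, 1 for V1, 2 for V2, 3 for X1. The exceptions are \<open>C1\<close> and
  \<open>C2\<close>, both on U and indexed by the message.\<close>

locale one_shot =
  fixes Q :: "('u \<times> 'v \<times> 'w) pmf" and R :: "'r pmf" and \<kappa> :: "'u \<times> 'v \<times> 'w \<Rightarrow> 'r \<Rightarrow> 'o pmf"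
    and yo :: "'o \<Rightarrow> 'y" and zo :: "'o \<Rightarrow> 'z"
    and F0 C1 C2 F1 S1 T1 F2 S2 T2 F3 :: nat
  assumes finQ: "finite (set_pmf Q)" and finR: "finite (set_pmf R)" and fin\<kappa>: "\<And>q r. finite (set_pmf (\<kappa> q r))"
    and pos: "0 < F0" "0 < C1" "0 < C2" "0 < F1" "0 < S1" "0 < T1" "0 < F2" "0 < S2" "0 < T2" "0 < F3"
begin

definition "J = source Q R \<kappa>"
abbreviation "Y \<equiv> rvO yo"
abbreviation "Z \<equiv> rvO zo"

definition "K0 = {..<F0} \<times> {..<C1} \<times> {..<C2}"
definition "K1 = {..<F1} \<times> {..<S1} \<times> {..<T1}"
definition "K2 = {..<F2} \<times> {..<S2} \<times> {..<T2}"
definition "K3 = {..<F3}"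

definition M1 :: "triple set" where "M1 = {..<C1} \<times> {..<S1} \<times> {..<T1}"
definition M2 :: "triple set" where "M2 = {..<C2} \<times> {..<S2} \<times> {..<T2}"

definition fq :: "('u \<Rightarrow> triple) \<Rightarrow> ('v \<Rightarrow> triple) \<Rightarrow> ('w \<Rightarrow> triple)
    \<Rightarrow> 'u \<times> 'v \<times> 'w \<Rightarrow> triple" where
  "fq h0 h1 h2 q = (fst (h0 (fst q)), fst (h1 (fst (snd q))), fst (h2 (snd (snd q))))"

definition mq :: "('u \<Rightarrow> triple) \<Rightarrow> ('v \<Rightarrow> triple) \<Rightarrow> ('w \<Rightarrow> triple)
    \<Rightarrow> 'u \<times> 'v \<times> 'w \<Rightarrow> triple \<times> triple" where
  "mq h0 h1 h2 q = ((fst (snd (h0 (fst q))), snd (h1 (fst (snd q)))), (snd (snd (h0 (fst q))), snd (h2 (snd (snd q)))))"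

lemma finJ: "finite (set_pmf J)"
  unfolding J_def using finQ finR fin\<kappa> by (rule finite_source)

lemma K_fin: "finite K0" "K0 \<noteq> {}" "finite K1" "K1 \<noteq> {}" "finite K2" "K2 \<noteq> {}" "finite K3" "K3 \<noteq> {}"
  "finite M1" "M1 \<noteq> {}" "finite M2" "M2 \<noteq> {}"
  using pos by (auto simp: K0_def K1_def K2_def K3_def M1_def M2_def lessThan_empty_iff)

abbreviation unif :: "nat \<Rightarrow> nat pmf" where "unif n \<equiv> pmf_of_set {..<n}"

lemma unif_eqs:
  "pmf_of_set K0 = pair_pmf (unif F0) (pair_pmf (unif C1) (unif C2))"
  "pmf_of_set K1 = pair_pmf (unif F1) (pair_pmf (unif S1) (unif T1))"
  "pmf_of_set K2 = pair_pmf (unif F2) (pair_pmf (unif S2) (unif T2))"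
  "pmf_of_set M1 = pair_pmf (unif C1) (pair_pmf (unif S1) (unif T1))"
  "pmf_of_set M2 = pair_pmf (unif C2) (pair_pmf (unif S2) (unif T2))"
  unfolding K0_def K1_def K2_def M1_def M2_def
  using pos by (simp_all add: pmf_of_set_Times lessThan_empty_iff)

lemma finite_unif: "0 < n \<Longrightarrow> finite (set_pmf (unif n))"
  by (simp add: lessThan_empty_iff)

definition "LH12 h1 h2 = l1 (map_pmf (\<lambda>w. ((h1 (rvV1 w), h2 (rvV2 w)), rvU w)) J) (pair_pmf (pmf_of_set (K1 \<times> K2)) (map_pmf rvU J))"
definition "LH0 h0 = l1 (map_pmf (\<lambda>w. (h0 (rvU w), ())) J) (pair_pmf (pmf_of_set K0) (map_pmf (\<lambda>_. ()) J))"
definition "D0 h0 = l1 (map_pmf (\<lambda>w. (snd (h0 (rvU w)), fst (h0 (rvU w)))) J)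
    (pair_pmf (pair_pmf (unif C1) (unif C2)) (map_pmf (\<lambda>w. fst (h0 (rvU w))) J))"
text \<open>The distance \<open>D\<close> of \<open>coded_exists\<close>: the price of drawing the
  messages uniformly instead of reading them off the source.\<close>

definition "DD h0 h1 h2 = l1 (map_pmf (\<lambda>q. (fq h0 h1 h2 q, mq h0 h1 h2 q)) Q)
    (pair_pmf (map_pmf (fq h0 h1 h2) Q) (pmf_of_set (M1 \<times> M2)))"

lemma map_fst_J: "map_pmf (\<lambda>w. f (fst w)) J = map_pmf f Q"
proof -
  have "map_pmf fst J = Q"
    by (simp add: J_def source_def map_bind_pmf pmf.map_comp o_def bind_return_pmf')
  then show ?thesis by (metis (no_types, lifting) pmf.map_comp o_def map_pmf_cong)
qed

lemma D0_le: "D0 h0 \<le> 2 * LH0 h0"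
proof -
  have "map_pmf (\<lambda>k. (snd k, fst k)) (pmf_of_set K0) = pair_pmf (pair_pmf (unif C1) (unif C2)) (unif F0)"
    unfolding unif_eqs by (subst (2) pair_commute_pmf) (simp add: case_prod_unfold)
  from l1_pair_marginal[OF finJ _ this, where g = "\<lambda>a e. a" and k = "\<lambda>w. h0 (rvU w)" and E = "\<lambda>_. ()"]
  show ?thesis using K_fin by (simp add: D0_def LH0_def)
qed

text \<open>Without message parts on \<open>U\<close> no entropy condition on \<open>U\<close> is needed.\<close>
lemma D0_trivial:
  assumes "C1 = 1" "C2 = 1" "range h0 \<subseteq> K0"
  shows "D0 h0 = 0"
proof -
  have "snd (h0 u) = (0, 0)" for u
  proof -
    have "h0 u \<in> {..<F0} \<times> {..<C1} \<times> {..<C2}" using assms(3) unfolding K0_def by auto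
    then show ?thesis using assms(1,2) by (cases "h0 u") auto
  qed
  then have "map_pmf (\<lambda>w. (snd (h0 (rvU w)), fst (h0 (rvU w)))) J
     = pair_pmf (pair_pmf (unif C1) (unif C2)) (map_pmf (\<lambda>w. fst (h0 (rvU w))) J)"
    using assms by (simp add: lessThan_Suc pmf_of_set_singleton pair_return_pmf1 pmf.map_comp o_def)
  then show ?thesis by (simp add: D0_def)
qed

text \<open>Two replacements in a row: the hashes of V1 and V2 become uniform given U, then the
  message parts on U become uniform given the public part of U. That public part keeps its source
  law \<open>?lf\<close>. The factor 2 restores the true law of all public parts.\<close>

lemma DD_le: "DD h0 h1 h2 \<le> 2 * (LH12 h1 h2 + D0 h0)"
proof -
  let ?G = "\<lambda>((k1, k2), u). (((fst (snd (h0 u)), snd k1), (snd (snd (h0 u)), snd k2)), (fst (h0 u), fst k1, fst k2))"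
  let ?G' = "\<lambda>((k1, k2), ((c1, c2), f0)). (((c1, snd k1), (c2, snd k2)), (f0, fst k1, fst k2))
     :: (triple \<times> triple) \<times> triple"
  let ?U12 = "pmf_of_set (K1 \<times> K2)" and ?UC = "pair_pmf (unif C1) (unif C2)" and ?UM = "pmf_of_set (M1 \<times> M2)"
  let ?lf = "map_pmf (\<lambda>w. fst (h0 (rvU w))) J"
  let ?p = "map_pmf (\<lambda>q. (mq h0 h1 h2 q, fq h0 h1 h2 q)) Q"
  let ?r = "pair_pmf ?lf (pair_pmf (unif F1) (unif F2))"
  have finU: "finite (set_pmf ?U12)" "finite (set_pmf ?UC)" "finite (set_pmf ?UM)"
    using K_fin pos by (auto simp: set_pmf_of_set finite_unif lessThan_empty_iff)
  have p: "?p = map_pmf ?G (map_pmf (\<lambda>w. ((h1 (rvV1 w), h2 (rvV2 w)), rvU w)) J)"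
    using map_fst_J[of "\<lambda>q. (mq h0 h1 h2 q, fq h0 h1 h2 q)"]
    by (simp add: pmf.map_comp o_def mq_def fq_def rvU_def rvV1_def rvV2_def)
  have mid: "map_pmf ?G (pair_pmf ?U12 (map_pmf rvU J))
      = map_pmf ?G' (pair_pmf ?U12 (map_pmf (\<lambda>w. (snd (h0 (rvU w)), fst (h0 (rvU w)))) J))"
    by (simp add: pair_map_pmf2 pmf.map_comp o_def case_prod_unfold apsnd_def)
  have last: "map_pmf ?G' (pair_pmf ?U12 (pair_pmf ?UC ?lf)) = pair_pmf ?UM ?r"
  proof (rule pmf_eqI)
    fix x :: "(triple \<times> triple) \<times> triple"
    obtain c1 k1 c2 k2 f0 f1 f2 where x: "x = (((c1, k1), (c2, k2)), (f0, f1, f2))" by (metis prod.exhaust)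
    have inj: "inj ?G'" by (auto simp: inj_def)
    have xG: "x = ?G' (((f1, k1), (f2, k2)), ((c1, c2), f0))" by (simp add: x)
    obtain s1 t1 s2 t2 where k: "k1 = (s1, t1)" "k2 = (s2, t2)" by (metis prod.exhaust)
    have "pmf (map_pmf ?G' (pair_pmf ?U12 (pair_pmf ?UC ?lf))) x
       = pmf (pair_pmf ?U12 (pair_pmf ?UC ?lf)) (((f1, k1), (f2, k2)), ((c1, c2), f0))"
      unfolding xG by (rule pmf_map_inj'[OF inj])
    also have "\<dots> = pmf (pair_pmf ?UM ?r) x"
      using K_fin by (simp add: x k pmf_of_set_Times unif_eqs pmf_pair del: pmf_of_set)
    finally show "pmf (map_pmf ?G' (pair_pmf ?U12 (pair_pmf ?UC ?lf))) x = pmf (pair_pmf ?UM ?r) x" .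
  qed
  have "l1 ?p (pair_pmf ?UM ?r) \<le> l1 ?p (map_pmf ?G (pair_pmf ?U12 (map_pmf rvU J)))
      + l1 (map_pmf ?G (pair_pmf ?U12 (map_pmf rvU J))) (pair_pmf ?UM ?r)"
    using finQ finU finJ pos by (intro l1_triangle) (auto simp: finite_unif)
  also have "l1 ?p (map_pmf ?G (pair_pmf ?U12 (map_pmf rvU J))) \<le> LH12 h1 h2"
    unfolding p LH12_def using finJ finU by (intro l1_map) auto
  also have "l1 (map_pmf ?G (pair_pmf ?U12 (map_pmf rvU J))) (pair_pmf ?UM ?r)
     \<le> l1 (pair_pmf ?U12 (map_pmf (\<lambda>w. (snd (h0 (rvU w)), fst (h0 (rvU w)))) J)) (pair_pmf ?U12 (pair_pmf ?UC ?lf))"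
    unfolding mid last[symmetric] using finJ finU by (intro l1_map) auto
  also have "\<dots> \<le> D0 h0"
    unfolding D0_def using finJ finU by (intro l1_pair_right) auto
  finally have le: "l1 ?p (pair_pmf ?UM ?r) \<le> LH12 h1 h2 + D0 h0" by simp
  have "DD h0 h1 h2 = l1 (map_pmf prod.swap ?p) (map_pmf prod.swap (pair_pmf ?UM (map_pmf snd ?p)))"
    unfolding DD_def by (subst pair_commute_pmf) (simp add: pmf.map_comp o_def case_prod_unfold)
  also have "\<dots> \<le> l1 ?p (pair_pmf ?UM (map_pmf snd ?p))"
    using finQ finU by (intro l1_map) auto
  also have "\<dots> \<le> 2 * l1 ?p (pair_pmf ?UM ?r)"
    using finQ finU finJ pos by (intro l1_snd_marginal) (auto simp: finite_unif)
  finally show ?thesis using le by simp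
qed

lemma prob_J_le: "(\<And>w. w \<in> set_pmf J \<Longrightarrow> w \<in> S \<Longrightarrow> w \<in> T) \<Longrightarrow> prob J S \<le> prob J T"
  by (intro measure_pmf.finite_measure_mono_AE) (auto simp: AE_measure_pmf_iff)

lemma prob_tail_le_peak:
  assumes "0 \<le> k" "k \<le> K" "0 < K"
  shows "prob J {w. \<tau> < k * cp J A E (A w) (E w)} \<le> peak J A E (\<tau> / K)"
  unfolding peak_def
proof (rule prob_J_le)
  fix w assume "w \<in> {w. \<tau> < k * cp J A E (A w) (E w)}"
  then have "\<tau> < k * cp J A E (A w) (E w)" by simp
  also have "\<dots> \<le> K * cp J A E (A w) (E w)" using assms by (intro mult_right_mono) (auto simp: cp_nonneg)
  finally show "w \<in> {w. \<tau> / K < cp J A E (A w) (E w)}" using assms by (simp add: field_simps)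
qed

lemma hash_uniform2_peak:
  assumes KA: "finite KA" "KA \<noteq> {}" and KB: "finite KB" "KB \<noteq> {}"
    and HA: "uhash HA (A ` set_pmf J) (pmf_of_set KA)"
    and HB: "uhash HB (B ` set_pmf J) (pmf_of_set KB)" and tau: "0 \<le> \<tau>" "sqrt (3 * \<tau>) \<le> \<eta>"
    and pk: "peak J A E (\<tau> / card KA) \<le> \<eta>" "peak J B E (\<tau> / card KB) \<le> \<eta>"
      "peak J (A \<star> B) E (\<tau> / (card KA * card KB)) \<le> \<eta>"
  shows "expectation (pair_pmf HA HB) (\<lambda>h. l1 (map_pmf (\<lambda>w. ((fst h (A w), snd h (B w)), E w)) J)
             (pair_pmf (pmf_of_set (KA \<times> KB)) (map_pmf E J))) \<le> 7 * \<eta>"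
proof -
  have ka: "real (card KA) \<ge> 1" "real (card KB) \<ge> 1"
    using KA KB by (simp_all add: Suc_le_eq card_gt_0_iff)
  note t1 = prob_tail_le_peak[of "real (card KA) - 1" "card KA" \<tau> A E]
  note t2 = prob_tail_le_peak[of "real (card KB) - 1" "card KB" \<tau> B E]
  have "(real (card KA) - 1) * (real (card KB) - 1) \<le> real (card KA * card KB)"
    using ka by (simp add: mult_mono)
  note t3 = prob_tail_le_peak[OF _ this, of \<tau> "A \<star> B" E]
  show ?thesis
    using hash_uniform2[OF finJ KA KB HA HB tau(1), of E] t1 t2 t3 tau pk ka by simp
qed

lemma hash_uniform1_peak:
  assumes KA: "finite KA" "KA \<noteq> {}"
    and HA: "uhash HA (A ` set_pmf J) (pmf_of_set KA)" and tau: "0 \<le> \<tau>" "sqrt (3 * \<tau>) \<le> \<eta>"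
    and pk: "peak J A E (\<tau> / card KA) \<le> \<eta>"
  shows "expectation HA (\<lambda>h. l1 (map_pmf (\<lambda>w. (h (A w), E w)) J)
             (pair_pmf (pmf_of_set KA) (map_pmf E J))) \<le> 3 * \<eta>"
proof -
  have ka: "real (card KA) \<ge> 1" using KA by (simp_all add: Suc_le_eq card_gt_0_iff)
  show ?thesis
    using hash_uniform1[OF finJ KA HA tau(1), of E] prob_tail_le_peak[of "real (card KA) - 1" "card KA" \<tau> A E]
      tau pk ka by simp
qed

section \<open>Successive decoding\<close>

definition "hit A E \<theta> h = prob J (collide \<theta> J A E h)"

text \<open>The order X1, U, V1 produces H(X1|Y), H(U|Y,X1), H(V1|Y,X1,U), the entropies behind
  I(X1;Y), I(U;Y|X1), I(V1;Y|U,X1). Each stage uses the results of the earlier ones, so one correct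
  stage feeds the next.\<close>

definition "dec1 \<theta>0 \<theta>1 \<theta>3 h0 h1 h3 fg y =
  (let x = decode \<theta>3 J rvX1 Y h3 y (snd fg);
       u = decode \<theta>0 J rvU (Y \<star> rvX1) (fst \<circ> h0) (y, x) (fst (fst fg));
       v = decode \<theta>1 J rvV1 (Y \<star> rvX1 \<star> rvU) (fst \<circ> h1) (y, x, u) (fst (snd (fst fg)))
   in (fst (snd (h0 u)), snd (h1 v)))"

text \<open>Receiver 2 treats the relay word as noise. It decodes U from the same public hash as
  receiver 1.\<close>

definition "dec2 \<theta>0 \<theta>2 h0 h2 fg z =
  (let u = decode \<theta>0 J rvU Z (fst \<circ> h0) z (fst (fst fg));
       v = decode \<theta>2 J rvV2 (Z \<star> rvU) (fst \<circ> h2) (z, u) (snd (snd (fst fg)))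
   in (snd (snd (h0 u)), snd (h2 v)))"

definition "err1 \<theta>0 \<theta>1 \<theta>3 h0 h1 h2 h3 = prob J
    {w. dec1 \<theta>0 \<theta>1 \<theta>3 h0 h1 h3 (fq h0 h1 h2 (fst w), h3 (rvX1 w)) (Y w) \<noteq> fst (mq h0 h1 h2 (fst w))}"
definition "err2 \<theta>0 \<theta>2 h0 h1 h2 h3 = prob J
    {w. dec2 \<theta>0 \<theta>2 h0 h2 (fq h0 h1 h2 (fst w), h3 (rvX1 w)) (Z w) \<noteq> snd (mq h0 h1 h2 (fst w))}"

lemma prob_Un_le: "prob J (S \<union> T) \<le> prob J S + prob J T"
  by (rule measure_Un_le) auto

lemma err1_le:
  "err1 \<theta>0 \<theta>1 \<theta>3 h0 h1 h2 h3
   \<le> (miss J rvX1 Y \<theta>3 + hit rvX1 Y \<theta>3 h3)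
    + (miss J rvU (Y \<star> rvX1) \<theta>0 + hit rvU (Y \<star> rvX1) \<theta>0 (fst \<circ> h0))
    + (miss J rvV1 (Y \<star> rvX1 \<star> rvU) \<theta>1 + hit rvV1 (Y \<star> rvX1 \<star> rvU) \<theta>1 (fst \<circ> h1))"
proof -
  let ?m = "\<lambda>A E \<theta>. {w. cp J A E (A w) (E w) < \<theta>}"
  have "err1 \<theta>0 \<theta>1 \<theta>3 h0 h1 h2 h3
    \<le> prob J (((?m rvX1 Y \<theta>3 \<union> collide \<theta>3 J rvX1 Y h3)
       \<union> (?m rvU (Y \<star> rvX1) \<theta>0 \<union> collide \<theta>0 J rvU (Y \<star> rvX1) (fst \<circ> h0)))
       \<union> (?m rvV1 (Y \<star> rvX1 \<star> rvU) \<theta>1 \<union> collide \<theta>1 J rvV1 (Y \<star> rvX1 \<star> rvU) (fst \<circ> h1)))" (is "_ \<le> prob J ?T")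
    unfolding err1_def
  proof (rule prob_J_le, rule ccontr)
    fix w assume w: "w \<in> set_pmf J" "w \<notin> ?T"
      and err: "w \<in> {w. dec1 \<theta>0 \<theta>1 \<theta>3 h0 h1 h3 (fq h0 h1 h2 (fst w), h3 (rvX1 w)) (Y w) \<noteq> fst (mq h0 h1 h2 (fst w))}"
    have "decode \<theta>3 J rvX1 Y h3 (Y w) (h3 (rvX1 w)) = rvX1 w"
      using w by (intro decode_correct) auto
    moreover have "decode \<theta>0 J rvU (Y \<star> rvX1) (fst \<circ> h0) (Y w, rvX1 w) ((fst \<circ> h0) (rvU w)) = rvU w"
      using w by (intro decode_correct[where E = "Y \<star> rvX1"]) auto
    moreover have "decode \<theta>1 J rvV1 (Y \<star> rvX1 \<star> rvU) (fst \<circ> h1) (Y w, rvX1 w, rvU w) ((fst \<circ> h1) (rvV1 w)) = rvV1 w"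
      using w by (intro decode_correct[where E = "Y \<star> rvX1 \<star> rvU"]) auto
    ultimately show False using err
      by (simp add: dec1_def fq_def mq_def Let_def rvU_def rvV1_def)
  qed
  also have "\<dots> \<le> (miss J rvX1 Y \<theta>3 + hit rvX1 Y \<theta>3 h3)
    + (miss J rvU (Y \<star> rvX1) \<theta>0 + hit rvU (Y \<star> rvX1) \<theta>0 (fst \<circ> h0))
    + (miss J rvV1 (Y \<star> rvX1 \<star> rvU) \<theta>1 + hit rvV1 (Y \<star> rvX1 \<star> rvU) \<theta>1 (fst \<circ> h1))"
    unfolding miss_def hit_def
    by (intro order_trans[OF prob_Un_le] add_mono prob_Un_le)
  finally show ?thesis .
qed

lemma err2_le:
  "err2 \<theta>0 \<theta>2 h0 h1 h2 h3
   \<le> (miss J rvU Z \<theta>0 + hit rvU Z \<theta>0 (fst \<circ> h0))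
    + (miss J rvV2 (Z \<star> rvU) \<theta>2 + hit rvV2 (Z \<star> rvU) \<theta>2 (fst \<circ> h2))"
proof -
  let ?m = "\<lambda>A E \<theta>. {w. cp J A E (A w) (E w) < \<theta>}"
  have "err2 \<theta>0 \<theta>2 h0 h1 h2 h3
    \<le> prob J ((?m rvU Z \<theta>0 \<union> collide \<theta>0 J rvU Z (fst \<circ> h0))
       \<union> (?m rvV2 (Z \<star> rvU) \<theta>2 \<union> collide \<theta>2 J rvV2 (Z \<star> rvU) (fst \<circ> h2)))" (is "_ \<le> prob J ?T")
    unfolding err2_def
  proof (rule prob_J_le, rule ccontr)
    fix w assume w: "w \<in> set_pmf J" "w \<notin> ?T"
      and err: "w \<in> {w. dec2 \<theta>0 \<theta>2 h0 h2 (fq h0 h1 h2 (fst w), h3 (rvX1 w)) (Z w) \<noteq> snd (mq h0 h1 h2 (fst w))}"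
    have "decode \<theta>0 J rvU Z (fst \<circ> h0) (Z w) ((fst \<circ> h0) (rvU w)) = rvU w"
      using w by (intro decode_correct) auto
    moreover have "decode \<theta>2 J rvV2 (Z \<star> rvU) (fst \<circ> h2) (Z w, rvU w) ((fst \<circ> h2) (rvV2 w)) = rvV2 w"
      using w by (intro decode_correct[where E = "Z \<star> rvU"]) auto
    ultimately show False using err
      by (simp add: dec2_def fq_def mq_def Let_def rvU_def rvV2_def)
  qed
  also have "\<dots> \<le> (miss J rvU Z \<theta>0 + hit rvU Z \<theta>0 (fst \<circ> h0))
    + (miss J rvV2 (Z \<star> rvU) \<theta>2 + hit rvV2 (Z \<star> rvU) \<theta>2 (fst \<circ> h2))"
    unfolding miss_def hit_def
    by (intro order_trans[OF prob_Un_le] add_mono prob_Un_le)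
  finally show ?thesis .
qed

section \<open>Secrecy of the parts s1 and s2\<close>

definition "fs h a = (fst (h a), fst (snd (h a)))"

definition "SEC1 h0 h1 h2 h3 = l1 (map_pmf (\<lambda>w. (fst (snd (h1 (rvV1 w))), ((fq h0 h1 h2 (fst w), h3 (rvX1 w)), Z w))) J)
    (pair_pmf (unif S1) (map_pmf (\<lambda>w. ((fq h0 h1 h2 (fst w), h3 (rvX1 w)), Z w)) J))"
definition "SEC2 h0 h1 h2 h3 = l1 (map_pmf (\<lambda>w. (fst (snd (h2 (rvV2 w))), ((fq h0 h1 h2 (fst w), h3 (rvX1 w)), Y w))) J)
    (pair_pmf (unif S2) (map_pmf (\<lambda>w. ((fq h0 h1 h2 (fst w), h3 (rvX1 w)), Y w)) J))"

text \<open>Stronger eavesdroppers. In \<open>LS1\<close> receiver 2 is handed the blocks of U and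
  V2, which determine their public hashes, and the hash of X1 is made uniform along with that of V1.
  In \<open>LS1'\<close> it is handed X1 as well, which determines the remaining public hash.
  \<open>LS2\<close> hands U, V1 and X1 to receiver 1.\<close>

definition "LS1 h1 h3 = l1 (map_pmf (\<lambda>w. ((fs h1 (rvV1 w), h3 (rvX1 w)), (Z w, rvU w, rvV2 w))) J)
    (pair_pmf (pmf_of_set (({..<F1} \<times> {..<S1}) \<times> K3)) (map_pmf (Z \<star> rvU \<star> rvV2) J))"
definition "LS1' h1 = l1 (map_pmf (\<lambda>w. (fs h1 (rvV1 w), (Z w, rvU w, rvV2 w, rvX1 w))) J)
    (pair_pmf (pmf_of_set ({..<F1} \<times> {..<S1})) (map_pmf (Z \<star> rvU \<star> rvV2 \<star> rvX1) J))"
definition "LS2 h2 = l1 (map_pmf (\<lambda>w. (fs h2 (rvV2 w), (Y w, rvU w, rvV1 w, rvX1 w))) J)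
    (pair_pmf (pmf_of_set ({..<F2} \<times> {..<S2})) (map_pmf (Y \<star> rvU \<star> rvV1 \<star> rvX1) J))"

lemma SEC1_le: "SEC1 h0 h1 h2 h3 \<le> 2 * LS1 h1 h3"
proof -
  have fin: "finite (set_pmf (pmf_of_set (({..<F1} \<times> {..<S1}) \<times> K3)))"
    using pos K_fin by (simp add: lessThan_empty_iff)
  have "map_pmf (\<lambda>k. (snd (fst k), (fst (fst k), snd k))) (pmf_of_set (({..<F1} \<times> {..<S1}) \<times> K3))
      = pair_pmf (unif S1) (pair_pmf (unif F1) (pmf_of_set K3))"
  proof -
    have "map_pmf (\<lambda>k. (snd (fst k), (fst (fst k), snd k))) (pmf_of_set (({..<F1} \<times> {..<S1}) \<times> K3))
       = map_pmf (\<lambda>k. (snd (fst k), (fst (fst k), snd k))) (pair_pmf (pair_pmf (unif F1) (unif S1)) (pmf_of_set K3))"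
      using pos K_fin by (simp add: pmf_of_set_Times lessThan_empty_iff)
    also have "pair_pmf (unif F1) (unif S1) = map_pmf (\<lambda>k. (snd k, fst k)) (pair_pmf (unif S1) (unif F1))"
      by (subst pair_commute_pmf) (simp add: case_prod_unfold)
    finally show ?thesis
      by (simp add: pair_pmf_def map_pmf_def bind_assoc_pmf bind_return_pmf)
  qed
  from l1_pair_marginal[OF finJ fin this, where k = "\<lambda>w. (fs h1 (rvV1 w), h3 (rvX1 w))" and E = "Z \<star> rvU \<star> rvV2"
      and g = "\<lambda>a e. (((fst (h0 (fst (snd e))), fst a, fst (h2 (snd (snd e)))), snd a), fst e)"]
  show ?thesis by (simp add: SEC1_def LS1_def fs_def fq_def rvU_def rvV1_def rvV2_def)
qed

lemma swap_unif: "0 < m \<Longrightarrow> 0 < n \<Longrightarrow>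
  map_pmf (\<lambda>k. (snd k, fst k)) (pmf_of_set ({..<m} \<times> {..<n})) = pair_pmf (unif n) (unif m)"
  by (subst pair_commute_pmf) (simp add: pmf_of_set_Times lessThan_empty_iff case_prod_unfold)

lemma SEC1_le': "SEC1 h0 h1 h2 h3 \<le> 2 * LS1' h1"
proof -
  have fin: "finite (set_pmf (pmf_of_set ({..<F1} \<times> {..<S1})))"
    using pos by (simp add: lessThan_empty_iff)
  from l1_pair_marginal[OF finJ fin swap_unif[OF pos(4,5)], where k = "\<lambda>w. fs h1 (rvV1 w)" and E = "Z \<star> rvU \<star> rvV2 \<star> rvX1"
      and g = "\<lambda>a e. (((fst (h0 (fst (snd e))), a, fst (h2 (fst (snd (snd e))))), h3 (snd (snd (snd e)))), fst e)"]
  show ?thesis by (simp add: SEC1_def LS1'_def fs_def fq_def rvU_def rvV1_def rvV2_def)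
qed

lemma SEC2_le: "SEC2 h0 h1 h2 h3 \<le> 2 * LS2 h2"
proof -
  have fin: "finite (set_pmf (pmf_of_set ({..<F2} \<times> {..<S2})))"
    using pos by (simp add: lessThan_empty_iff)
  from l1_pair_marginal[OF finJ fin swap_unif[OF pos(7,8)], where k = "\<lambda>w. fs h2 (rvV2 w)" and E = "Y \<star> rvU \<star> rvV1 \<star> rvX1"
      and g = "\<lambda>a e. (((fst (h0 (fst (snd e))), fst (h1 (fst (snd (snd e)))), a), h3 (snd (snd (snd e)))), fst e)"]
  show ?thesis by (simp add: SEC2_def LS2_def fs_def fq_def rvU_def rvV1_def rvV2_def)
qed

definition "loss \<theta>0 \<theta>1 \<theta>2 \<theta>3 h0 h1 h2 h3 =
  err1 \<theta>0 \<theta>1 \<theta>3 h0 h1 h2 h3 + err2 \<theta>0 \<theta>2 h0 h1 h2 h3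
    + SEC1 h0 h1 h2 h3 + SEC2 h0 h1 h2 h3 + 6 * DD h0 h1 h2"

lemma hit_expectation:
  fixes \<theta> \<eta> :: real
  assumes H: "uhash H (A ` set_pmf J) (pmf_of_set Ks)" and Ks: "finite Ks" "Ks \<noteq> {}"
    and th: "0 < \<theta>" "1 / (card Ks * \<theta>) \<le> \<eta>"
  shows "expectation H (hit A E \<theta>) \<le> \<eta>"
  using hash_collision[OF finJ Ks H th(1), of E] th(2) by (simp add: hit_def[abs_def] collide_def)

lemma uhash_fst:
  assumes "uhash H S (pmf_of_set ({..<m} \<times> B))" "0 < m" "finite B" "B \<noteq> {}"
  shows "uhash (map_pmf ((\<circ>) fst) H) S (unif m)"
  using uhash_comp[OF assms(1), of fst] assms
  by (simp add: pmf_of_set_Times lessThan_empty_iff map_fst_pair_pmf)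

lemma uhash_fs:
  fixes m n l :: nat
  assumes "uhash H S (pmf_of_set ({..<m} \<times> {..<n} \<times> {..<l}))" "0 < m" "0 < n" "0 < l"
  shows "uhash (map_pmf fs H) S (pmf_of_set ({..<m} \<times> {..<n}))"
proof -
  have "map_pmf (\<lambda>k. (fst k, fst (snd k))) (pmf_of_set ({..<m} \<times> {..<n} \<times> {..<l}))
      = pmf_of_set ({..<m} \<times> {..<n})"
    using assms map_pair[of "\<lambda>x. x" fst "unif m" "pair_pmf (unif n) (unif l)"]
    by (simp add: pmf_of_set_Times lessThan_empty_iff map_fst_pair_pmf case_prod_unfold)
  then show ?thesis
    using uhash_comp[OF assms(1), of "\<lambda>k. (fst k, fst (snd k))"] by (simp add: fs_def[abs_def] o_def)
qed

text \<open>
  The second alternative of \<open>s1\<close> reveals \<open>X1\<close> to receiver 2.  It serves the case of equality in the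
  constraint of \<open>L5\<close>, where the hash of \<open>X1\<close> cannot be kept nearly independent of \<open>Z\<close>.
\<close>
lemma good_hashes:
  fixes \<eta> \<tau> \<theta>0 \<theta>1 \<theta>2 \<theta>3 :: real
  assumes th: "0 < \<theta>0" "0 < \<theta>1" "0 < \<theta>2" "0 < \<theta>3"
    and ms: "miss J rvX1 Y \<theta>3 \<le> \<eta>" "miss J rvU (Y \<star> rvX1) \<theta>0 \<le> \<eta>"
      "miss J rvV1 (Y \<star> rvX1 \<star> rvU) \<theta>1 \<le> \<eta>" "miss J rvU Z \<theta>0 \<le> \<eta>" "miss J rvV2 (Z \<star> rvU) \<theta>2 \<le> \<eta>"
    and cl: "1 / (F0 * \<theta>0) \<le> \<eta>" "1 / (F1 * \<theta>1) \<le> \<eta>" "1 / (F2 * \<theta>2) \<le> \<eta>" "1 / (F3 * \<theta>3) \<le> \<eta>"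
    and tau: "0 \<le> \<tau>" "sqrt (3 * \<tau>) \<le> \<eta>"
    and c: "C1 = 1 \<and> C2 = 1 \<or> peak J rvU (\<lambda>_. ()) (\<tau> / (F0 * (C1 * C2))) \<le> \<eta>"
    and pk: "peak J rvV1 rvU (\<tau> / (F1 * (S1 * T1))) \<le> \<eta>" "peak J rvV2 rvU (\<tau> / (F2 * (S2 * T2))) \<le> \<eta>"
      "peak J (rvV1 \<star> rvV2) rvU (\<tau> / ((F1 * (S1 * T1)) * (F2 * (S2 * T2)))) \<le> \<eta>"
    and s1: "peak J rvV1 (Z \<star> rvU \<star> rvV2) (\<tau> / (F1 * S1)) \<le> \<eta>
        \<and> peak J rvX1 (Z \<star> rvU \<star> rvV2) (\<tau> / F3) \<le> \<eta>
        \<and> peak J (rvV1 \<star> rvX1) (Z \<star> rvU \<star> rvV2) (\<tau> / (F1 * S1 * F3)) \<le> \<eta>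
      \<or> peak J rvV1 (Z \<star> rvU \<star> rvV2 \<star> rvX1) (\<tau> / (F1 * S1)) \<le> \<eta>"
    and s2: "peak J rvV2 (Y \<star> rvU \<star> rvV1 \<star> rvX1) (\<tau> / (F2 * S2)) \<le> \<eta>"
  shows "\<exists>h0 h1 h2 (h3 :: 'r \<Rightarrow> nat).
      loss \<theta>0 \<theta>1 \<theta>2 \<theta>3 h0 h1 h2 h3 \<le> 200 * \<eta>"
proof -
  have eta: "0 \<le> \<eta>" using tau by (meson order_trans real_sqrt_ge_zero mult_nonneg_nonneg zero_le_numeral)
  have cards: "card K0 = F0 * (C1 * C2)" "card K1 = F1 * (S1 * T1)" "card K2 = F2 * (S2 * T2)" "card K3 = F3"
    by (simp_all add: K0_def K1_def K2_def K3_def card_cartesian_product)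
  obtain H0 where H0: "uhash H0 (rvU ` set_pmf J) (pmf_of_set K0)"
    using uhash_exists[OF finite_imageI[OF finJ], of "pmf_of_set K0" rvU] K_fin by auto
  obtain H1 where H1: "uhash H1 (rvV1 ` set_pmf J) (pmf_of_set K1)"
    using uhash_exists[OF finite_imageI[OF finJ], of "pmf_of_set K1" rvV1] K_fin by auto
  obtain H2 where H2: "uhash H2 (rvV2 ` set_pmf J) (pmf_of_set K2)"
    using uhash_exists[OF finite_imageI[OF finJ], of "pmf_of_set K2" rvV2] K_fin by auto
  obtain H3 where H3: "uhash H3 (rvX1 ` set_pmf J) (pmf_of_set K3)"
    using uhash_exists[OF finite_imageI[OF finJ], of "pmf_of_set K3" rvX1] K_fin by auto
  let ?H = "pair_pmf H0 (pair_pmf H1 (pair_pmf H2 H3))"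
  let ?E = "expectation ?H"
  have finH: "finite (set_pmf ?H)" "finite (set_pmf H0)" "finite (set_pmf H1)" "finite (set_pmf H2)" "finite (set_pmf H3)"
    using H0 H1 H2 H3 by (auto simp: uhash_def)
  note int = integrable_measure_pmf_finite[OF finH(1)]
  have m0: "map_pmf fst ?H = H0" and m1: "map_pmf (\<lambda>h. fst (snd h)) ?H = H1"
    and m2: "map_pmf (\<lambda>h. fst (snd (snd h))) ?H = H2" and m3: "map_pmf (\<lambda>h. snd (snd (snd h))) ?H = H3"
  proof -
    have *: "map_pmf (\<lambda>h. f (snd h)) (pair_pmf p q) = map_pmf f q" for f and p :: "'p pmf" and q :: "'q pmf"
      by (metis (no_types, lifting) map_snd_pair_pmf pmf.map_comp o_def map_pmf_cong)
    show "map_pmf fst ?H = H0" by (simp add: map_fst_pair_pmf)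
    show "map_pmf (\<lambda>h. fst (snd h)) ?H = H1" by (simp only: * map_fst_pair_pmf)
    show "map_pmf (\<lambda>h. fst (snd (snd h))) ?H = H2" by (simp only: * *[of "\<lambda>h. fst (snd h)"] map_fst_pair_pmf)
    show "map_pmf (\<lambda>h. snd (snd (snd h))) ?H = H3" by (simp only: * *[of "\<lambda>h. snd (snd h)"] map_snd_pair_pmf)
  qed
  have m12: "map_pmf (\<lambda>h. (fst (snd h), fst (snd (snd h)))) ?H = pair_pmf H1 H2"
    and m13: "map_pmf (\<lambda>h. (fst (snd h), snd (snd (snd h)))) ?H = pair_pmf H1 H3"
    by (simp_all add: pair_pmf_def map_pmf_def bind_assoc_pmf bind_return_pmf)
  note E0 = integral_map_pmf[of fst ?H, unfolded m0, symmetric]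
    and E1 = integral_map_pmf[of "\<lambda>h. fst (snd h)" ?H, unfolded m1, symmetric]
    and E2 = integral_map_pmf[of "\<lambda>h. fst (snd (snd h))" ?H, unfolded m2, symmetric]
    and E3 = integral_map_pmf[of "\<lambda>h. snd (snd (snd h))" ?H, unfolded m3, symmetric]
    and E12 = integral_map_pmf[of "\<lambda>h. (fst (snd h), fst (snd (snd h)))" ?H, unfolded m12, symmetric]
    and E13 = integral_map_pmf[of "\<lambda>h. (fst (snd h), snd (snd (snd h)))" ?H, unfolded m13, symmetric]
  have H0': "uhash (map_pmf ((\<circ>) fst) H0) (rvU ` set_pmf J) (unif F0)"
    using H0 unfolding K0_def by (rule uhash_fst) (use pos in \<open>auto simp: lessThan_empty_iff\<close>)
  have H1': "uhash (map_pmf ((\<circ>) fst) H1) (rvV1 ` set_pmf J) (unif F1)"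
    using H1 unfolding K1_def by (rule uhash_fst) (use pos in \<open>auto simp: lessThan_empty_iff\<close>)
  have H2': "uhash (map_pmf ((\<circ>) fst) H2) (rvV2 ` set_pmf J) (unif F2)"
    using H2 unfolding K2_def by (rule uhash_fst) (use pos in \<open>auto simp: lessThan_empty_iff\<close>)
  have H1s: "uhash (map_pmf fs H1) (rvV1 ` set_pmf J) (pmf_of_set ({..<F1} \<times> {..<S1}))"
    using H1 unfolding K1_def by (rule uhash_fs) (use pos in auto)
  have H2s: "uhash (map_pmf fs H2) (rvV2 ` set_pmf J) (pmf_of_set ({..<F2} \<times> {..<S2}))"
    using H2 unfolding K2_def by (rule uhash_fs) (use pos in auto)
  have ne: "{..<n} \<noteq> {}" if "0 < n" for n :: nat using that by (simp add: lessThan_empty_iff)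

  have h3: "expectation H3 (hit rvX1 Y \<theta>3) \<le> \<eta>"
    using hit_expectation[OF H3 K_fin(7,8) th(4)] cl(4) by (simp add: cards)
  have h0: "expectation H0 (\<lambda>h. hit rvU E \<theta>0 (fst \<circ> h)) \<le> \<eta>" for E :: "_ \<Rightarrow> 'e"
    using hit_expectation[OF H0' _ ne[OF pos(1)] th(1), of \<eta> E] cl(1) by simp
  have h1: "expectation H1 (\<lambda>h. hit rvV1 E \<theta>1 (fst \<circ> h)) \<le> \<eta>" for E :: "_ \<Rightarrow> 'e"
    using hit_expectation[OF H1' _ ne[OF pos(4)] th(2), of \<eta> E] cl(2) by simp
  have h2: "expectation H2 (\<lambda>h. hit rvV2 E \<theta>2 (fst \<circ> h)) \<le> \<eta>" for E :: "_ \<Rightarrow> 'e"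
    using hit_expectation[OF H2' _ ne[OF pos(7)] th(3), of \<eta> E] cl(3) by simp

  have L12: "expectation (pair_pmf H1 H2) (\<lambda>h. LH12 (fst h) (snd h)) \<le> 7 * \<eta>"
    unfolding LH12_def
    by (rule hash_uniform2_peak[OF K_fin(3-6) H1 H2 tau]) (use pk in \<open>simp_all add: cards\<close>)
  have L0: "expectation H0 D0 \<le> 6 * \<eta>"
    using c
  proof
    assume c1: "C1 = 1 \<and> C2 = 1"
    have "D0 h \<le> 0" if "h \<in> set_pmf H0" for h
      using H0 that c1 K_fin by (subst D0_trivial) (auto simp: uhash_def)
    then have "expectation H0 D0 \<le> expectation H0 (\<lambda>_. 0)"
      by (rule expectation_mono[OF finH(2)])
    then show ?thesis using eta by simp
  next
    assume "peak J rvU (\<lambda>_. ()) (\<tau> / (F0 * (C1 * C2))) \<le> \<eta>"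
    then have "expectation H0 LH0 \<le> 3 * \<eta>"
      unfolding LH0_def[abs_def]
      by (intro hash_uniform1_peak[OF K_fin(1,2) H0 tau]) (simp add: cards)
    moreover have "expectation H0 D0 \<le> expectation H0 (\<lambda>h. 2 * LH0 h)"
      by (rule expectation_mono[OF finH(2) D0_le])
    ultimately show ?thesis by simp
  qed
  have L2: "expectation H2 LS2 \<le> 3 * \<eta>"
  proof -
    have "expectation (map_pmf fs H2) (\<lambda>h. l1 (map_pmf (\<lambda>w. (h (rvV2 w), (Y w, rvU w, rvV1 w, rvX1 w))) J)
      (pair_pmf (pmf_of_set ({..<F2} \<times> {..<S2})) (map_pmf (Y \<star> rvU \<star> rvV1 \<star> rvX1) J))) \<le> 3 * \<eta>"
      by (rule hash_uniform1_peak[OF _ _ H2s tau])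
        (use s2 pos in \<open>simp_all add: card_cartesian_product lessThan_empty_iff\<close>)
    then show ?thesis by (simp add: LS2_def[abs_def])
  qed
  \<comment> \<open>A bound \<open>L\<close> on the whole tuple of hash functions hides which
    alternative of \<open>s1\<close> holds, so the averaging below is done once.\<close>
  have S1: "\<exists>L. ?E L \<le> 7 * \<eta> \<and> (\<forall>h0 h1 h2 h3. SEC1 h0 h1 h2 h3 \<le> 2 * L (h0, h1, h2, h3))"
    using s1
  proof
    assume a: "peak J rvV1 (Z \<star> rvU \<star> rvV2) (\<tau> / (F1 * S1)) \<le> \<eta>
        \<and> peak J rvX1 (Z \<star> rvU \<star> rvV2) (\<tau> / F3) \<le> \<eta>
        \<and> peak J (rvV1 \<star> rvX1) (Z \<star> rvU \<star> rvV2) (\<tau> / (F1 * S1 * F3)) \<le> \<eta>"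
    have "expectation (pair_pmf (map_pmf fs H1) H3) (\<lambda>h. l1 (map_pmf (\<lambda>w. ((fst h (rvV1 w), snd h (rvX1 w)), (Z w, rvU w, rvV2 w))) J)
    (pair_pmf (pmf_of_set (({..<F1} \<times> {..<S1}) \<times> K3)) (map_pmf (Z \<star> rvU \<star> rvV2) J))) \<le> 7 * \<eta>"
      by (rule hash_uniform2_peak[OF _ _ K_fin(7,8) H1s H3 tau])
        (use a pos in \<open>simp_all add: card_cartesian_product lessThan_empty_iff cards\<close>)
    then have "expectation (pair_pmf H1 H3) (\<lambda>h. LS1 (fst h) (snd h)) \<le> 7 * \<eta>"
      by (simp add: LS1_def pair_map_pmf1)
    then have "?E (\<lambda>h. LS1 (fst (snd h)) (snd (snd (snd h)))) \<le> 7 * \<eta>"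
      using E13[of "\<lambda>h. LS1 (fst h) (snd h)"] by simp
    then show ?thesis
      by (intro exI[of _ "\<lambda>h. LS1 (fst (snd h)) (snd (snd (snd h)))"]) (simp add: SEC1_le)
  next
    assume a: "peak J rvV1 (Z \<star> rvU \<star> rvV2 \<star> rvX1) (\<tau> / (F1 * S1)) \<le> \<eta>"
    have "expectation (map_pmf fs H1) (\<lambda>h. l1 (map_pmf (\<lambda>w. (h (rvV1 w), (Z w, rvU w, rvV2 w, rvX1 w))) J)
      (pair_pmf (pmf_of_set ({..<F1} \<times> {..<S1})) (map_pmf (Z \<star> rvU \<star> rvV2 \<star> rvX1) J))) \<le> 3 * \<eta>"
      by (rule hash_uniform1_peak[OF _ _ H1s tau])
        (use a pos in \<open>simp_all add: card_cartesian_product lessThan_empty_iff\<close>)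
    then have "expectation H1 LS1' \<le> 3 * \<eta>" by (simp add: LS1'_def[abs_def])
    then have "?E (\<lambda>h. LS1' (fst (snd h))) \<le> 7 * \<eta>" using eta by (simp only: E1)
    then show ?thesis
      by (intro exI[of _ "\<lambda>h. LS1' (fst (snd h))"]) (simp add: SEC1_le')
  qed
  then obtain L where L: "?E L \<le> 7 * \<eta>" "\<And>h0 h1 h2 h3. SEC1 h0 h1 h2 h3 \<le> 2 * L (h0, h1, h2, h3)" by blast

  \<comment> \<open>A bound of the loss whose summands have known means. The
    \<open>5 * \<eta>\<close> are the five misses, which do not depend on the hashes; 2 comes from
    the secrecy lemmas, and 12 is the 6 in \<open>loss\<close> times the 2 in
    \<open>DD_le\<close>.\<close>
  let ?B = "\<lambda>h. (5 * \<eta> + hit rvX1 Y \<theta>3 (snd (snd (snd h)))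
     + hit rvU (Y \<star> rvX1) \<theta>0 (fst \<circ> fst h) + hit rvV1 (Y \<star> rvX1 \<star> rvU) \<theta>1 (fst \<circ> fst (snd h))
     + hit rvU Z \<theta>0 (fst \<circ> fst h) + hit rvV2 (Z \<star> rvU) \<theta>2 (fst \<circ> fst (snd (snd h))))
     + 2 * L h + 2 * LS2 (fst (snd (snd h))) + 12 * LH12 (fst (snd h)) (fst (snd (snd h))) + 12 * D0 (fst h)"
  obtain h where h: "?B h \<le> ?E ?B" using ex_le_expectation[OF finH(1), of ?B] by blast
  have "?E ?B = (5 * \<eta> + ?E (\<lambda>h. hit rvX1 Y \<theta>3 (snd (snd (snd h))))
     + ?E (\<lambda>h. hit rvU (Y \<star> rvX1) \<theta>0 (fst \<circ> fst h)) + ?E (\<lambda>h. hit rvV1 (Y \<star> rvX1 \<star> rvU) \<theta>1 (fst \<circ> fst (snd h)))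
     + ?E (\<lambda>h. hit rvU Z \<theta>0 (fst \<circ> fst h)) + ?E (\<lambda>h. hit rvV2 (Z \<star> rvU) \<theta>2 (fst \<circ> fst (snd (snd h)))))
     + 2 * ?E L + 2 * ?E (\<lambda>h. LS2 (fst (snd (snd h)))) + 12 * ?E (\<lambda>h. LH12 (fst (snd h)) (fst (snd (snd h))))
     + 12 * ?E (\<lambda>h. D0 (fst h))"
    by (simp add: int)
  \<comment> \<open>In units of \<open>\<eta>\<close>: 5 misses, 5 hits, 14 and 6 for secrecy, 84
    and 72 for uniformity, which is 186 in total.\<close>
  also have "\<dots> \<le> 200 * \<eta>"
  proof -
    have a: "?E (\<lambda>h. hit rvX1 Y \<theta>3 (snd (snd (snd h)))) \<le> \<eta>"
      using h3 by (simp only: E3)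
    have b: "?E (\<lambda>h. hit rvU E \<theta>0 (fst \<circ> fst h)) \<le> \<eta>" for E :: "_ \<Rightarrow> 'e"
      using h0[of E] by (simp only: E0[of "\<lambda>h. hit rvU E \<theta>0 (fst \<circ> h)"])
    have c: "?E (\<lambda>h. hit rvV1 E \<theta>1 (fst \<circ> fst (snd h))) \<le> \<eta>" for E :: "_ \<Rightarrow> 'e"
      using h1[of E] by (simp only: E1[of "\<lambda>h. hit rvV1 E \<theta>1 (fst \<circ> h)"])
    have d: "?E (\<lambda>h. hit rvV2 E \<theta>2 (fst \<circ> fst (snd (snd h)))) \<le> \<eta>" for E :: "_ \<Rightarrow> 'e"
      using h2[of E] by (simp only: E2[of "\<lambda>h. hit rvV2 E \<theta>2 (fst \<circ> h)"])
    have e: "?E (\<lambda>h. LS2 (fst (snd (snd h)))) \<le> 3 * \<eta>"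
      using L2 by (simp only: E2)
    have f: "?E (\<lambda>h. LH12 (fst (snd h)) (fst (snd (snd h)))) \<le> 7 * \<eta>"
      using L12 E12[of "\<lambda>h. LH12 (fst h) (snd h)"] by simp
    have g: "?E (\<lambda>h. D0 (fst h)) \<le> 6 * \<eta>"
      using L0 by (simp only: E0)
    show ?thesis
      using a b[of "Y \<star> rvX1"] b[of Z] c[of "Y \<star> rvX1 \<star> rvU"] d[of "Z \<star> rvU"] e f g L(1) eta
      by linarith
  qed
  finally have fin: "?B h \<le> 200 * \<eta>" using h by linarith
  obtain h0 h1 h2 h3 where hh: "h = (h0, h1, h2, h3)" by (metis prod.exhaust)
  have aux: "e1 + e2 + s1 + s2 + 6 * d \<le> 200 * \<eta>"
    if "(5 * \<eta> + c1 + c2 + c3 + c4 + c5) + 2 * l1 + 2 * l2 + 12 * l3 + 12 * l4 \<le> 200 * \<eta>"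
      "m1 \<le> \<eta>" "m2 \<le> \<eta>" "m3 \<le> \<eta>" "m4 \<le> \<eta>" "m5 \<le> \<eta>"
      "e1 \<le> (m1 + c1) + (m2 + c2) + (m3 + c3)" "e2 \<le> (m4 + c4) + (m5 + c5)"
      "s1 \<le> 2 * l1" "s2 \<le> 2 * l2" "d \<le> 2 * (l3 + l4)"
    for e1 e2 s1 s2 d c1 c2 c3 c4 c5 l1 l2 l3 l4 m1 m2 m3 m4 m5 :: real
    using that unfolding distrib_left by linarith
  from aux[OF fin[unfolded hh fst_conv snd_conv] ms err1_le err2_le L(2) SEC2_le DD_le]
  show ?thesis unfolding loss_def by blast
qed

text \<open>Fixing the public values removes all shared randomness: the encoder and the relay then
  draw from conditioned laws known in advance. The four terms are nonnegative, so each is at most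
  their sum.\<close>

lemma one_shot_code:
  assumes good: "loss \<theta>0 \<theta>1 \<theta>2 \<theta>3 h0 h1 h2 h3 \<le> \<epsilon>"
  shows "\<exists>Qc Rc d1 d2. (\<forall>m. set_pmf (Qc m) \<subseteq> set_pmf Q) \<and> set_pmf Rc \<subseteq> set_pmf R \<and>
    reliable_secret (bind_pmf (pmf_of_set (M1 \<times> M2)) (\<lambda>m. map_pmf (Pair m) (source (Qc m) Rc \<kappa>))) Y Z d1 d2 S1 S2 \<epsilon>"
proof -
  let ?fq = "fq h0 h1 h2" and ?mq = "mq h0 h1 h2"
  let ?d1 = "dec1 \<theta>0 \<theta>1 \<theta>3 h0 h1 h3" and ?d2 = "dec2 \<theta>0 \<theta>2 h0 h2"
  let ?A = "map_pmf (\<lambda>(q, r, c). ((?fq q, h3 r), ?mq q, q, r, c)) (source Q R \<kappa>)"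
  let ?B = "coded Q R \<kappa> ?fq ?mq h3 (pmf_of_set (M1 \<times> M2))"
  let ?E1 = "{x. ?d1 (fst x) (Y (snd (snd x))) \<noteq> fst (fst (snd x))}"
  let ?E2 = "{x. ?d2 (fst x) (Z (snd (snd x))) \<noteq> snd (fst (snd x))}"
  let ?t1 = "\<lambda>fg. l1 (map_pmf (\<lambda>w. (fst (snd (fst (fst w))), Z (snd w))) (?B fg))
            (pair_pmf (unif S1) (map_pmf (\<lambda>w. Z (snd w)) (?B fg)))"
  let ?t2 = "\<lambda>fg. l1 (map_pmf (\<lambda>w. (fst (snd (snd (fst w))), Y (snd w))) (?B fg))
            (pair_pmf (unif S2) (map_pmf (\<lambda>w. Y (snd w)) (?B fg)))"
  have A: "?A = map_pmf (\<lambda>w. ((?fq (fst w), h3 (rvX1 w)), ?mq (fst w), w)) J"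
    by (simp add: J_def case_prod_unfold rvX1_def)
  have finU: "finite (set_pmf (pmf_of_set (M1 \<times> M2)))" "finite (set_pmf (unif S1))" "finite (set_pmf (unif S2))"
    using K_fin pos by (auto simp: finite_unif)
  obtain fg where fg: "prob (?B fg) {w. (fg, w) \<in> ?E1} + prob (?B fg) {w. (fg, w) \<in> ?E2} + ?t1 fg + ?t2 fg
     \<le> prob ?A ?E1 + prob ?A ?E2
       + l1 (map_pmf (\<lambda>(fg, w). (fst (snd (fst (fst w))), (fg, Z (snd w)))) ?A)
            (pair_pmf (unif S1) (map_pmf (\<lambda>(fg, w). (fg, Z (snd w))) ?A))
       + l1 (map_pmf (\<lambda>(fg, w). (fst (snd (snd (fst w))), (fg, Y (snd w)))) ?A)
            (pair_pmf (unif S2) (map_pmf (\<lambda>(fg, w). (fg, Y (snd w))) ?A))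
       + 6 * DD h0 h1 h2"
    using coded_exists[where \<kappa> = \<kappa> and fq = ?fq and fr = h3 and mq = ?mq and ?E1.0 = ?E1 and ?E2.0 = ?E2
        and ?s1.0 = "\<lambda>w. fst (snd (fst (fst w)))" and ?z1.0 = "\<lambda>w. Z (snd w)"
        and ?s2.0 = "\<lambda>w. fst (snd (snd (fst w)))" and ?z2.0 = "\<lambda>w. Y (snd w)",
        OF finQ finR fin\<kappa> finU]
    unfolding DD_def[symmetric] by (elim exE) (rule that)
  also have "\<dots> = loss \<theta>0 \<theta>1 \<theta>2 \<theta>3 h0 h1 h2 h3"
    unfolding A by (simp add: loss_def err1_def err2_def SEC1_def SEC2_def pmf.map_comp o_def vimage_def mq_def rvV1_def rvV2_def)
  also note good
  finally have tot: "prob (?B fg) {w. (fg, w) \<in> ?E1} + prob (?B fg) {w. (fg, w) \<in> ?E2} + ?t1 fg + ?t2 fg \<le> \<epsilon>" .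
  have "0 \<le> prob (?B fg) {w. (fg, w) \<in> ?E1}" "0 \<le> prob (?B fg) {w. (fg, w) \<in> ?E2}" "0 \<le> ?t1 fg" "0 \<le> ?t2 fg"
    by (rule measure_nonneg l1_nonneg)+
  with tot have "prob (?B fg) {w. (fg, w) \<in> ?E1} \<le> \<epsilon>" "prob (?B fg) {w. (fg, w) \<in> ?E2} \<le> \<epsilon>" "?t1 fg \<le> \<epsilon>" "?t2 fg \<le> \<epsilon>"
    by linarith+
  then have "reliable_secret (?B fg) Y Z (?d1 fg) (?d2 fg) S1 S2 \<epsilon>"
    by (simp add: reliable_secret_def)
  then show ?thesis
    unfolding coded_def
    by (intro exI[of _ "\<lambda>m. condp Q (\<lambda>q. (?fq q, ?mq q)) (fst fg, m)"] exI[of _ "condp R h3 (snd fg)"]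
        exI[of _ "?d1 fg"] exI[of _ "?d2 fg"]) (simp add: set_condp)
qed

end

section \<open>Block codes for the channel\<close>

fun pmf_list :: "'x pmf list \<Rightarrow> 'x list pmf" where
  "pmf_list [] = return_pmf []"
| "pmf_list (p # ps) = bind_pmf p (\<lambda>x. map_pmf ((#) x) (pmf_list ps))"

lemma finite_pmf_list: "(\<And>p. p \<in> set ps \<Longrightarrow> finite (set_pmf p)) \<Longrightarrow> finite (set_pmf (pmf_list ps))"
  by (induction ps) auto

lemma length_pmf_list: "xs \<in> set_pmf (pmf_list ps) \<Longrightarrow> length xs = length ps"
  by (induction ps arbitrary: xs) auto

definition letter :: "('x,'x1,'y,'y1,'z) channel \<Rightarrow> 'x \<Rightarrow> 'x1 \<Rightarrow> ('x1 \<times> 'y \<times> 'y1 \<times> 'z) pmf" where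
  "letter W x x1 = map_pmf (Pair x1) (W x x1)"

definition kern1 :: "('x,'x1,'y,'y1,'z) channel \<Rightarrow> (triple \<Rightarrow> 'x pmf) \<Rightarrow> triple \<Rightarrow> 'x1
    \<Rightarrow> ('x1 \<times> 'y \<times> 'y1 \<times> 'z) pmf" where
  "kern1 W PX q x1 = bind_pmf (PX q) (\<lambda>x. letter W x x1)"

definition unzip3 :: "('a \<times> 'b \<times> 'c) list \<Rightarrow> 'a list \<times> 'b list \<times> 'c list" where
  "unzip3 l = (map fst l, map (\<lambda>x. fst (snd x)) l, map (\<lambda>x. snd (snd x)) l)"

definition zip3 :: "'a list \<times> 'b list \<times> 'c list \<Rightarrow> ('a \<times> 'b \<times> 'c) list" where
  "zip3 x = zip (fst x) (zip (fst (snd x)) (snd (snd x)))"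

lemma zip3_unzip3 [simp]: "zip3 (unzip3 l) = l"
  by (induction l) (auto simp: zip3_def unzip3_def)

definition encx :: "(triple \<Rightarrow> 'x pmf) \<Rightarrow> nat list \<times> nat list \<times> nat list \<Rightarrow> 'x list pmf" where
  "encx PX q = pmf_list (map PX (zip3 q))"

text \<open>The relay looks at its past only for the time index, counted from 0, and sends a
  prescribed word \<open>r\<close>. This is a legitimate causal strategy under which X1 stays
  independent of the encoder.\<close>

definition kern :: "('x,'x1,'y,'y1,'z) channel \<Rightarrow> (triple \<Rightarrow> 'x pmf)
    \<Rightarrow> nat list \<times> nat list \<times> nat list \<Rightarrow> 'x1 list \<Rightarrow> ('x1 \<times> 'y \<times> 'y1 \<times> 'z) list pmf" where
  "kern W PX q r = bind_pmf (encx PX q) (chan_run W (\<lambda>past. r ! length past) [])"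

text \<open>With a prescribed relay word the channel acts letter by letter. The induction moves
  along the input word while \<open>past\<close> grows, so the statement is about the part of
  \<open>r\<close> still to be sent.\<close>

lemma chan_run_fixed:
  "length past + length xs \<le> length r \<Longrightarrow>
   chan_run W (\<lambda>past. r ! length past) past xs = pmf_list (map2 (letter W) xs (drop (length past) r))"
proof (induction xs arbitrary: past)
  case (Cons x xs)
  have d: "drop (length past) r = r ! length past # drop (Suc (length past)) r"
    using Cons.prems by (simp add: Cons_nth_drop_Suc)
  have "chan_run W (\<lambda>past. r ! length past) (past @ [y1]) xs
      = pmf_list (map2 (letter W) xs (drop (Suc (length past)) r))" for y1
    using Cons.IH[of "past @ [y1]"] Cons.prems by simp
  then show ?case
    by (simp add: d letter_def map_pmf_def bind_assoc_pmf bind_return_pmf case_prod_unfold)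
qed simp

lemma finite_chan_run:
  fixes W :: "'x::finite \<Rightarrow> 'x1::finite \<Rightarrow> ('y::finite \<times> 'y1::finite \<times> 'z::finite) pmf"
  shows "finite (set_pmf (chan_run W s past xs))"
  by (induction xs arbitrary: past) (auto simp: case_prod_unfold)

lemma pmf_list_kern:
  assumes "length qs = length rs"
  shows "bind_pmf (pmf_list (map PX qs)) (\<lambda>xs. pmf_list (map2 (letter W) xs rs)) = pmf_list (map2 (kern1 W PX) qs rs)"
  using assms
proof (induction qs rs rule: list_induct2)
  case (Cons q qs r rs)
  have "bind_pmf (pmf_list (map PX (q # qs))) (\<lambda>xs. pmf_list (map2 (letter W) xs (r # rs)))
      = bind_pmf (PX q) (\<lambda>x. bind_pmf (pmf_list (map PX qs)) (\<lambda>xs. bind_pmf (letter W x r)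
          (\<lambda>c. map_pmf ((#) c) (pmf_list (map2 (letter W) xs rs)))))"
    by (simp add: bind_assoc_pmf bind_map_pmf)
  also have "\<dots> = bind_pmf (PX q) (\<lambda>x. bind_pmf (letter W x r) (\<lambda>c. bind_pmf (pmf_list (map PX qs))
          (\<lambda>xs. map_pmf ((#) c) (pmf_list (map2 (letter W) xs rs)))))"
    by (subst bind_commute_pmf) (rule refl)
  also have "\<dots> = bind_pmf (kern1 W PX q r) (\<lambda>c. map_pmf ((#) c) (pmf_list (map2 (kern1 W PX) qs rs)))"
    by (simp add: kern1_def bind_assoc_pmf map_bind_pmf[symmetric] Cons.IH)
  finally show ?case by simp
qed (simp add: bind_return_pmf)

lemma kern_unzip3:
  assumes "length qs = length rs"
  shows "kern W PX (unzip3 qs) rs = pmf_list (map2 (kern1 W PX) qs rs)"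
proof -
  have "kern W PX (unzip3 qs) rs = bind_pmf (pmf_list (map PX qs)) (\<lambda>xs. pmf_list (map2 (letter W) xs rs))"
    unfolding kern_def encx_def zip3_unzip3
    by (intro bind_pmf_cong refl) (use assms length_pmf_list in \<open>fastforce simp: chan_run_fixed\<close>)
  then show ?thesis by (simp add: pmf_list_kern[OF assms])
qed

lemma source_lists:
  "bind_pmf (replicate_pmf n P) (\<lambda>qs. bind_pmf (replicate_pmf n R) (\<lambda>rs. map_pmf (\<lambda>c. (qs, rs, c)) (pmf_list (map2 \<kappa> qs rs))))
   = map_pmf unzip3 (replicate_pmf n (source P R \<kappa>))"
proof (induction n)
  case 0
  then show ?case by (simp add: unzip3_def bind_return_pmf)
next
  case (Suc n)
  let ?c = "\<lambda>(w :: 'a \<times> 'b \<times> 'c) (l :: 'a list \<times> 'b list \<times> 'c list). (fst w # fst l, fst (snd w) # fst (snd l), snd (snd w) # snd (snd l))"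
  have "bind_pmf (replicate_pmf (Suc n) P) (\<lambda>qs. bind_pmf (replicate_pmf (Suc n) R) (\<lambda>rs. map_pmf (\<lambda>c. (qs, rs, c)) (pmf_list (map2 \<kappa> qs rs))))
     = bind_pmf P (\<lambda>q. bind_pmf (replicate_pmf n P) (\<lambda>qs. bind_pmf R (\<lambda>r. bind_pmf (replicate_pmf n R) (\<lambda>rs.
         bind_pmf (\<kappa> q r) (\<lambda>c. map_pmf (\<lambda>cs. (q # qs, r # rs, c # cs)) (pmf_list (map2 \<kappa> qs rs)))))))"
    by (simp add: bind_assoc_pmf bind_return_pmf map_bind_pmf pmf.map_comp o_def)
  also have "\<dots> = bind_pmf P (\<lambda>q. bind_pmf R (\<lambda>r. bind_pmf (replicate_pmf n P) (\<lambda>qs. bind_pmf (replicate_pmf n R) (\<lambda>rs.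
         bind_pmf (\<kappa> q r) (\<lambda>c. map_pmf (\<lambda>cs. (q # qs, r # rs, c # cs)) (pmf_list (map2 \<kappa> qs rs)))))))"
    by (subst bind_commute_pmf[of "replicate_pmf n P" R]) (rule refl)
  also have "\<dots> = bind_pmf P (\<lambda>q. bind_pmf R (\<lambda>r. bind_pmf (replicate_pmf n P) (\<lambda>qs. bind_pmf (\<kappa> q r) (\<lambda>c. bind_pmf (replicate_pmf n R) (\<lambda>rs.
         map_pmf (\<lambda>cs. (q # qs, r # rs, c # cs)) (pmf_list (map2 \<kappa> qs rs)))))))"
    by (subst bind_commute_pmf[of "replicate_pmf n R"]) (rule refl)
  also have "\<dots> = bind_pmf P (\<lambda>q. bind_pmf R (\<lambda>r. bind_pmf (\<kappa> q r) (\<lambda>c. bind_pmf (replicate_pmf n P) (\<lambda>qs. bind_pmf (replicate_pmf n R) (\<lambda>rs.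
         map_pmf (\<lambda>cs. (q # qs, r # rs, c # cs)) (pmf_list (map2 \<kappa> qs rs)))))))"
    by (subst bind_commute_pmf[of "replicate_pmf n P"]) (rule refl)
  also have "\<dots> = bind_pmf (source P R \<kappa>) (\<lambda>w. map_pmf (?c w) (bind_pmf (replicate_pmf n P) (\<lambda>qs. bind_pmf (replicate_pmf n R)
         (\<lambda>rs. map_pmf (\<lambda>c. (qs, rs, c)) (pmf_list (map2 \<kappa> qs rs))))))"
    by (simp add: source_def bind_assoc_pmf bind_map_pmf map_bind_pmf pmf.map_comp o_def)
  also have "\<dots> = map_pmf unzip3 (replicate_pmf (Suc n) (source P R \<kappa>))"
    unfolding Suc.IH by (simp add: map_bind_pmf pmf.map_comp o_def unzip3_def map_pmf_def[symmetric])
  finally show ?case .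
qed

definition split_sample :: "(('a \<times> 'b \<times> 'c) \<times> 'r \<times> 'o) list \<Rightarrow> ('a list \<times> 'b list \<times> 'c list) \<times> 'r list \<times> 'o list" where
  "split_sample ws = (unzip3 (map fst ws), map (\<lambda>w. fst (snd w)) ws, map (\<lambda>w. snd (snd w)) ws)"

text \<open>The block source is a reshaped i.i.d. sample of the single-letter source, which makes
  the equipartition bounds available for the one-shot code. The letters of X are absorbed into the
  kernel.\<close>

lemma source_kern:
  "source (map_pmf unzip3 (replicate_pmf n P)) (replicate_pmf n R) (kern W PX)
   = map_pmf split_sample (replicate_pmf n (source P R (kern1 W PX)))"
proof -
  have "source (map_pmf unzip3 (replicate_pmf n P)) (replicate_pmf n R) (kern W PX)
     = bind_pmf (replicate_pmf n P) (\<lambda>qs. bind_pmf (replicate_pmf n R) (\<lambda>rs.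
         map_pmf (\<lambda>c. (unzip3 qs, rs, c)) (pmf_list (map2 (kern1 W PX) qs rs))))"
    unfolding source_def bind_map_pmf
    by (intro bind_pmf_cong refl) (simp add: set_replicate_pmf kern_unzip3)
  also have "\<dots> = map_pmf (\<lambda>x. (unzip3 (fst x), snd x)) (bind_pmf (replicate_pmf n P) (\<lambda>qs. bind_pmf (replicate_pmf n R) (\<lambda>rs.
         map_pmf (\<lambda>c. (qs, rs, c)) (pmf_list (map2 (kern1 W PX) qs rs)))))"
    by (simp add: map_bind_pmf pmf.map_comp o_def)
  also have "\<dots> = map_pmf split_sample (replicate_pmf n (source P R (kern1 W PX)))"
    unfolding source_lists by (simp add: pmf.map_comp o_def split_sample_def[abs_def] unzip3_def)
  finally show ?thesis .
qed

definition traceY :: "('x1 \<times> 'y \<times> 'y1 \<times> 'z) list \<Rightarrow> 'y list" where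
  "traceY os = map (\<lambda>(x1, y, y1, z). y) os"

definition traceZ :: "('x1 \<times> 'y \<times> 'y1 \<times> 'z) list \<Rightarrow> 'z list" where
  "traceZ os = map (\<lambda>(x1, y, y1, z). z) os"

lemma finite_encx:
  fixes PX :: "triple \<Rightarrow> 'x::finite pmf"
  shows "finite (set_pmf (encx PX q))"
  unfolding encx_def by (rule finite_pmf_list) simp

lemma finite_kern:
  fixes W :: "'x::finite \<Rightarrow> 'x1::finite \<Rightarrow> ('y::finite \<times> 'y1::finite \<times> 'z::finite) pmf"
  shows "finite (set_pmf (kern W PX q r))"
  unfolding kern_def by (simp add: finite_encx finite_chan_run)

text \<open>Only the message law and the outputs of the coded experiment survive in
  \<open>code_pmf\<close>, and \<open>push\<close> identifies the two. Errors and equivocations are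
  then transferred without loss.\<close>

lemma code_from_coded:
  fixes W :: "'x::finite \<Rightarrow> 'x1::finite \<Rightarrow> ('y::finite \<times> 'y1::finite \<times> 'z::finite) pmf"
    and PX :: "triple \<Rightarrow> 'x pmf" and M1 M2 :: "triple set"
  assumes M: "finite M1" "M1 \<noteq> {}" "finite M2" "M2 \<noteq> {}"
    and Qc: "\<And>m. finite (set_pmf (Qc m))" "\<forall>m. \<forall>q\<in>set_pmf (Qc m). length (zip3 q) = n"
    and Rc: "finite (set_pmf Rc)"
  defines "B \<equiv> bind_pmf (pmf_of_set (M1 \<times> M2)) (\<lambda>m. map_pmf (Pair m) (source (Qc m) Rc (kern W PX)))"
  assumes B: "reliable_secret B (rvO traceY) (rvO traceZ) d1 d2 S1 S2 e"
    and S: "2 \<le> S1" "2 \<le> S2" and n: "0 < n"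
  shows "\<exists>enc rel dec1 dec2. valid_code n (card M1) (card M2) enc \<and>
     Pe1 W (card M1) (card M2) enc rel dec1 \<le> e \<and> Pe2 W (card M1) (card M2) enc rel dec2 \<le> e \<and>
     (1 - 2 * e) * (log 2 S1 - 1) \<le> n * Delta1 W n (card M1) (card M2) enc rel \<and>
     (1 - 2 * e) * (log 2 S2 - 1) \<le> n * Delta2 W n (card M1) (card M2) enc rel"
proof -
  have e1: "prob B {w. d1 (traceY (snd (snd (snd w)))) \<noteq> fst (fst w)} \<le> e"
    and e2: "prob B {w. d2 (traceZ (snd (snd (snd w)))) \<noteq> snd (fst w)} \<le> e"
    and s1: "l1 (map_pmf (\<lambda>w. (fst (snd (fst (fst w))), traceZ (snd (snd (snd w))))) B)
           (pair_pmf (pmf_of_set {..<S1}) (map_pmf (\<lambda>w. traceZ (snd (snd (snd w)))) B)) \<le> e"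
    and s2: "l1 (map_pmf (\<lambda>w. (fst (snd (snd (fst w))), traceY (snd (snd (snd w))))) B)
           (pair_pmf (pmf_of_set {..<S2}) (map_pmf (\<lambda>w. traceY (snd (snd (snd w)))) B)) \<le> e"
    using B by (simp_all add: reliable_secret_def rvO_def)
  have S': "2 \<le> card {..<S1}" "2 \<le> card {..<S2}" using S by simp_all
  \<comment> \<open>Messages of a code are initial segments of the naturals, so the triples are
    enumerated and the decoders return numbers.\<close>
  obtain b1 where b1: "bij_betw b1 {..<card M1} M1"
    using ex_bij_betw_nat_finite[OF M(1)] by (auto simp: atLeast0LessThan)
  obtain b2 where b2: "bij_betw b2 {..<card M2} M2"
    using ex_bij_betw_nat_finite[OF M(3)] by (auto simp: atLeast0LessThan)
  define enc where "enc w1 w2 = bind_pmf (Qc (b1 w1, b2 w2)) (encx PX)" for w1 w2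
  define rel :: "('y1 list \<Rightarrow> 'x1) pmf" where "rel = map_pmf (\<lambda>r past. r ! length past) Rc"
  define dec1 where "dec1 y = inv_into {..<card M1} b1 (d1 y)" for y
  define dec2 where "dec2 z = inv_into {..<card M2} b2 (d2 z)" for z
  let ?C = "code_pmf W (card M1) (card M2) enc rel"
  have ne: "{..<card M1} \<noteq> {}" "{..<card M2} \<noteq> {}" using M by (auto simp: lessThan_empty_iff)
  have C: "?C = bind_pmf (pmf_of_set {..<card M1}) (\<lambda>w1. bind_pmf (pmf_of_set {..<card M2}) (\<lambda>w2.
      map_pmf (\<lambda>w. (w1, w2, snd (snd w))) (source (Qc (b1 w1, b2 w2)) Rc (kern W PX))))"
  proof -
    have "?C = bind_pmf (pmf_of_set {..<card M1}) (\<lambda>w1. bind_pmf (pmf_of_set {..<card M2}) (\<lambda>w2.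
       bind_pmf (Qc (b1 w1, b2 w2)) (\<lambda>q. bind_pmf (encx PX q) (\<lambda>xs. bind_pmf Rc (\<lambda>r.
         map_pmf (\<lambda>os. (w1, w2, os)) (chan_run W (\<lambda>past. r ! length past) [] xs))))))"
      by (simp add: code_pmf_def enc_def rel_def bind_assoc_pmf bind_map_pmf)
    also have "\<dots> = bind_pmf (pmf_of_set {..<card M1}) (\<lambda>w1. bind_pmf (pmf_of_set {..<card M2}) (\<lambda>w2.
       bind_pmf (Qc (b1 w1, b2 w2)) (\<lambda>q. bind_pmf Rc (\<lambda>r. bind_pmf (encx PX q) (\<lambda>xs.
         map_pmf (\<lambda>os. (w1, w2, os)) (chan_run W (\<lambda>past. r ! length past) [] xs))))))"
      by (subst bind_commute_pmf[of Rc]) (rule refl)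
    also have "\<dots> = bind_pmf (pmf_of_set {..<card M1}) (\<lambda>w1. bind_pmf (pmf_of_set {..<card M2}) (\<lambda>w2.
      map_pmf (\<lambda>w. (w1, w2, snd (snd w))) (source (Qc (b1 w1, b2 w2)) Rc (kern W PX))))"
      by (simp add: source_def kern_def map_bind_pmf pmf.map_comp o_def)
    finally show ?thesis .
  qed
  have finsrc: "finite (set_pmf (source (Qc m) Rc (kern W PX)))" for m
    using Qc(1) Rc finite_kern by (rule finite_source)
  have finC: "finite (set_pmf ?C)"
    unfolding C using ne finsrc by simp
  have setC: "fst t < card M1 \<and> fst (snd t) < card M2" if "t \<in> set_pmf ?C" for t
    using that ne unfolding C by auto
  have push: "map_pmf (\<lambda>t. (b1 (fst t), b2 (fst (snd t)), snd (snd t))) ?C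
      = map_pmf (\<lambda>w. (fst (fst w), snd (fst w), snd (snd (snd w)))) B"
  proof -
    have "pmf_of_set (M1 \<times> M2) = pair_pmf (map_pmf b1 (pmf_of_set {..<card M1})) (map_pmf b2 (pmf_of_set {..<card M2}))"
      using M ne b1 b2 by (simp add: pmf_of_set_Times map_pmf_of_set_bij_betw)
    then have "B = bind_pmf (pmf_of_set {..<card M1}) (\<lambda>w1. bind_pmf (pmf_of_set {..<card M2}) (\<lambda>w2.
        map_pmf (Pair (b1 w1, b2 w2)) (source (Qc (b1 w1, b2 w2)) Rc (kern W PX))))"
      unfolding B_def by (simp add: pair_pmf_def bind_map_pmf bind_assoc_pmf bind_return_pmf)
    then show ?thesis unfolding C by (simp add: map_bind_pmf pmf.map_comp o_def)
  qed
  have outYZ: "outY t = traceY (snd (snd t))" "outZ t = traceZ (snd (snd t))"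
    for t :: "nat \<times> nat \<times> ('x1 \<times> 'y \<times> 'y1 \<times> 'z) list"
    by (simp_all add: outY_def outZ_def traceY_def traceZ_def)
  have probs: "prob ?C {t. P (b1 (fst t), b2 (fst (snd t)), snd (snd t))}
     = prob B {w. P (fst (fst w), snd (fst w), snd (snd (snd w)))}" for P
    using arg_cong[OF push, of "\<lambda>p. prob p {x. P x}"] by (simp add: vimage_def)
  have sub: "prob ?C S \<le> prob ?C T"
    if "\<And>t. t \<in> set_pmf ?C \<Longrightarrow> t \<in> S \<Longrightarrow> t \<in> T" for S T
    using that by (intro measure_pmf.finite_measure_mono_AE) (auto simp: AE_measure_pmf_iff)
  have "valid_code n (card M1) (card M2) enc"
  proof -
    have "length xs = n" if "xs \<in> set_pmf (enc w1 w2)" for w1 w2 xs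
    proof -
      obtain q where "q \<in> set_pmf (Qc (b1 w1, b2 w2))" "xs \<in> set_pmf (encx PX q)" using \<open>xs \<in> _\<close> by (auto simp: enc_def)
      then show ?thesis using Qc(2) by (metis encx_def length_map length_pmf_list)
    qed
    then show ?thesis using M by (simp add: valid_code_def Suc_le_eq card_gt_0_iff)
  qed
  moreover have "Pe1 W (card M1) (card M2) enc rel dec1 \<le> e"
  proof -
    have "Pe1 W (card M1) (card M2) enc rel dec1
        \<le> prob ?C {t. d1 (traceY (snd (snd t))) \<noteq> b1 (fst t)}"
      unfolding Pe1_def
    proof (rule sub)
      fix t assume t: "t \<in> set_pmf ?C" and "t \<in> {t. dec1 (outY t) \<noteq> fst t}"
      moreover have "inv_into {..<card M1} b1 (b1 (fst t)) = fst t"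
        using setC[OF t] b1 by (intro inv_into_f_f) (auto simp: bij_betw_def)
      ultimately show "t \<in> {t. d1 (traceY (snd (snd t))) \<noteq> b1 (fst t)}"
        by (auto simp: dec1_def outYZ)
    qed
    also have "\<dots> \<le> e"
      using e1 probs[of "\<lambda>x. d1 (traceY (snd (snd x))) \<noteq> fst x"] by simp
    finally show ?thesis .
  qed
  moreover have "Pe2 W (card M1) (card M2) enc rel dec2 \<le> e"
  proof -
    have "Pe2 W (card M1) (card M2) enc rel dec2
        \<le> prob ?C {t. d2 (traceZ (snd (snd t))) \<noteq> b2 (fst (snd t))}"
      unfolding Pe2_def
    proof (rule sub)
      fix t assume t: "t \<in> set_pmf ?C" and "t \<in> {t. dec2 (outZ t) \<noteq> fst (snd t)}"
      moreover have "inv_into {..<card M2} b2 (b2 (fst (snd t))) = fst (snd t)"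
        using setC[OF t] b2 by (intro inv_into_f_f) (auto simp: bij_betw_def)
      ultimately show "t \<in> {t. d2 (traceZ (snd (snd t))) \<noteq> b2 (fst (snd t))}"
        by (auto simp: dec2_def outYZ)
    qed
    also have "\<dots> \<le> e"
      using e2 probs[of "\<lambda>x. d2 (traceZ (snd (snd x))) \<noteq> fst (snd x)"] by simp
    finally show ?thesis .
  qed
  moreover have "(1 - 2 * e) * (log 2 S1 - 1) \<le> n * Delta1 W n (card M1) (card M2) enc rel"
  proof -
    have "l1 (map_pmf (\<lambda>t. (fst (snd (b1 (fst t))), outZ t)) ?C) (pair_pmf (pmf_of_set {..<S1}) (map_pmf outZ ?C)) \<le> e"
      using s1 arg_cong[OF push, of "map_pmf (\<lambda>x. (fst (snd (fst x)), traceZ (snd (snd x))))"]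
        arg_cong[OF push, of "map_pmf (\<lambda>x. traceZ (snd (snd x)))"]
      by (simp add: outYZ[abs_def] pmf.map_comp o_def)
    \<comment> \<open>The equivocation of the whole message number is bounded below through the
      secret component of the triple that it stands for.\<close>
    from cent_ge_uniform[OF finC S'(1), where A = fst and g = "\<lambda>w1. fst (snd (b1 w1))", OF this]
    have "(1 - 2 * e) * (log 2 S1 - 1) \<le> cent ?C fst outZ" by simp
    then show ?thesis using n by (simp add: Delta1_def)
  qed
  moreover have "(1 - 2 * e) * (log 2 S2 - 1) \<le> n * Delta2 W n (card M1) (card M2) enc rel"
  proof -
    have "l1 (map_pmf (\<lambda>t. (fst (snd (b2 (fst (snd t)))), outY t)) ?C) (pair_pmf (pmf_of_set {..<S2}) (map_pmf outY ?C)) \<le> e"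
      using s2 arg_cong[OF push, of "map_pmf (\<lambda>x. (fst (snd (fst (snd x))), traceY (snd (snd x))))"]
        arg_cong[OF push, of "map_pmf (\<lambda>x. traceY (snd (snd x)))"]
      by (simp add: outYZ[abs_def] pmf.map_comp o_def)
    from cent_ge_uniform[OF finC S'(2), where A = "\<lambda>t. fst (snd t)" and g = "\<lambda>w2. fst (snd (b2 w2))", OF this]
    show ?thesis using n by (simp add: Delta2_def)
  qed
  ultimately show ?thesis by blast
qed

text \<open>\<open>A\<close> is, up to an injective encoding, the letter-by-letter application of \<open>a\<close> to a block.\<close>
definition letterwise :: "(('a list \<times> 'b list \<times> 'c list) \<times> 'r list \<times> 'o list \<Rightarrow> 'k) \<Rightarrow> (('a \<times> 'b \<times> 'c) \<times> 'r \<times> 'o \<Rightarrow> 'l) \<Rightarrow> bool" where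
  "letterwise A a \<longleftrightarrow> (\<exists>\<iota>. inj \<iota> \<and> (\<forall>ws. A (split_sample ws) = \<iota> (map a ws)))"

lemma letterwiseI: "(\<And>ws. A (split_sample ws) = map a ws) \<Longrightarrow> letterwise A a"
  unfolding letterwise_def by (intro exI[of _ id]) auto

lemma letterwise_Pair:
  assumes "letterwise A a" "letterwise B b"
  shows "letterwise (A \<star> B) (a \<star> b)"
proof -
  obtain \<iota> \<kappa> where *: "inj \<iota>" "\<And>ws. A (split_sample ws) = \<iota> (map a ws)"
    "inj \<kappa>" "\<And>ws. B (split_sample ws) = \<kappa> (map b ws)"
    using assms unfolding letterwise_def by blast
  have "inj (\<lambda>l. (\<iota> (map fst l), \<kappa> (map snd l)))"
    by (rule injI) (metis *(1,3) injD prod.inject zip_map_fst_snd)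
  then show ?thesis unfolding letterwise_def
    by (intro exI[of _ "\<lambda>l. (\<iota> (map fst l), \<kappa> (map snd l))"]) (simp add: * o_def)
qed

text \<open>Conditioning on an almost surely constant variable is no conditioning. It links a block
  of units to the single unit value.\<close>

lemma cp_const:
  assumes "\<And>w. w \<in> set_pmf P \<Longrightarrow> E w = c" "w \<in> set_pmf P"
  shows "cp P A E a (E w) = cp P A (\<lambda>_. ()) a ()"
proof -
  have "map_pmf (A \<star> E) P = map_pmf (\<lambda>x. (fst x, c)) (map_pmf (\<lambda>w. (A w, ())) P)"
    by (auto simp: pmf.map_comp assms(1) intro!: map_pmf_cong)
  then have "pmf (map_pmf (A \<star> E) P) (a, c) = pmf (map_pmf (\<lambda>w. (A w, ())) P) (a, ())"
    using pmf_map_inj'[of "\<lambda>x::_ \<times> unit. (fst x, c)" "map_pmf (\<lambda>w. (A w, ())) P" "(a, ())"] by (simp add: inj_def)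
  moreover have "map_pmf E P = map_pmf (\<lambda>_. c) P" by (intro map_pmf_cong) (auto simp: assms(1))
  ultimately show ?thesis by (simp add: cp_def assms)
qed

section \<open>Hash sizes and typical blocks for large n\<close>

definition sz :: "nat \<Rightarrow> real \<Rightarrow> nat" where "sz n r = nat \<lceil>2 powr (n * r)\<rceil>"

text \<open>Rounding up never lowers a rate, as decoding demands, and at most doubles the size; the
  doubling is the 1 in the exponent. Doubling suffices because the power is at least 1 for a
  nonnegative rate.\<close>

lemma sz_bounds:
  assumes "0 \<le> r"
  shows "2 powr (n * r) \<le> sz n r" "real (sz n r) \<le> 2 powr (n * r + 1)" "0 < sz n r"
proof -
  have "1 \<le> (2::real) powr (n * r)" using assms by (simp add: ge_one_powr_ge_zero)
  moreover have "real (sz n r) = of_int \<lceil>2 powr (n * r)\<rceil>"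
  proof -
    have "0 \<le> \<lceil>2 powr (n * r)\<rceil>" using powr_ge_zero[of 2 "n * r"] by linarith
    then show ?thesis by (simp add: sz_def)
  qed
  moreover have "real_of_int \<lceil>2 powr (n * r)\<rceil> < 2 powr (n * r) + 1" by linarith
  ultimately show "2 powr (n * r) \<le> sz n r" "real (sz n r) \<le> 2 powr (n * r + 1)"
    by (simp_all add: powr_add)
  then have "1 \<le> real (sz n r)" using \<open>1 \<le> 2 powr (n * r)\<close> by linarith
  then show "0 < sz n r" by (cases "sz n r = 0") auto
qed

lemma sz_0 [simp]: "sz n 0 = 1" by (simp add: sz_def)

lemma log_sz:
  assumes "0 \<le> r"
  shows "n * r \<le> log 2 (sz n r)" "log 2 (sz n r) \<le> n * r + 1"
  using sz_bounds[OF assms, of n] by (auto simp: le_log_iff log_le_iff)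

lemma sz_mult_le:
  fixes x y a b i j :: real and n :: nat
  assumes "x \<le> 2 powr (n * a + i)" "y \<le> 2 powr (n * b + j)" "0 \<le> y"
  shows "x * y \<le> 2 powr (n * (a + b) + (i + j))"
proof -
  have "x * y \<le> 2 powr (n * a + i) * 2 powr (n * b + j)"
    using assms by (intro mult_mono) auto
  also have "\<dots> = 2 powr (n * (a + b) + (i + j))"
    by (simp add: powr_add[symmetric] algebra_simps)
  finally show ?thesis .
qed

context
  fixes J :: "(('a \<times> 'b \<times> 'c) \<times> 'r \<times> 'o) pmf"
  assumes finJ: "finite (set_pmf J)"
begin

definition "Jn n = map_pmf split_sample (replicate_pmf n J)"

text \<open>The threshold exponent \<open>r - \<delta> / 2\<close> lies between the conditional
  entropy and the hash rate \<open>r\<close>, at distance at least \<open>\<delta> / 2\<close> from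
  both. The lower gap makes misses rare; the upper gap will make collisions rare.\<close>

lemma ev_miss:
  fixes \<delta> \<eta> r :: real
  assumes A: "letterwise A a" and E: "letterwise E e" and r: "cent J a e + \<delta> \<le> r" and d: "0 < \<delta>" "0 < \<eta>"
  shows "\<forall>\<^sub>F n in sequentially. miss (Jn n) A E (2 powr - (n * (r - \<delta> / 2))) \<le> \<eta>"
proof -
  obtain \<iota> \<kappa> where *: "inj \<iota>" "\<And>ws. A (split_sample ws) = \<iota> (map a ws)"
    "inj \<kappa>" "\<And>ws. E (split_sample ws) = \<kappa> (map e ws)"
    using A E unfolding letterwise_def by blast
  have "0 < \<delta> / 2" using d by simp
  from order_tendstoD(2)[OF cp_tails(1)[OF finJ *(1,3), where f = split_sample and A = A and E = E and a = a and e = e, OF *(2,4) this] d(2)]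
  show ?thesis
  proof (rule eventually_mono)
    fix n assume lt: "prob (map_pmf split_sample (replicate_pmf n J))
      {w. cp (map_pmf split_sample (replicate_pmf n J)) A E (A w) (E w) < 2 powr - (n * (cent J a e + \<delta> / 2))} < \<eta>"
    have "n * (cent J a e + \<delta> / 2) \<le> n * (r - \<delta> / 2)" using r by (intro mult_left_mono) auto
    then have le: "2 powr - (n * (r - \<delta> / 2)) \<le> 2 powr - (n * (cent J a e + \<delta> / 2))" by simp
    have "prob (Jn n) {w. cp (Jn n) A E (A w) (E w) < 2 powr - (n * (r - \<delta> / 2))}
      \<le> prob (Jn n) {w. cp (Jn n) A E (A w) (E w) < 2 powr - (n * (cent J a e + \<delta> / 2))}"
      by (rule measure_pmf.finite_measure_mono, rule Collect_mono, rule impI, erule less_le_trans[OF _ le]) simp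
    then show "miss (Jn n) A E (2 powr - (n * (r - \<delta> / 2))) \<le> \<eta>"
      using lt unfolding Jn_def miss_def by linarith
  qed
qed

lemma ev_powr_large:
  fixes \<delta> b :: real
  assumes "0 < \<delta>" shows "\<forall>\<^sub>F n in sequentially. b \<le> n * \<delta>"
proof -
  obtain N :: nat where N: "b / \<delta> \<le> N" using real_arch_simple by blast
  have "b \<le> n * \<delta>" if "N \<le> n" for n
  proof -
    have "b / \<delta> \<le> n" using N that by linarith
    then show ?thesis using assms by (simp add: field_simps)
  qed
  then show ?thesis by (rule eventually_sequentiallyI)
qed

text \<open>One half of \<open>\<delta>\<close> absorbs the deviation of the block, the other half
  the constants \<open>\<tau>\<close> and 6. The 6 allows for the largest product in use, of six
  rounded sizes, each at most doubled.\<close>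

lemma ev_peak:
  fixes \<delta> \<eta> r \<tau> :: real
  assumes A: "letterwise A a" and E: "letterwise E e" and r: "r + \<delta> \<le> cent J a e" and d: "0 < \<delta>" "0 < \<eta>" "0 < \<tau>"
  shows "\<forall>\<^sub>F n in sequentially. flat (Jn n) A E \<tau> \<eta> (2 powr (n * r + 6))"
proof -
  obtain \<iota> \<kappa> where *: "inj \<iota>" "\<And>ws. A (split_sample ws) = \<iota> (map a ws)"
    "inj \<kappa>" "\<And>ws. E (split_sample ws) = \<kappa> (map e ws)"
    using A E unfolding letterwise_def by blast
  have d2: "0 < \<delta> / 2" using d by simp
  note t = order_tendstoD(2)[OF cp_tails(2)[OF finJ *(1,3), where f = split_sample and A = A and E = E and a = a and e = e, OF *(2,4) d2] d(2)]
  show ?thesis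
    using t ev_powr_large[OF d2, of "6 - log 2 \<tau>"]
  proof eventually_elim
    case (elim n)
    show ?case
      unfolding flat_def
    proof (intro allI impI)
      fix K :: real assume K: "0 < K" "K \<le> 2 powr (n * r + 6)"
      have "n * (r + \<delta>) \<le> n * cent J a e" using r by (intro mult_left_mono) auto
      then have "- (n * (cent J a e - \<delta> / 2)) \<le> log 2 \<tau> - (n * r + 6)"
        using elim(2) by (simp add: algebra_simps)
      then have "2 powr - (n * (cent J a e - \<delta> / 2)) \<le> 2 powr (log 2 \<tau> - (n * r + 6))" by simp
      also have "\<dots> = \<tau> / 2 powr (n * r + 6)" using d by (simp add: powr_diff)
      also have "\<dots> \<le> \<tau> / K" using K d by (intro divide_left_mono) auto
      finally have le: "2 powr - (n * (cent J a e - \<delta> / 2)) \<le> \<tau> / K" .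
      have "prob (Jn n) {w. \<tau> / K < cp (Jn n) A E (A w) (E w)}
        \<le> prob (Jn n) {w. 2 powr - (n * (cent J a e - \<delta> / 2)) < cp (Jn n) A E (A w) (E w)}"
        by (rule measure_pmf.finite_measure_mono, rule Collect_mono, rule impI, erule le_less_trans[OF le]) simp
      then show "peak (Jn n) A E (\<tau> / K) \<le> \<eta>"
        using elim(1) unfolding Jn_def peak_def by linarith
    qed
  qed
qed

text \<open>A constant is not \<open>letterwise\<close>, since lists of units of different lengths
  would have to be told apart. For a fixed block length the list of units is constant, and it takes
  the place of the unit value.\<close>

lemma ev_peak_const:
  fixes \<delta> \<eta> r \<tau> :: real
  assumes A: "letterwise A a" and r: "r + \<delta> \<le> cent J a (\<lambda>_. ())" and d: "0 < \<delta>" "0 < \<eta>" "0 < \<tau>"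
  shows "\<forall>\<^sub>F n in sequentially. flat (Jn n) A (\<lambda>_. ()) \<tau> \<eta> (2 powr (n * r + 6))"
proof -
  let ?E = "\<lambda>w. map (\<lambda>_. ()) (fst (snd w))"
  have E: "letterwise ?E (\<lambda>_. ())"
    by (rule letterwiseI) (simp add: split_sample_def)
  have cst: "?E w = replicate n ()" if "w \<in> set_pmf (Jn n)" for w n
    using that by (auto simp: Jn_def split_sample_def set_replicate_pmf map_replicate_const)
  show ?thesis
    using ev_peak[OF A E r d]
  proof eventually_elim
    case (elim n)
    have eq: "cp (Jn n) A ?E a (?E w) = cp (Jn n) A (\<lambda>_. ()) a ()" if "w \<in> set_pmf (Jn n)" for a w
      using cst that by (rule cp_const)
    have "prob (Jn n) {w. x < cp (Jn n) A (\<lambda>_. ()) (A w) ()}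
        = prob (Jn n) {w. x < cp (Jn n) A ?E (A w) (?E w)}" for x
      by (intro measure_pmf.finite_measure_eq_AE) (simp_all add: AE_measure_pmf_iff eq)
    then show ?case using elim by (simp add: flat_def peak_def)
  qed
qed

end

section \<open>Good codes from single-letter rate conditions\<close>

abbreviation rvY :: "triple \<times> 'x1 \<times> ('x1 \<times> 'y \<times> 'y1 \<times> 'z) \<Rightarrow> 'y" where
  "rvY \<equiv> rvO (\<lambda>c. fst (snd c))"

abbreviation rvZ :: "triple \<times> 'x1 \<times> ('x1 \<times> 'y \<times> 'y1 \<times> 'z) \<Rightarrow> 'z" where
  "rvZ \<equiv> rvO (\<lambda>c. snd (snd (snd c)))"

definition good_code :: "('x,'x1,'y,'y1,'z) channel \<Rightarrow> nat \<Rightarrow> real \<Rightarrow> real \<Rightarrow> real \<Rightarrow> real \<Rightarrow> real \<Rightarrow> nat \<Rightarrow> nat \<Rightarrow> (nat \<Rightarrow> nat \<Rightarrow> 'x list pmf)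
    \<Rightarrow> ('y1 list \<Rightarrow> 'x1) pmf \<Rightarrow> ('y list \<Rightarrow> nat) \<Rightarrow> ('z list \<Rightarrow> nat) \<Rightarrow> bool" where
  "good_code W n R1 R2 Re1 Re2 \<epsilon> M1 M2 enc rel dec1 dec2 \<longleftrightarrow>
     valid_code n M1 M2 enc \<and> \<bar>log 2 M1 / n - R1\<bar> \<le> \<epsilon> \<and> \<bar>log 2 M2 / n - R2\<bar> \<le> \<epsilon> \<and>
     Re1 - \<epsilon> \<le> Delta1 W n M1 M2 enc rel \<and> Re2 - \<epsilon> \<le> Delta2 W n M1 M2 enc rel \<and>
     Pe1 W M1 M2 enc rel dec1 \<le> \<epsilon> \<and> Pe2 W M1 M2 enc rel dec2 \<le> \<epsilon>"

lemma rate_bounds: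
  fixes a b c \<epsilon> :: real and n :: nat
  assumes "0 \<le> a" "0 \<le> b" "0 \<le> c" "0 < n" "3 \<le> n * \<epsilon>"
  shows "\<bar>log 2 (sz n a * (sz n b * sz n c)) / n - (a + b + c)\<bar> \<le> \<epsilon>"
proof -
  have "log 2 (sz n a * (sz n b * sz n c)) = log 2 (sz n a) + (log 2 (sz n b) + log 2 (sz n c))"
    using sz_bounds(3)[OF assms(1)] sz_bounds(3)[OF assms(2)] sz_bounds(3)[OF assms(3)]
    by (simp add: log_mult)
  then have "n * (a + b + c) \<le> log 2 (sz n a * (sz n b * sz n c))"
    "log 2 (sz n a * (sz n b * sz n c)) \<le> n * (a + b + c) + n * \<epsilon>"
    using log_sz[OF assms(1), of n] log_sz[OF assms(2), of n] log_sz[OF assms(3), of n] assms(5)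
    unfolding distrib_left by linarith+
  then show ?thesis using assms(4) by (simp add: abs_le_iff field_simps)
qed

lemma sz_prod3:
  assumes "0 \<le> a" "0 \<le> b" "0 \<le> c"
  shows "real (sz n a) * (real (sz n b) * real (sz n c)) \<le> 2 powr (n * (a + b + c) + 3)"
proof -
  have "real (sz n a) * (real (sz n b) * real (sz n c)) \<le> 2 powr (n * (a + (b + c)) + (1 + (1 + 1)))"
    using assms by (intro sz_mult_le sz_bounds mult_nonneg_nonneg) auto
  then show ?thesis by (simp add: add.assoc)
qed

text \<open>The hypotheses \<open>sw\<close> serve the decoders, \<open>c\<close> and
  \<open>mc\<close> make the messages nearly uniform given the public parts, \<open>se1\<close> and
  \<open>se2\<close> give secrecy, all with the same slack \<open>\<delta>\<close>. The rates
  \<open>s1\<close> and \<open>s2\<close> are positive so that the secret sets are eventually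
  nontrivial.\<close>

lemma codes_exist:
  fixes W :: "'x::finite \<Rightarrow> 'x1::finite \<Rightarrow> ('y::finite \<times> 'y1::finite \<times> 'z::finite) pmf"
    and PX :: "triple \<Rightarrow> 'x pmf" and PX1 :: "'x1 pmf"
    and \<delta> f0 c1 c2 f1 s1 t1 f2 s2 t2 f3 \<epsilon> :: real
  assumes fin: "finite (set_pmf PUV)"
  defines "J \<equiv> source PUV PX1 (kern1 W PX)"
  assumes nn: "0 \<le> f0" "0 \<le> c1" "0 \<le> c2" "0 \<le> f1" "0 < s1" "0 \<le> t1" "0 \<le> f2" "0 < s2" "0 \<le> t2" "0 \<le> f3"
    and d: "0 < \<delta>" and eps: "0 < \<epsilon>"
    and sw: "cent J rvX1 rvY + \<delta> \<le> f3" "cent J rvU (rvY \<star> rvX1) + \<delta> \<le> f0" "cent J rvU rvZ + \<delta> \<le> f0"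
      "cent J rvV1 (rvY \<star> rvX1 \<star> rvU) + \<delta> \<le> f1" "cent J rvV2 (rvZ \<star> rvU) + \<delta> \<le> f2"
    and c: "c1 = 0 \<and> c2 = 0 \<or> f0 + c1 + c2 + \<delta> \<le> cent J rvU (\<lambda>_. ())"
    and mc: "f1 + s1 + t1 + \<delta> \<le> cent J rvV1 rvU" "f2 + s2 + t2 + \<delta> \<le> cent J rvV2 rvU"
      "f1 + s1 + t1 + f2 + s2 + t2 + \<delta> \<le> cent J (rvV1 \<star> rvV2) rvU"
    and se1: "f1 + s1 + \<delta> \<le> cent J rvV1 (rvZ \<star> rvU \<star> rvV2) \<and> f3 + \<delta> \<le> cent J rvX1 (rvZ \<star> rvU \<star> rvV2)
        \<and> f1 + s1 + f3 + \<delta> \<le> cent J (rvV1 \<star> rvX1) (rvZ \<star> rvU \<star> rvV2)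
      \<or> f1 + s1 + \<delta> \<le> cent J rvV1 (rvZ \<star> rvU \<star> rvV2 \<star> rvX1)"
    and se2: "f2 + s2 + \<delta> \<le> cent J rvV2 (rvY \<star> rvU \<star> rvV1 \<star> rvX1)"
  shows "\<forall>\<^sub>F n in sequentially. \<exists>M1 M2 enc rel dec1 dec2.
    good_code W n (c1 + s1 + t1) (c2 + s2 + t2) s1 s2 \<epsilon> M1 M2 enc rel dec1 dec2"
proof -
  \<comment> \<open>The first bound keeps \<open>1 - 2 * e\<close> positive; the last limits the
    equivocation lost through the factor \<open>1 - 2 * e\<close> to half of
    \<open>\<epsilon>\<close>.\<close>
  define e where "e = min (1 / 4) (min \<epsilon> (\<epsilon> / (4 * (s1 + s2 + 1))))"
  have e: "0 < e" "e \<le> 1 / 4" "e \<le> \<epsilon>" "4 * (s1 + s2 + 1) * e \<le> \<epsilon>"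
  proof -
    have p: "0 < 4 * (s1 + s2 + 1)" using nn by simp
    show "0 < e" using eps p by (simp add: e_def)
    show "e \<le> 1 / 4" unfolding e_def by (rule min.cobounded1)
    show "e \<le> \<epsilon>" unfolding e_def by (rule min.coboundedI2, rule min.cobounded1)
    have "e \<le> \<epsilon> / (4 * (s1 + s2 + 1))" by (simp add: e_def)
    then show "4 * (s1 + s2 + 1) * e \<le> \<epsilon>" using p by (simp add: field_simps)
  qed
  \<comment> \<open>The 200 undoes the constant of \<open>good_hashes\<close>, and
    \<open>\<tau>\<close> solves \<open>sqrt (3 * \<tau>) = \<eta>\<close>.\<close>
  define \<eta> where "\<eta> = e / 200"
  define \<tau> where "\<tau> = \<eta>\<^sup>2 / 3"
  have eta: "0 < \<eta>" and tau: "0 < \<tau>" "sqrt (3 * \<tau>) \<le> \<eta>" using e by (auto simp: \<eta>_def \<tau>_def)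
  have finJ: "finite (set_pmf J)"
    unfolding J_def using fin by (intro finite_source) (auto simp: kern1_def letter_def)
  let ?P = "Jn J"
  let ?Y = "rvO traceY" and ?Z = "rvO traceZ"
  have os: "one_shot (map_pmf unzip3 (replicate_pmf n PUV)) (replicate_pmf n PX1) (kern W PX)
      (sz n f0) (sz n c1) (sz n c2) (sz n f1) (sz n s1) (sz n t1) (sz n f2) (sz n s2) (sz n t2) (sz n f3)" for n
    using fin nn by unfold_locales (auto simp: finite_kern sz_bounds(3))
  have Jn: "one_shot.J (map_pmf unzip3 (replicate_pmf n PUV)) (replicate_pmf n PX1) (kern W PX) = ?P n" for n
    unfolding one_shot.J_def[OF os] J_def Jn_def[OF finJ[unfolded J_def]] by (rule source_kern)
  note defs = rvU_def[abs_def] rvV1_def[abs_def] rvV2_def[abs_def] rvX1_def[abs_def] rvO_def[abs_def]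
  have lU: "letterwise rvU rvU" and lV1: "letterwise rvV1 rvV1" and lV2: "letterwise rvV2 rvV2"
    and lX1: "letterwise rvX1 rvX1" and lY: "letterwise ?Y rvY" and lZ: "letterwise ?Z rvZ"
    by (rule letterwiseI; simp add: defs split_sample_def unzip3_def traceY_def traceZ_def case_prod_unfold)+
  define \<theta> where "\<theta> f n = 2 powr - (n * (f - \<delta> / 2))" for f :: real and n :: nat
  have th0: "0 < \<theta> f n" for f n by (simp add: \<theta>_def)
  have th1: "1 / (sz n f * \<theta> f n) \<le> \<eta>" if "0 \<le> f" "log 2 (1 / \<eta>) \<le> n * (\<delta> / 2)" for f :: real and n :: nat
  proof -
    have "1 / \<eta> \<le> 2 powr (n * (\<delta> / 2))" by (subst log_le_iff[symmetric]) (use that eta in simp_all)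
    also have "\<dots> = 2 powr (n * f) * \<theta> f n"
      by (simp add: \<theta>_def powr_add[symmetric] algebra_simps)
    also have "\<dots> \<le> sz n f * \<theta> f n" using sz_bounds(1)[OF that(1)] th0 by (intro mult_right_mono) (auto simp: less_imp_le)
    finally have "1 / \<eta> \<le> sz n f * \<theta> f n" .
    moreover have "0 < sz n f * \<theta> f n" using sz_bounds(3)[OF that(1)] th0 by simp
    ultimately show ?thesis using eta by (simp add: field_simps)
  qed

  note ms = ev_miss[OF finJ _ _ _ d eta, folded \<theta>_def]
  note pk = ev_peak[OF finJ _ _ _ d eta tau(1)]
  note lP = letterwise_Pair
  have ev6: "\<forall>\<^sub>F n in sequentially. c1 = 0 \<and> c2 = 0 \<or> (flat (?P n) rvU (\<lambda>_. ()) \<tau> \<eta> (2 powr (n * (f0 + c1 + c2) + 6)))"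
    using c
  proof
    assume "f0 + c1 + c2 + \<delta> \<le> cent J rvU (\<lambda>_. ())"
    from ev_peak_const[OF finJ lU this d eta tau(1)] show ?thesis by (rule eventually_mono) blast
  qed simp
  let ?E = "?Z \<star> rvU \<star> rvV2" and ?E' = "?Z \<star> rvU \<star> rvV2 \<star> rvX1" and ?G = "?Y \<star> rvU \<star> rvV1 \<star> rvX1"
  have lE: "letterwise ?E (rvZ \<star> rvU \<star> rvV2)" by (rule lP[OF lZ lP[OF lU lV2]])
  have lE': "letterwise ?E' (rvZ \<star> rvU \<star> rvV2 \<star> rvX1)" by (rule lP[OF lZ lP[OF lU lP[OF lV2 lX1]]])
  have lG: "letterwise ?G (rvY \<star> rvU \<star> rvV1 \<star> rvX1)" by (rule lP[OF lY lP[OF lU lP[OF lV1 lX1]]])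
  have ev10: "\<forall>\<^sub>F n in sequentially.
      (flat (?P n) rvV1 ?E \<tau> \<eta> (2 powr (n * (f1 + s1) + 6))) \<and>
      (flat (?P n) rvX1 ?E \<tau> \<eta> (2 powr (n * f3 + 6))) \<and>
      (flat (?P n) (rvV1 \<star> rvX1) ?E \<tau> \<eta> (2 powr (n * (f1 + s1 + f3) + 6)))
    \<or> (flat (?P n) rvV1 ?E' \<tau> \<eta> (2 powr (n * (f1 + s1) + 6)))"
    using se1
  proof
    assume a: "f1 + s1 + \<delta> \<le> cent J rvV1 (rvZ \<star> rvU \<star> rvV2) \<and> f3 + \<delta> \<le> cent J rvX1 (rvZ \<star> rvU \<star> rvV2)
        \<and> f1 + s1 + f3 + \<delta> \<le> cent J (rvV1 \<star> rvX1) (rvZ \<star> rvU \<star> rvV2)"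
    note a1 = conjunct1[OF a] and a2 = conjunct1[OF conjunct2[OF a]] and a3 = conjunct2[OF conjunct2[OF a]]
    show ?thesis
      by (rule eventually_mono[OF eventually_conj[OF pk[OF lV1 lE a1] eventually_conj[OF pk[OF lX1 lE a2]
            pk[OF lP[OF lV1 lX1] lE a3]]]]) (rule disjI1)
  next
    assume a: "f1 + s1 + \<delta> \<le> cent J rvV1 (rvZ \<star> rvU \<star> rvV2 \<star> rvX1)"
    show ?thesis by (rule eventually_mono[OF pk[OF lV1 lE' a]]) (rule disjI2)
  qed
  note large = ev_powr_large[OF finJ]
  show ?thesis
    using ms[OF lX1 lY sw(1)] ms[OF lU lP[OF lY lX1] sw(2)] ms[OF lU lZ sw(3)] ms[OF lV1 lP[OF lY lP[OF lX1 lU]] sw(4)]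
      ms[OF lV2 lP[OF lZ lU] sw(5)] ev6 pk[OF lV1 lU mc(1)] pk[OF lV2 lU mc(2)] pk[OF lP[OF lV1 lV2] lU mc(3)] ev10
      pk[OF lV2 lG se2] large[OF half_gt_zero[OF d], of "log 2 (1 / \<eta>)"] large[OF eps, of 3]
      large[OF nn(5), of 1] large[OF nn(8), of 1] eventually_gt_at_top[of 0]
  proof eventually_elim
    case (elim n)
    interpret os: one_shot "map_pmf unzip3 (replicate_pmf n PUV)" "replicate_pmf n PX1" "kern W PX" traceY traceZ
      "sz n f0" "sz n c1" "sz n c2" "sz n f1" "sz n s1" "sz n t1" "sz n f2" "sz n s2" "sz n t2" "sz n f3"
      by (rule os)
    have nn': "0 \<le> s1" "0 \<le> s2" using nn by auto
    have le6: "x \<le> 2 powr (n * r + i) \<Longrightarrow> i \<le> 6 \<Longrightarrow> x \<le> 2 powr (n * r + 6)" for x r i :: real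
      by (erule order_trans) simp
    have k: "0 < real (sz n r)" "real (sz n r) \<le> 2 powr (n * r + 6)" if "0 \<le> r" for r :: real
      using sz_bounds[OF that, of n] by (auto intro: le6[of _ r 1])
    have k2: "0 < real (sz n a) * real (sz n b)" "real (sz n a) * real (sz n b) \<le> 2 powr (n * (a + b) + 6)"
      if "0 \<le> a" "0 \<le> b" for a b :: real
    proof -
      show "0 < real (sz n a) * real (sz n b)" using k(1)[OF that(1)] k(1)[OF that(2)] by simp
      show "real (sz n a) * real (sz n b) \<le> 2 powr (n * (a + b) + 6)"
        by (rule le6[OF sz_mult_le[OF sz_bounds(2)[OF that(1)] sz_bounds(2)[OF that(2)]]]) auto
    qed
    have k3: "0 < real (sz n a) * (real (sz n b) * real (sz n c))" "real (sz n a) * (real (sz n b) * real (sz n c)) \<le> 2 powr (n * (a + b + c) + 6)"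
      if "0 \<le> a" "0 \<le> b" "0 \<le> c" for a b c :: real
      using k(1)[OF that(1)] k(1)[OF that(2)] k(1)[OF that(3)] le6[OF sz_prod3[OF that, of n]] by auto
    have k3': "0 < real (sz n a) * real (sz n b) * real (sz n c)" "real (sz n a) * real (sz n b) * real (sz n c) \<le> 2 powr (n * (a + b + c) + 6)"
      if "0 \<le> a" "0 \<le> b" "0 \<le> c" for a b c :: real
      using k3[OF that] by (simp_all add: mult.assoc)
    have k6: "0 < (real (sz n f1) * (real (sz n s1) * real (sz n t1))) * (real (sz n f2) * (real (sz n s2) * real (sz n t2)))"
      "(real (sz n f1) * (real (sz n s1) * real (sz n t1))) * (real (sz n f2) * (real (sz n s2) * real (sz n t2)))
         \<le> 2 powr (n * (f1 + s1 + t1 + f2 + s2 + t2) + 6)"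
    proof -
      show "0 < (real (sz n f1) * (real (sz n s1) * real (sz n t1))) * (real (sz n f2) * (real (sz n s2) * real (sz n t2)))"
        using k3(1)[of f1 s1 t1] k3(1)[of f2 s2 t2] nn by simp
      have "(real (sz n f1) * (real (sz n s1) * real (sz n t1))) * (real (sz n f2) * (real (sz n s2) * real (sz n t2)))
         \<le> 2 powr (n * ((f1 + s1 + t1) + (f2 + s2 + t2)) + (3 + 3))"
        by (rule sz_mult_le[OF sz_prod3 sz_prod3]) (use nn in auto)
      then show "(real (sz n f1) * (real (sz n s1) * real (sz n t1))) * (real (sz n f2) * (real (sz n s2) * real (sz n t2)))
         \<le> 2 powr (n * (f1 + s1 + t1 + f2 + s2 + t2) + 6)"
        by (simp add: add.assoc)
    qed
    have "\<exists>h0 h1 h2 (h3 :: 'x1 list \<Rightarrow> nat). os.loss (\<theta> f0 n) (\<theta> f1 n) (\<theta> f2 n) (\<theta> f3 n) h0 h1 h2 h3 \<le> 200 * \<eta>"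
    proof (rule os.good_hashes[where \<tau> = \<tau>])
      show "miss os.J rvX1 ?Y (\<theta> f3 n) \<le> \<eta>" using elim(1) by (simp only: Jn)
      show "miss os.J rvU (?Y \<star> rvX1) (\<theta> f0 n) \<le> \<eta>" using elim(2) by (simp only: Jn)
      show "miss os.J rvV1 (?Y \<star> rvX1 \<star> rvU) (\<theta> f1 n) \<le> \<eta>" using elim(4) by (simp only: Jn)
      show "miss os.J rvU ?Z (\<theta> f0 n) \<le> \<eta>" using elim(3) by (simp only: Jn)
      show "miss os.J rvV2 (?Z \<star> rvU) (\<theta> f2 n) \<le> \<eta>" using elim(5) by (simp only: Jn)
      show "1 / (sz n f0 * \<theta> f0 n) \<le> \<eta>" "1 / (sz n f1 * \<theta> f1 n) \<le> \<eta>" "1 / (sz n f2 * \<theta> f2 n) \<le> \<eta>" "1 / (sz n f3 * \<theta> f3 n) \<le> \<eta>"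
        using th1[OF _ elim(12)] nn by auto
      show "sz n c1 = 1 \<and> sz n c2 = 1 \<or> peak os.J rvU (\<lambda>_. ()) (\<tau> / (sz n f0 * (sz n c1 * sz n c2))) \<le> \<eta>"
        using elim(6) k3[OF nn(1-3)] unfolding Jn flat_def by auto
      show "peak os.J rvV1 rvU (\<tau> / (sz n f1 * (sz n s1 * sz n t1))) \<le> \<eta>"
        using elim(7) k3[OF nn(4) nn'(1) nn(6)] unfolding Jn flat_def by auto
      show "peak os.J rvV2 rvU (\<tau> / (sz n f2 * (sz n s2 * sz n t2))) \<le> \<eta>"
        using elim(8) k3[OF nn(7) nn'(2) nn(9)] unfolding Jn flat_def by auto
      show "peak os.J (rvV1 \<star> rvV2) rvU (\<tau> / ((sz n f1 * (sz n s1 * sz n t1)) * (sz n f2 * (sz n s2 * sz n t2)))) \<le> \<eta>"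
        using elim(9)[unfolded flat_def, rule_format, OF k6] unfolding Jn by simp
      show "peak os.J rvV1 ?E (\<tau> / (sz n f1 * sz n s1)) \<le> \<eta> \<and> peak os.J rvX1 ?E (\<tau> / sz n f3) \<le> \<eta>
        \<and> peak os.J (rvV1 \<star> rvX1) ?E (\<tau> / (sz n f1 * sz n s1 * sz n f3)) \<le> \<eta>
        \<or> peak os.J rvV1 ?E' (\<tau> / (sz n f1 * sz n s1)) \<le> \<eta>"
        using elim(10) k2[OF nn(4) nn'(1)] k[OF nn(10)] k3'[OF nn(4) nn'(1) nn(10)]
        unfolding Jn flat_def by auto
      show "peak os.J rvV2 ?G (\<tau> / (sz n f2 * sz n s2)) \<le> \<eta>"
        using elim(11) k2[OF nn(7) nn'(2)] unfolding Jn flat_def by auto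
    qed (use th0 tau in auto)
    then obtain h0 h1 h2 and h3 :: "'x1 list \<Rightarrow> nat" where
      good: "os.loss (\<theta> f0 n) (\<theta> f1 n) (\<theta> f2 n) (\<theta> f3 n) h0 h1 h2 h3 \<le> 200 * \<eta>" by blast
    have e200: "200 * \<eta> = e" by (simp add: \<eta>_def)
    obtain Qc Rc d1 d2 where Q: "\<And>m. set_pmf (Qc m) \<subseteq> set_pmf (map_pmf unzip3 (replicate_pmf n PUV))"
        "set_pmf Rc \<subseteq> set_pmf (replicate_pmf n PX1)"
      and B: "reliable_secret (bind_pmf (pmf_of_set (os.M1 \<times> os.M2)) (\<lambda>m. map_pmf (Pair m) (source (Qc m) Rc (kern W PX))))
        ?Y ?Z d1 d2 (sz n s1) (sz n s2) e"
      using os.one_shot_code[OF good] unfolding e200 by blast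
    \<comment> \<open>With at least two secrets, \<open>log 2 S - 1\<close> is nonnegative, as the
      equivocation bound presupposes.\<close>
    have two: "2 \<le> sz n s1" "2 \<le> sz n s2"
    proof -
      have "2 \<le> sz n s" if "1 \<le> n * s" "0 \<le> s" for s :: real
      proof -
        have "2 powr 1 \<le> (2::real) powr (n * s)" using that by (intro powr_mono) auto
        then have "2 \<le> real (sz n s)" using sz_bounds(1)[OF that(2), of n] by simp
        then show ?thesis by linarith
      qed
      from this[OF elim(14) nn'(1)] this[OF elim(15) nn'(2)]
      show "2 \<le> sz n s1" "2 \<le> sz n s2" by simp_all
    qed
    have finQc: "finite (set_pmf (Qc m))" for m using Q(1) by (rule finite_subset) (use fin in simp)
    have lenQc: "\<forall>m. \<forall>q\<in>set_pmf (Qc m). length (zip3 q) = n"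
      using Q(1) by (fastforce simp: set_replicate_pmf)
    have finRc: "finite (set_pmf Rc)" using Q(2) by (rule finite_subset) simp
    obtain enc rel dec1 dec2 where
      v: "valid_code n (card os.M1) (card os.M2) enc"
      and pe: "Pe1 W (card os.M1) (card os.M2) enc rel dec1 \<le> e" "Pe2 W (card os.M1) (card os.M2) enc rel dec2 \<le> e"
      and D1: "(1 - 2 * e) * (log 2 (sz n s1) - 1) \<le> n * Delta1 W n (card os.M1) (card os.M2) enc rel"
      and D2: "(1 - 2 * e) * (log 2 (sz n s2) - 1) \<le> n * Delta2 W n (card os.M1) (card os.M2) enc rel"
      using code_from_coded[OF os.K_fin(9-12) finQc lenQc finRc B two elim(16)] by blast
    \<comment> \<open>Half of \<open>n * \<epsilon>\<close> covers the factor
      \<open>1 - 2 * e\<close>. The other half is at least 3/2 by \<open>elim(13)\<close> and covers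
      the constant 1 lost in the equivocation bound.\<close>
    have dl: "s - \<epsilon> \<le> D" if D: "(1 - 2 * e) * (log 2 (sz n s) - 1) \<le> n * D" and s: "0 \<le> s" "s \<le> s1 + s2" for s D :: real
    proof -
      have "(1 - 2 * e) * (n * s - 1) \<le> (1 - 2 * e) * (log 2 (sz n s) - 1)"
        using log_sz(1)[OF s(1), of n] e by (intro mult_left_mono) auto
      then have 1: "(1 - 2 * e) * (n * s - 1) \<le> n * D" using D by linarith
      have "4 * (s + 1) * e \<le> 4 * (s1 + s2 + 1) * e" using s e by (intro mult_right_mono) auto
      then have "4 * (s + 1) * e \<le> \<epsilon>" using e by linarith
      then have "2 * e * s \<le> \<epsilon> / 2" using e by (simp add: algebra_simps)
      then have "n * (2 * e * s) \<le> n * (\<epsilon> / 2)" by (intro mult_left_mono) auto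
      then have "n * (s - \<epsilon>) \<le> (1 - 2 * e) * (n * s - 1)"
        using elim(13) e by (simp add: algebra_simps)
      then have "n * (s - \<epsilon>) \<le> n * D" using 1 by linarith
      then show ?thesis using elim(16) by simp
    qed
    have cM: "real (card os.M1) = sz n c1 * (sz n s1 * sz n t1)" "real (card os.M2) = sz n c2 * (sz n s2 * sz n t2)"
      by (simp_all add: os.M1_def os.M2_def card_cartesian_product)
    have "good_code W n (c1 + s1 + t1) (c2 + s2 + t2) s1 s2 \<epsilon> (card os.M1) (card os.M2) enc rel dec1 dec2"
      unfolding good_code_def
      using v pe e dl[OF D1] dl[OF D2] rate_bounds[OF nn(2) nn'(1) nn(6) elim(16,13)]
        rate_bounds[OF nn(3) nn'(2) nn(9) elim(16,13)] nn
      by (auto simp: cM)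
    then show ?case by blast
  qed
qed

section \<open>Entropies and rates\<close>

text \<open>Entropy sees only the partition into level sets, so tuples may be reordered, regrouped
  and padded with constants.\<close>

lemma ent_cong:
  assumes "finite (set_pmf P)" "\<And>w v. A w = A v \<longleftrightarrow> B w = B v"
  shows "ent P A = ent P B"
proof -
  have "pmf (map_pmf A P) (A w) = pmf (map_pmf B P) (B w)" for w
  proof -
    have "A -` {A w} = B -` {B w}" using assms(2) by auto
    then show ?thesis by (simp add: pmf_map)
  qed
  then show ?thesis by (simp add: ent_expectation[OF assms(1)])
qed

lemma ent_map: "ent (map_pmf g P) A = ent P (\<lambda>w. A (g w))"
  by (simp add: ent_def pmf.map_comp o_def)

lemma cent_map: "cent (map_pmf g P) A C = cent P (\<lambda>w. A (g w)) (\<lambda>w. C (g w))"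
  by (simp add: cent_def ent_map)

lemma cmi_map: "cmi (map_pmf g P) A B C = cmi P (\<lambda>w. A (g w)) (\<lambda>w. B (g w)) (\<lambda>w. C (g w))"
  by (simp add: cmi_def ent_map)

lemma mi_map: "mi (map_pmf g P) A B = mi P (\<lambda>w. A (g w)) (\<lambda>w. B (g w))"
  by (simp add: mi_def cmi_map)

lemma ent_const: "ent P (\<lambda>_. c) = 0"
  by (simp add: ent_def disc_H_def)

lemma ent_indep:
  assumes "finite (set_pmf P)" "map_pmf (A \<star> B) P = pair_pmf (map_pmf A P) (map_pmf B P)"
  shows "ent P (A \<star> B) = ent P A + ent P B"
proof -
  have "- log 2 (pmf (map_pmf (A \<star> B) P) (A w, B w))
      = - log 2 (pmf (map_pmf A P) (A w)) + - log 2 (pmf (map_pmf B P) (B w))" if "w \<in> set_pmf P" for w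
    using pmf_map_pos[OF that, of A] pmf_map_pos[OF that, of B] by (simp add: assms(2) pmf_pair log_mult)
  then have "ent P (A \<star> B) = (\<Sum>w\<in>set_pmf P. pmf P w * (- log 2 (pmf (map_pmf A P) (A w)) + - log 2 (pmf (map_pmf B P) (B w))))"
    unfolding ent_expectation[OF assms(1)] expectation_sum[OF assms(1) subset_refl]
    by (intro sum.cong refl) (simp only:)
  also have "\<dots> = ent P A + ent P B"
    unfolding ent_expectation[OF assms(1)] expectation_sum[OF assms(1) subset_refl] distrib_left sum.distrib ..
  finally show ?thesis .
qed

lemma cent_nonneg:
  assumes "finite (set_pmf P)" shows "0 \<le> cent P A E"
  unfolding cent_expectation[OF assms] expectation_sum[OF assms subset_refl]
  using cp_pos[of _ P A E] cp_le_1[of _ P A E] by (intro sum_nonneg mult_nonneg_nonneg) auto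

text \<open>By \<open>ln r \<le> r - 1\<close> for the ratio \<open>r = P(a|c) P(b|c) P(c) / P(a,b,c)\<close>, whose mean is at most 1.\<close>
lemma cmi_nonneg:
  fixes A :: "'o \<Rightarrow> 'a" and B :: "'o \<Rightarrow> 'b" and C :: "'o \<Rightarrow> 'c"
  assumes fin: "finite (set_pmf P)" shows "0 \<le> cmi P A B C"
proof -
  let ?S = "set_pmf P"
  let ?abc = "A \<star> B \<star> C"
  let ?p = "map_pmf ?abc P"
  define r where "r x = cp P A C (fst x) (snd (snd x)) * cp P B C (fst (snd x)) (snd (snd x)) * pmf (map_pmf C P) (snd (snd x)) / pmf ?p x" for x
  have "(\<Sum>w\<in>?S. pmf P w * r (?abc w)) = (\<Sum>x\<in>?abc ` ?S. pmf ?p x * r x)"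
    using fin by (subst sum_pmf_map) auto
  also have "\<dots> = (\<Sum>x\<in>?abc ` ?S. cp P A C (fst x) (snd (snd x)) * cp P B C (fst (snd x)) (snd (snd x)) * pmf (map_pmf C P) (snd (snd x)))"
  proof (intro sum.cong refl)
    fix x assume "x \<in> ?abc ` ?S"
    then have "0 < pmf ?p x" by (auto intro!: pmf_positive)
    then show "pmf ?p x * r x = cp P A C (fst x) (snd (snd x)) * cp P B C (fst (snd x)) (snd (snd x)) * pmf (map_pmf C P) (snd (snd x))"
      by (simp add: r_def)
  qed
  also have "\<dots> \<le> (\<Sum>x\<in>A ` ?S \<times> B ` ?S \<times> C ` ?S. cp P A C (fst x) (snd (snd x)) * cp P B C (fst (snd x)) (snd (snd x)) * pmf (map_pmf C P) (snd (snd x)))"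
    using fin by (intro sum_mono2) (auto simp: cp_nonneg)
  also have "\<dots> = (\<Sum>c\<in>C ` ?S. (\<Sum>a\<in>A ` ?S. cp P A C a c) * (\<Sum>b\<in>B ` ?S. cp P B C b c) * pmf (map_pmf C P) c)"
  proof -
    have "(\<Sum>x\<in>A ` ?S \<times> B ` ?S \<times> C ` ?S. cp P A C (fst x) (snd (snd x)) * cp P B C (fst (snd x)) (snd (snd x)) * pmf (map_pmf C P) (snd (snd x)))
       = (\<Sum>a\<in>A ` ?S. \<Sum>b\<in>B ` ?S. \<Sum>c\<in>C ` ?S. cp P A C a c * cp P B C b c * pmf (map_pmf C P) c)"
      by (simp add: sum.cartesian_product case_prod_unfold)
    also have "\<dots> = (\<Sum>a\<in>A ` ?S. \<Sum>c\<in>C ` ?S. \<Sum>b\<in>B ` ?S. cp P A C a c * cp P B C b c * pmf (map_pmf C P) c)"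
      by (intro sum.cong refl sum.swap)
    also have "\<dots> = (\<Sum>c\<in>C ` ?S. \<Sum>a\<in>A ` ?S. \<Sum>b\<in>B ` ?S. cp P A C a c * cp P B C b c * pmf (map_pmf C P) c)"
      by (rule sum.swap)
    also have "\<dots> = (\<Sum>c\<in>C ` ?S. (\<Sum>a\<in>A ` ?S. cp P A C a c) * (\<Sum>b\<in>B ` ?S. cp P B C b c) * pmf (map_pmf C P) c)"
      by (intro sum.cong refl) (simp only: sum_distrib_right sum_distrib_left, rule sum.swap)
    finally show ?thesis .
  qed
  also have "\<dots> = (\<Sum>c\<in>C ` ?S. pmf (map_pmf C P) c)"
    using fin by (intro sum.cong refl) (simp add: sum_cp_eq_1)
  also have "\<dots> = 1" using fin by (intro sum_pmf_eq_1) auto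
  finally have r1: "(\<Sum>w\<in>?S. pmf P w * r (?abc w)) \<le> 1" .
  have pw: "- log 2 (pmf (map_pmf (A \<star> C) P) (A w, C w)) + - log 2 (pmf (map_pmf (B \<star> C) P) (B w, C w))
      - - log 2 (pmf ?p (?abc w)) - - log 2 (pmf (map_pmf C P) (C w)) \<ge> (1 - r (?abc w)) / ln 2"
    if w: "w \<in> ?S" for w
  proof -
    note pos = pmf_map_pos[OF w, of "A \<star> C"] pmf_map_pos[OF w, of "B \<star> C"]
      pmf_map_pos[OF w, of ?abc] pmf_map_pos[OF w, of C]
    have "r (?abc w) = pmf (map_pmf (A \<star> C) P) (A w, C w) * pmf (map_pmf (B \<star> C) P) (B w, C w)
        / (pmf ?p (?abc w) * pmf (map_pmf C P) (C w))"
      using pos by (simp add: r_def cp_def)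
    then have l: "log 2 (r (?abc w)) = log 2 (pmf (map_pmf (A \<star> C) P) (A w, C w)) + log 2 (pmf (map_pmf (B \<star> C) P) (B w, C w))
      - log 2 (pmf ?p (?abc w)) - log 2 (pmf (map_pmf C P) (C w))" and rp: "0 < r (?abc w)"
      using pos by (simp_all add: log_mult log_divide)
    have "ln (r (?abc w)) \<le> r (?abc w) - 1" using rp by (rule ln_le_minus_one)
    then have "log 2 (r (?abc w)) \<le> (r (?abc w) - 1) / ln 2" unfolding log_def by (intro divide_right_mono) auto
    moreover have "(1 - r (?abc w)) / ln 2 = - ((r (?abc w) - 1) / ln 2)" by (simp add: diff_divide_distrib)
    ultimately show ?thesis unfolding l by linarith
  qed
  have "cmi P A B C = (\<Sum>w\<in>?S. pmf P w * (- log 2 (pmf (map_pmf (A \<star> C) P) (A w, C w)) + - log 2 (pmf (map_pmf (B \<star> C) P) (B w, C w))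
      - - log 2 (pmf ?p (?abc w)) - - log 2 (pmf (map_pmf C P) (C w))))"
    unfolding cmi_def ent_expectation[OF fin] expectation_sum[OF fin subset_refl]
    by (simp add: sum.distrib sum_subtractf sum_negf distrib_left right_diff_distrib)
  also have "\<dots> \<ge> (\<Sum>w\<in>?S. pmf P w * ((1 - r (?abc w)) / ln 2))"
    by (intro sum_mono mult_left_mono pw) auto
  also have "(\<Sum>w\<in>?S. pmf P w * ((1 - r (?abc w)) / ln 2)) = (1 - (\<Sum>w\<in>?S. pmf P w * r (?abc w))) / ln 2"
    using fin by (simp add: sum_divide_distrib[symmetric] right_diff_distrib sum_subtractf sum_pmf_eq_1)
  finally show ?thesis using r1 by (simp add: order_trans[rotated])
qed

text \<open>\<open>c1\<close> and \<open>c2\<close> are the rates moved to U. The individual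
  constraints force at least \<open>l1\<close> and \<open>l2\<close>, the sum constraint forces a
  total of at least \<open>T\<close>, and secrecy allows at most \<open>R1 - Re1\<close> and
  \<open>R2 - Re2\<close>. A point of this box with total exactly \<open>T\<close> exists because
  \<open>T\<close> lies between the sums of its corners.\<close>

lemma rate_splitting:
  fixes R1 R2 a b c M Re1 Re2 :: real
  assumes "R1 \<le> M + a" "R2 \<le> M + b" "R1 + R2 \<le> M + a + b - c" "0 \<le> M" "0 \<le> c"
    and "Re1 \<le> R1" "Re2 \<le> R2" "Re1 \<le> a - c" "Re2 \<le> b - c"
  shows "\<exists>c1 c2. 0 \<le> c1 \<and> c1 \<le> R1 - Re1 \<and> 0 \<le> c2 \<and> c2 \<le> R2 - Re2 \<and> R1 - c1 \<le> a \<and> R2 - c2 \<le> b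
     \<and> c1 + c2 \<le> M \<and> (R1 - c1) + (R2 - c2) \<le> a + b - c"
proof -
  define l1 where "l1 = max 0 (R1 - a)"
  define l2 where "l2 = max 0 (R2 - b)"
  define T where "T = max (l1 + l2) (R1 + R2 - a - b + c)"
  \<comment> \<open>As much as possible from the first message while leaving \<open>l2\<close> to
    the second; the second share is \<open>T - c1\<close>.\<close>
  define c1 where "c1 = min (R1 - Re1) (T - l2)"
  have "0 \<le> l1" "R1 - a \<le> l1" "0 \<le> l2" "R2 - b \<le> l2" by (auto simp: l1_def l2_def)
  moreover have "l1 \<le> R1 - Re1" "l2 \<le> R2 - Re2" "l1 + l2 \<le> M" using assms by (auto simp: l1_def l2_def)
  moreover have "l1 + l2 \<le> T" "R1 + R2 - a - b + c \<le> T" by (auto simp: T_def)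
  moreover have "T \<le> M" "T \<le> (R1 - Re1) + (R2 - Re2)"
    using assms calculation(5-7) by (auto simp: T_def)
  moreover have "c1 \<le> R1 - Re1" "c1 \<le> T - l2" "c1 = R1 - Re1 \<or> c1 = T - l2" by (auto simp: c1_def)
  ultimately have "0 \<le> c1 \<and> c1 \<le> R1 - Re1 \<and> 0 \<le> T - c1 \<and> T - c1 \<le> R2 - Re2 \<and> R1 - c1 \<le> a \<and> R2 - (T - c1) \<le> b
     \<and> c1 + (T - c1) \<le> M \<and> (R1 - c1) + (R2 - (T - c1)) \<le> a + b - c"
    by auto
  then show ?thesis by blast
qed

section \<open>The single-letter law\<close>

lemma source_eq_joint:
  "source PUV PX1 (kern1 W PX) = map_pmf (\<lambda>w. ((sU w, sV1 w, sV2 w), sX1 w, (sX1 w, sY w, sY1 w, sZ w))) (joint W PUV PX PX1)"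
proof -
  have "source PUV PX1 (kern1 W PX) = bind_pmf PUV (\<lambda>q. bind_pmf PX1 (\<lambda>x1. bind_pmf (PX q) (\<lambda>x. map_pmf (\<lambda>c. (q, x1, (x1, c))) (W x x1))))"
    by (simp add: source_def kern1_def letter_def map_bind_pmf pmf.map_comp o_def)
  also have "\<dots> = bind_pmf PUV (\<lambda>q. bind_pmf (PX q) (\<lambda>x. bind_pmf PX1 (\<lambda>x1. map_pmf (\<lambda>c. (q, x1, (x1, c))) (W x x1))))"
    by (subst bind_commute_pmf[of PX1]) (rule refl)
  also have "\<dots> = map_pmf (\<lambda>w. ((sU w, sV1 w, sV2 w), sX1 w, (sX1 w, sY w, sY1 w, sZ w))) (joint W PUV PX PX1)"
    by (simp add: joint_def map_bind_pmf pmf.map_comp o_def case_prod_unfold)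
  finally show ?thesis .
qed

lemma finite_joint:
  fixes W :: "'x::finite \<Rightarrow> 'x1::finite \<Rightarrow> ('y::finite \<times> 'y1::finite \<times> 'z::finite) pmf"
  shows "finite (set_pmf PUV) \<Longrightarrow> finite (set_pmf (joint W PUV PX PX1))"
  by (auto simp: joint_def)

lemma joint_indep:
  fixes W :: "'x::finite \<Rightarrow> 'x1::finite \<Rightarrow> ('y::finite \<times> 'y1::finite \<times> 'z::finite) pmf"
  assumes "finite (set_pmf PUV)"
  shows "ent (joint W PUV PX PX1) (\<lambda>w. (f (sU w, sV1 w, sV2 w), sX1 w))
       = ent (joint W PUV PX PX1) (\<lambda>w. f (sU w, sV1 w, sV2 w)) + ent (joint W PUV PX PX1) sX1"
proof (rule ent_indep[OF finite_joint[OF assms]])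
  let ?J = "joint W PUV PX PX1"
  have "map_pmf (\<lambda>w. (f (sU w, sV1 w, sV2 w), sX1 w)) ?J = pair_pmf (map_pmf f PUV) PX1"
    by (simp add: joint_def map_bind_pmf pmf.map_comp o_def case_prod_unfold pair_pmf_def bind_map_pmf)
  moreover have "map_pmf (\<lambda>w. f (sU w, sV1 w, sV2 w)) ?J = map_pmf f PUV"
    by (simp add: joint_def map_bind_pmf pmf.map_comp o_def case_prod_unfold map_pmf_def[of f])
  moreover have "map_pmf sX1 ?J = PX1"
    by (simp add: joint_def map_bind_pmf pmf.map_comp o_def case_prod_unfold bind_return_pmf')
  ultimately show "map_pmf (\<lambda>w. (f (sU w, sV1 w, sV2 w), sX1 w)) ?J
      = pair_pmf (map_pmf (\<lambda>w. f (sU w, sV1 w, sV2 w)) ?J) (map_pmf sX1 ?J)" by simp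
qed

lemma good_code_mono:
  assumes "good_code W n R1' R2' Re1' Re2' \<epsilon>' M1 M2 enc rel dec1 dec2"
    and "\<bar>R1' - R1\<bar> + \<epsilon>' \<le> \<epsilon>" "\<bar>R2' - R2\<bar> + \<epsilon>' \<le> \<epsilon>" "Re1 - \<epsilon> \<le> Re1' - \<epsilon>'" "Re2 - \<epsilon> \<le> Re2' - \<epsilon>'"
  shows "good_code W n R1 R2 Re1 Re2 \<epsilon> M1 M2 enc rel dec1 dec2"
proof -
  have "\<epsilon>' \<le> \<epsilon>" using assms(2) by linarith
  moreover have "\<bar>log 2 M1 / n - R1\<bar> \<le> \<bar>log 2 M1 / n - R1'\<bar> + \<bar>R1' - R1\<bar>"
    "\<bar>log 2 M2 / n - R2\<bar> \<le> \<bar>log 2 M2 / n - R2'\<bar> + \<bar>R2' - R2\<bar>" by linarith+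
  ultimately show ?thesis using assms unfolding good_code_def by linarith
qed

text \<open>The rates are: conditional entropies plus \<open>\<delta>\<close> for the public parts,
  \<open>c1\<close> and \<open>c2\<close> from \<open>rate_splitting\<close> for the parts on U, Re1
  and Re2 for the secrets, and what is left for the parts t. Some of them are then lowered by
  multiples of \<open>\<delta>\<close>.\<close>

lemma L5_good_codes:
  fixes W :: "'x::finite \<Rightarrow> 'x1::finite \<Rightarrow> ('y::finite \<times> 'y1::finite \<times> 'z::finite) pmf"
  assumes L5: "(R1, R2, Re1, Re2) \<in> L5 W" and eps: "0 < \<epsilon>"
  shows "\<forall>\<^sub>F n in sequentially. \<exists>M1 M2 enc rel dec1 dec2.
    good_code W n R1 R2 Re1 Re2 \<epsilon> M1 M2 enc rel dec1 dec2"
proof -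
  obtain PUV PX PX1 where fin: "finite (set_pmf PUV)"
    and L: "let J = joint W PUV PX PX1;
          M1 = min (cmi J sU sY sX1) (mi J sU sZ)
      in mi J sX1 sY \<ge> cmi J sX1 sZ (sU \<star> sV2) \<and>
         R1 > 0 \<and> R2 > 0 \<and> Re1 > 0 \<and> Re2 > 0 \<and>
         Re1 \<le> R1 \<and> Re2 \<le> R2 \<and>
         R1 \<le> M1 + cmi J sV1 sY (sU \<star> sX1) \<and>
         R2 \<le> M1 + cmi J sV2 sZ sU \<and>
         R1 + R2 \<le> M1 + cmi J sV1 sY (sU \<star> sX1) + cmi J sV2 sZ sU
                   - cmi J sV1 sV2 sU \<and>
         Re1 \<le> min (cmi J sX1 sZ (sU \<star> sV1 \<star> sV2)) (mi J sX1 sY)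
               + cmi J sV1 sY (sU \<star> sX1) - cmi J sV1 sV2 sU
               - cmi J (sX1 \<star> sV1) sZ (sU \<star> sV2) \<and>
         Re2 \<le> cmi J sV2 sZ sU - cmi J sV1 sV2 sU
               - cmi J sV2 sY (sU \<star> sX1 \<star> sV1)"
    using L5 unfolding L5_def by blast
  define J where "J = joint W PUV PX PX1"
  have finJ: "finite (set_pmf J)" unfolding J_def by (rule finite_joint[OF fin])
  define a where "a = cmi J sV1 sY (sU \<star> sX1)"
  define b where "b = cmi J sV2 sZ sU"
  define c where "c = cmi J sV1 sV2 sU"
  define M where "M = min (cmi J sU sY sX1) (mi J sU sZ)"
  define p where "p = mi J sX1 sY"
  define g where "g = cmi J sX1 sZ (sU \<star> sV2)"
  define m where "m = cmi J sX1 sZ (sU \<star> sV1 \<star> sV2)"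
  define d where "d = cmi J (sX1 \<star> sV1) sZ (sU \<star> sV2)"
  define k where "k = cmi J sV2 sY (sU \<star> sX1 \<star> sV1)"
  have H: "g \<le> p" "0 < R1" "0 < R2" "0 < Re1" "0 < Re2" "Re1 \<le> R1" "Re2 \<le> R2" "R1 \<le> M + a" "R2 \<le> M + b"
    "R1 + R2 \<le> M + a + b - c" "Re1 \<le> min m p + a - c - d" "Re2 \<le> b - c - k"
    using L unfolding Let_def J_def[symmetric] a_def b_def c_def M_def p_def g_def m_def d_def k_def by auto
  have pos: "0 \<le> c" "0 \<le> M" "0 \<le> k" "0 \<le> cmi J sV1 sZ (sU \<star> sV2)"
    unfolding c_def M_def k_def mi_def by (auto intro!: cmi_nonneg[OF finJ])

  \<comment> \<open>All informations are rewritten as combinations of joint entropies in one normal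
    form, with X1 split off by independence. Chain rules then become linear arithmetic.\<close>
  note ec = ent_cong[OF finJ]
  have ind: "ent J (\<lambda>w. (f (sU w, sV1 w, sV2 w), sX1 w)) = ent J (\<lambda>w. f (sU w, sV1 w, sV2 w)) + ent J sX1"
    for f :: "triple \<Rightarrow> triple"
    unfolding J_def by (rule joint_indep[OF fin])
  let ?U = "ent J sU" and ?X = "ent J sX1" and ?Y = "ent J sY" and ?Z = "ent J sZ"
  let ?AU = "ent J (sV1 \<star> sU)" and ?BU = "ent J (sV2 \<star> sU)" and ?ABU = "ent J (sV1 \<star> sV2 \<star> sU)"
  let ?UX = "ent J (sU \<star> sX1)" and ?YX = "ent J (sY \<star> sX1)" and ?UYX = "ent J (sU \<star> sY \<star> sX1)"
  let ?UZ = "ent J (sU \<star> sZ)" and ?AUX = "ent J (sV1 \<star> sU \<star> sX1)"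
  let ?AYUX = "ent J (sV1 \<star> sY \<star> sU \<star> sX1)" and ?BZU = "ent J (sV2 \<star> sZ \<star> sU)"
  let ?ZUB = "ent J (sZ \<star> sU \<star> sV2)" and ?XZUB = "ent J (sX1 \<star> sZ \<star> sU \<star> sV2)"
  let ?XUB = "ent J (sX1 \<star> sU \<star> sV2)" and ?AZUB = "ent J (sV1 \<star> sZ \<star> sU \<star> sV2)"
  let ?XUAB = "ent J (sX1 \<star> sU \<star> sV1 \<star> sV2)" and ?XAZUB = "ent J (\<lambda>w. ((sX1 w, sV1 w), sZ w, sU w, sV2 w))"
  let ?YUXA = "ent J (sY \<star> sU \<star> sX1 \<star> sV1)" and ?BYUXA = "ent J (sV2 \<star> sY \<star> sU \<star> sX1 \<star> sV1)"
  have UX: "?UX = ?U + ?X"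
    using ind[of "\<lambda>q. (fst q, 0, 0)"] ec[of "\<lambda>w. ((sU w, 0::nat, 0::nat), sX1 w)" "sU \<star> sX1"]
      ec[of "\<lambda>w. (sU w, 0::nat, 0::nat)" sU] by simp
  have AUX: "?AUX = ?AU + ?X"
    using ind[of "\<lambda>q. (fst (snd q), fst q, 0)"] ec[of "\<lambda>w. ((sV1 w, sU w, 0::nat), sX1 w)" "sV1 \<star> sU \<star> sX1"]
      ec[of "\<lambda>w. (sV1 w, sU w, 0::nat)" "sV1 \<star> sU"] by simp
  have XUB: "?XUB = ?BU + ?X"
  proof -
    have "ent J (\<lambda>w. ((sV2 w, sU w, 0::nat), sX1 w)) = ?XUB" by (rule ec) auto
    moreover have "ent J (\<lambda>w. (sV2 w, sU w, 0::nat)) = ?BU" by (rule ec) auto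
    ultimately show ?thesis using ind[of "\<lambda>q. (snd (snd q), fst q, 0)"] by simp
  qed
  have XUAB: "?XUAB = ?ABU + ?X"
  proof -
    have "ent J (\<lambda>w. ((sV1 w, sV2 w, sU w), sX1 w)) = ?XUAB" by (rule ec) auto
    then show ?thesis using ind[of "\<lambda>q. (fst (snd q), snd (snd q), fst q)"] by simp
  qed
  have a: "a = ?AU - ?U + ent J (sY \<star> sU \<star> sX1) - ?AYUX"
    using UX AUX by (simp add: a_def cmi_def)
  have b: "b = ?BU - ?U + ent J (sZ \<star> sU) - ?BZU"
    by (simp add: b_def cmi_def)
  have c: "c = ?AU + ?BU - ?ABU - ?U" by (simp add: c_def cmi_def)
  have M1: "cmi J sU sY sX1 = ?U + ?YX - ?UYX" using UX by (simp add: cmi_def)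
  have M2: "mi J sU sZ = ?U + ?Z - ?UZ"
    using ec[of "\<lambda>w. (sU w, ())" sU] ec[of "\<lambda>w. (sZ w, ())" sZ] ec[of "\<lambda>w. (sU w, sZ w, ())" "sU \<star> sZ"]
    by (simp add: mi_def cmi_def ent_const)
  have p: "p = ?X + ?Y - ent J (sX1 \<star> sY)"
    using ec[of "\<lambda>w. (sX1 w, ())" sX1] ec[of "\<lambda>w. (sY w, ())" sY] ec[of "\<lambda>w. (sX1 w, sY w, ())" "sX1 \<star> sY"]
    by (simp add: p_def mi_def cmi_def ent_const)
  have UB: "ent J (sU \<star> sV2) = ?BU" by (rule ec) auto
  have g: "g = ?X + ?ZUB - ?XZUB" using XUB UB by (simp add: g_def cmi_def)
  have m: "m = ?X + ?AZUB - ?XAZUB"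
  proof -
    have "ent J (sZ \<star> sU \<star> sV1 \<star> sV2) = ?AZUB" "ent J (sX1 \<star> sZ \<star> sU \<star> sV1 \<star> sV2) = ?XAZUB"
      "ent J (sU \<star> sV1 \<star> sV2) = ?ABU" by (rule ec; auto)+
    then show ?thesis using XUAB by (simp add: m_def cmi_def)
  qed
  have d: "d = ?ABU + ?X + ?ZUB - ?XAZUB - ?BU"
  proof -
    have "ent J (\<lambda>w. ((sX1 w, sV1 w), sU w, sV2 w)) = ?XUAB" by (rule ec) auto
    then show ?thesis using XUAB UB by (simp add: d_def cmi_def)
  qed
  have k: "k = ?ABU + ?YUXA - ?BYUXA - ?AU"
  proof -
    have "ent J (sV2 \<star> sU \<star> sX1 \<star> sV1) = ?XUAB" "ent J (sU \<star> sX1 \<star> sV1) = ?AUX" by (rule ec; auto)+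
    then show ?thesis using XUAB AUX by (simp add: k_def cmi_def)
  qed
  have n: "cmi J sV1 sZ (sU \<star> sV2) = ?ABU + ?ZUB - ?AZUB - ?BU"
  proof -
    have "ent J (sV1 \<star> sU \<star> sV2) = ?ABU" by (rule ec) auto
    then show ?thesis using UB by (simp add: cmi_def)
  qed

  \<comment> \<open>By the chain rule \<open>d\<close> is \<open>m\<close> plus I(V1;Z|U,V2), and
    that information is nonnegative.\<close>
  have "Re1 \<le> a - c" "Re2 \<le> b - c" using H(11,12) pos m d n by auto
  then obtain c1 c2 where cc: "0 \<le> c1" "c1 \<le> R1 - Re1" "0 \<le> c2" "c2 \<le> R2 - Re2" "R1 - c1 \<le> a" "R2 - c2 \<le> b"
     "c1 + c2 \<le> M" "(R1 - c1) + (R2 - c2) \<le> a + b - c"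
    using rate_splitting[OF H(8,9,10) pos(2,1) H(6,7)] by blast
  \<comment> \<open>A message rate loses at most \<open>4 * \<delta>\<close> on U and
    \<open>4 * \<delta>\<close> in its secret part, and the code itself is accurate up to
    \<open>\<delta>\<close>: hence 9. The 5 keeps the lowered secret rates positive. The last bound
    leaves room for two slacks, in \<open>f3\<close> and in the secrecy condition on X1.\<close>
  define \<delta> where "\<delta> = Min ({\<epsilon> / 9, Re1 / 5, Re2 / 5} \<union> (if g < p then {(p - g) / 2} else {}))"
  have dl: "0 < \<delta>" "9 * \<delta> \<le> \<epsilon>" "5 * \<delta> \<le> Re1" "5 * \<delta> \<le> Re2" "g < p \<Longrightarrow> 2 * \<delta> \<le> p - g"
  proof -
    have "\<delta> \<le> \<epsilon> / 9" "\<delta> \<le> Re1 / 5" "\<delta> \<le> Re2 / 5" unfolding \<delta>_def by (auto intro!: Min_le)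
    moreover have "\<delta> \<le> (p - g) / 2" if "g < p" unfolding \<delta>_def using that by (intro Min_le) auto
    ultimately show "9 * \<delta> \<le> \<epsilon>" "5 * \<delta> \<le> Re1" "5 * \<delta> \<le> Re2" "g < p \<Longrightarrow> 2 * \<delta> \<le> p - g" by auto
    show "0 < \<delta>" unfolding \<delta>_def using eps H by (subst Min_gr_iff) auto
  qed
  let ?S = "source PUV PX1 (kern1 W PX)"

  note S = source_eq_joint[where W = W and PX = PX, of PUV PX1, folded J_def]
  note ld = cent_def ent_map rvU_def[abs_def] rvV1_def[abs_def] rvV2_def[abs_def] rvX1_def[abs_def] rvO_def[abs_def]
  have q1: "cent ?S rvX1 rvY = ent J (sX1 \<star> sY) - ?Y"
    unfolding S by (simp add: ld)
  have q2: "cent ?S rvU (rvY \<star> rvX1) = ?UYX - ?YX"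
    unfolding S by (simp add: ld)
  have q3: "cent ?S rvU rvZ = ?UZ - ?Z"
    unfolding S by (simp add: ld)
  have YXU: "ent J (sY \<star> sX1 \<star> sU) = ent J (sY \<star> sU \<star> sX1)" by (rule ec) auto
  have q4: "cent ?S rvV1 (rvY \<star> rvX1 \<star> rvU) = ?AYUX - ent J (sY \<star> sU \<star> sX1)"
  proof -
    have "ent J (sV1 \<star> sY \<star> sX1 \<star> sU) = ?AYUX" by (rule ec) auto
    then show ?thesis unfolding S by (simp add: ld YXU)
  qed
  have q5: "cent ?S rvV2 (rvZ \<star> rvU) = ?BZU - ent J (sZ \<star> sU)"
    unfolding S by (simp add: ld)
  have q6: "cent ?S rvU (\<lambda>_. ()) = ?U"
  proof -
    have "ent J (\<lambda>w. (sU w, ())) = ?U" by (rule ec) auto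
    then show ?thesis unfolding S by (simp add: ld ent_const)
  qed
  have q7: "cent ?S rvV1 rvU = ?AU - ?U" "cent ?S rvV2 rvU = ?BU - ?U"
    unfolding S by (simp_all add: ld)
  have q8: "cent ?S (rvV1 \<star> rvV2) rvU = ?ABU - ?U"
  proof -
    have "ent J (\<lambda>w. ((sV1 w, sV2 w), sU w)) = ?ABU" by (rule ec) auto
    then show ?thesis unfolding S by (simp add: ld)
  qed
  have q9: "cent ?S rvV1 (rvZ \<star> rvU \<star> rvV2) = ?AZUB - ?ZUB" "cent ?S rvX1 (rvZ \<star> rvU \<star> rvV2) = ?XZUB - ?ZUB"
    unfolding S by (simp_all add: ld)
  have q10: "cent ?S (rvV1 \<star> rvX1) (rvZ \<star> rvU \<star> rvV2) = ?XAZUB - ?ZUB"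
  proof -
    have "ent J (\<lambda>w. ((sV1 w, sX1 w), sZ w, sU w, sV2 w)) = ?XAZUB" by (rule ec) auto
    then show ?thesis unfolding S by (simp add: ld)
  qed
  have q11: "cent ?S rvV1 (rvZ \<star> rvU \<star> rvV2 \<star> rvX1) = ?XAZUB - ?XZUB"
  proof -
    have "ent J (sV1 \<star> sZ \<star> sU \<star> sV2 \<star> sX1) = ?XAZUB" "ent J (sZ \<star> sU \<star> sV2 \<star> sX1) = ?XZUB"
      by (rule ec; auto)+
    then show ?thesis unfolding S by (simp add: ld)
  qed
  have q12: "cent ?S rvV2 (rvY \<star> rvU \<star> rvV1 \<star> rvX1) = ?BYUXA - ?YUXA"
  proof -
    have "ent J (sV2 \<star> sY \<star> sU \<star> sV1 \<star> sX1) = ?BYUXA" "ent J (sY \<star> sU \<star> sV1 \<star> sX1) = ?YUXA"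
      by (rule ec; auto)+
    then show ?thesis unfolding S by (simp add: ld)
  qed
  have finS: "finite (set_pmf ?S)" unfolding S using finJ by simp
  note cn = cent_nonneg[OF finS]
  \<comment> \<open>Public rates: the conditional entropies that remain to be resolved by the decoders.\<close>
  define f0 where "f0 = max (?UYX - ?YX) (?UZ - ?Z) + \<delta>"
  define f1 where "f1 = ?AYUX - ent J (sY \<star> sU \<star> sX1) + \<delta>"
  define f2 where "f2 = ?BZU - ent J (sZ \<star> sU) + \<delta>"
  define f3 where "f3 = ent J (sX1 \<star> sY) - ?Y + \<delta>"
  \<comment> \<open>In each later condition at most three slacks \<open>\<delta>\<close> accumulate,
    and lowering a single rate by \<open>4 * \<delta>\<close> pays for them. Truncation at 0 covers
    small \<open>M\<close>: either one of the two rates is really lowered, or both vanish and U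
    carries no message.\<close>
  define d1 where "d1 = max 0 (c1 - 4 * \<delta>)"
  define d2 where "d2 = max 0 (c2 - 4 * \<delta>)"
  have fn: "0 \<le> f0" "0 \<le> f1" "0 \<le> f2" "0 \<le> f3"
    using cn[of rvU rvZ] cn[of rvV1 "rvY \<star> rvX1 \<star> rvU"] cn[of rvV2 "rvZ \<star> rvU"] cn[of rvX1 rvY] dl(1)
    unfolding q1 q3 q4 q5 f0_def f1_def f2_def f3_def by linarith+
  have dn: "0 \<le> d1" "0 \<le> d2" "d1 \<le> c1" "d2 \<le> c2" "c1 - 4 * \<delta> \<le> d1" "c2 - 4 * \<delta> \<le> d2"
    using cc(1,3) dl(1) unfolding d1_def d2_def by linarith+
  have M': "M = ?U - f0 + \<delta>" unfolding M_def M1 M2 f0_def by linarith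
  have cd: "d1 = 0 \<and> d2 = 0 \<or> f0 + d1 + d2 + \<delta> \<le> ?U"
  proof (cases "d1 = 0 \<and> d2 = 0")
    case False
    then have "d1 = c1 - 4 * \<delta> \<or> d2 = c2 - 4 * \<delta>" by (auto simp: d1_def d2_def max_def split: if_splits)
    then have "d1 + d2 \<le> c1 + c2 - 4 * \<delta>" using dn by linarith
    then show ?thesis using cc(7) M' dl(1) by linarith
  qed simp
  have m1: "f1 + (Re1 - 4 * \<delta>) + (R1 - c1 - Re1) + \<delta> \<le> ?AU - ?U"
    using cc(5) dl(1) unfolding a f1_def by linarith
  have m2: "f2 + (Re2 - 4 * \<delta>) + (R2 - c2 - Re2) + \<delta> \<le> ?BU - ?U"
    using cc(6) dl(1) unfolding b f2_def by linarith
  have m3: "f1 + (Re1 - 4 * \<delta>) + (R1 - c1 - Re1) + f2 + (Re2 - 4 * \<delta>) + (R2 - c2 - Re2) + \<delta> \<le> ?ABU - ?U"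
    using cc(8) dl(1) unfolding a b c f1_def f2_def by linarith
  have e1: "f1 + (Re1 - 4 * \<delta>) + \<delta> \<le> ?AZUB - ?ZUB \<and> f3 + \<delta> \<le> ?XZUB - ?ZUB \<and> f1 + (Re1 - 4 * \<delta>) + f3 + \<delta> \<le> ?XAZUB - ?ZUB
      \<or> f1 + (Re1 - 4 * \<delta>) + \<delta> \<le> ?XAZUB - ?XZUB"
  \<comment> \<open>For \<open>g < p\<close> the three inequalities come from the bound with
    \<open>m\<close>, from \<open>g < p\<close> itself and from the bound with \<open>p\<close>. For
    \<open>g = p\<close> the minimum is at most \<open>g\<close>, and \<open>d - g\<close> is
    I(V1;Z|U,V2,X1), which is the secrecy condition with X1 revealed.\<close>
  proof (cases "g < p")
    case True
    have "Re1 \<le> m + a - c - d" "Re1 \<le> p + a - c - d" using H(11) by auto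
    then show ?thesis using dl(5)[OF True] dl(1) unfolding m p a c d g f1_def f3_def by linarith
  next
    case False
    then have "p = g" using H(1) by linarith
    then have "Re1 \<le> g + a - c - d" using H(11) by auto
    then have "f1 + (Re1 - 4 * \<delta>) + \<delta> \<le> ?XAZUB - ?XZUB"
      using dl(1) unfolding a c d g f1_def by linarith
    then show ?thesis ..
  qed
  have e2: "f2 + (Re2 - 4 * \<delta>) + \<delta> \<le> ?BYUXA - ?YUXA"
    using H(12) dl(1) unfolding b c k f2_def by linarith
  have "\<forall>\<^sub>F n in sequentially. \<exists>M1 M2 enc rel dec1 dec2.
    good_code W n (d1 + (Re1 - 4 * \<delta>) + (R1 - c1 - Re1)) (d2 + (Re2 - 4 * \<delta>) + (R2 - c2 - Re2))
      (Re1 - 4 * \<delta>) (Re2 - 4 * \<delta>) \<delta> M1 M2 enc rel dec1 dec2"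
  proof (rule codes_exist[OF fin, where PX = PX and ?PX1.0 = PX1 and \<delta> = \<delta> and ?f0.0 = f0 and ?f1.0 = f1 and ?f2.0 = f2 and ?f3.0 = f3])
    show "cent ?S rvU (rvY \<star> rvX1) + \<delta> \<le> f0" "cent ?S rvU rvZ + \<delta> \<le> f0"
      unfolding q2 q3 f0_def by linarith+
    show "cent ?S rvX1 rvY + \<delta> \<le> f3" "cent ?S rvV1 (rvY \<star> rvX1 \<star> rvU) + \<delta> \<le> f1" "cent ?S rvV2 (rvZ \<star> rvU) + \<delta> \<le> f2"
      unfolding q1 q4 q5 f1_def f2_def f3_def by simp_all
    show "d1 = 0 \<and> d2 = 0 \<or> f0 + d1 + d2 + \<delta> \<le> cent ?S rvU (\<lambda>_. ())" unfolding q6 by (rule cd)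
    show "f1 + (Re1 - 4 * \<delta>) + (R1 - c1 - Re1) + \<delta> \<le> cent ?S rvV1 rvU" unfolding q7 by (rule m1)
    show "f2 + (Re2 - 4 * \<delta>) + (R2 - c2 - Re2) + \<delta> \<le> cent ?S rvV2 rvU" unfolding q7 by (rule m2)
    show "f1 + (Re1 - 4 * \<delta>) + (R1 - c1 - Re1) + f2 + (Re2 - 4 * \<delta>) + (R2 - c2 - Re2) + \<delta> \<le> cent ?S (rvV1 \<star> rvV2) rvU"
      unfolding q8 by (rule m3)
    show "f1 + (Re1 - 4 * \<delta>) + \<delta> \<le> cent ?S rvV1 (rvZ \<star> rvU \<star> rvV2) \<and> f3 + \<delta> \<le> cent ?S rvX1 (rvZ \<star> rvU \<star> rvV2)
        \<and> f1 + (Re1 - 4 * \<delta>) + f3 + \<delta> \<le> cent ?S (rvV1 \<star> rvX1) (rvZ \<star> rvU \<star> rvV2)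
      \<or> f1 + (Re1 - 4 * \<delta>) + \<delta> \<le> cent ?S rvV1 (rvZ \<star> rvU \<star> rvV2 \<star> rvX1)"
      unfolding q9 q10 q11 by (rule e1)
    show "f2 + (Re2 - 4 * \<delta>) + \<delta> \<le> cent ?S rvV2 (rvY \<star> rvU \<star> rvV1 \<star> rvX1)"
      unfolding q12 by (rule e2)
    show "0 < Re1 - 4 * \<delta>" "0 < Re2 - 4 * \<delta>" "0 \<le> R1 - c1 - Re1" "0 \<le> R2 - c2 - Re2"
      using dl cc by linarith+
  qed (use fn dn dl in auto)
  then show ?thesis
  proof (rule eventually_mono)
    fix n assume "\<exists>M1 M2 enc rel dec1 dec2. good_code W n (d1 + (Re1 - 4 * \<delta>) + (R1 - c1 - Re1)) (d2 + (Re2 - 4 * \<delta>) + (R2 - c2 - Re2))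
      (Re1 - 4 * \<delta>) (Re2 - 4 * \<delta>) \<delta> M1 M2 enc rel dec1 dec2"
    then obtain M1 M2 enc rel dec1 dec2 where code: "good_code W n (d1 + (Re1 - 4 * \<delta>) + (R1 - c1 - Re1)) (d2 + (Re2 - 4 * \<delta>) + (R2 - c2 - Re2))
      (Re1 - 4 * \<delta>) (Re2 - 4 * \<delta>) \<delta> M1 M2 enc rel dec1 dec2" by blast
    have "good_code W n R1 R2 Re1 Re2 \<epsilon> M1 M2 enc rel dec1 dec2"
      by (rule good_code_mono[OF code]) (use dn dl in linarith)+
    then show "\<exists>M1 M2 enc rel dec1 dec2. good_code W n R1 R2 Re1 Re2 \<epsilon> M1 M2 enc rel dec1 dec2" by blast
  qed
qed

section \<open>The achievable region\<close>

text \<open>Achievability wants rates that converge exactly along one sequence of codes, so the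
  tolerance has to shrink with the length. \<open>K n\<close> is the largest index up to
  \<open>n\<close> whose threshold \<open>N\<close> has been passed; inserting 0 keeps the maximum
  defined.\<close>

lemma diagonal_sequence:
  fixes P :: "real \<Rightarrow> nat \<Rightarrow> bool"
  assumes "\<And>\<epsilon>. 0 < \<epsilon> \<Longrightarrow> \<forall>\<^sub>F n in sequentially. P \<epsilon> n"
  shows "\<exists>e. e \<longlonglongrightarrow> 0 \<and> (\<forall>\<^sub>F n in sequentially. P (e n) n)"
proof -
  have "\<exists>N. \<forall>n\<ge>N. P (1 / real (Suc k)) n" for k
    using assms[of "1 / real (Suc k)"] by (simp add: eventually_sequentially)
  then obtain N where N: "\<And>k n. N k \<le> n \<Longrightarrow> P (1 / real (Suc k)) n" by metis
  define K where "K n = Max (insert 0 {k. k \<le> n \<and> N k \<le> n})" for n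
  have fin: "finite (insert 0 {k. k \<le> n \<and> N k \<le> n})" for n
    by (rule finite_subset[of _ "{..n}"]) auto
  have large: "k \<le> K n" if "max k (N k) \<le> n" for k n
    unfolding K_def using fin that by (intro Max_ge) auto
  have "filterlim K at_top sequentially"
    unfolding filterlim_at_top eventually_sequentially using large by blast
  then have "filterlim (\<lambda>n. Suc (K n)) at_top sequentially"
    by (rule filterlim_compose[OF filterlim_Suc])
  then have "(\<lambda>n. 1 / real (Suc (K n))) \<longlonglongrightarrow> 0"
    by (rule filterlim_compose[OF lim_1_over_n])
  moreover have "\<forall>\<^sub>F n in sequentially. P (1 / real (Suc (K n))) n"
  proof (rule eventually_sequentiallyI)
    fix n assume n: "N 0 \<le> n"
    have "K n \<in> insert 0 {k. k \<le> n \<and> N k \<le> n}"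
      unfolding K_def using fin by (intro Max_in) auto
    then have "N (K n) \<le> n" using n by auto
    then show "P (1 / real (Suc (K n))) n" by (rule N)
  qed
  ultimately show ?thesis by (intro exI[of _ "\<lambda>n. 1 / real (Suc (K n))"]) blast
qed

lemma achievableI:
  fixes W :: "'x \<Rightarrow> 'x1 \<Rightarrow> ('y \<times> 'y1 \<times> 'z) pmf"
  assumes pos: "0 < R1" "0 < R2" "0 < Re1" "0 < Re2"
    and codes: "\<And>\<epsilon>. 0 < \<epsilon> \<Longrightarrow> \<forall>\<^sub>F n in sequentially. \<exists>M1 M2 enc rel dec1 dec2.
      good_code W n R1 R2 Re1 Re2 \<epsilon> M1 M2 enc rel dec1 dec2"
  shows "(R1, R2, Re1, Re2) \<in> achievable_region W"
proof -
  obtain e where e: "e \<longlonglongrightarrow> 0"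
    and ev: "\<forall>\<^sub>F n in sequentially. \<exists>M1 M2 enc rel dec1 dec2. good_code W n R1 R2 Re1 Re2 (e n) M1 M2 enc rel dec1 dec2"
    using diagonal_sequence[where P = "\<lambda>\<epsilon> n. \<exists>M1 M2 enc rel dec1 dec2. good_code W n R1 R2 Re1 Re2 \<epsilon> M1 M2 enc rel dec1 dec2", OF codes]
    by blast
  \<comment> \<open>Validity is demanded at every length, the other properties only eventually. At
    lengths without a good code any valid code is taken, and one exists with a single message for
    each receiver.\<close>
  define Q where "Q n M1 M2 enc rel dec1 dec2 \<longleftrightarrow> valid_code n M1 M2 enc \<and>
    ((\<exists>M1 M2 enc rel dec1 dec2. good_code W n R1 R2 Re1 Re2 (e n) M1 M2 enc rel dec1 dec2)
      \<longrightarrow> good_code W n R1 R2 Re1 Re2 (e n) M1 M2 enc rel dec1 dec2)"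
    for n M1 M2 and enc :: "nat \<Rightarrow> nat \<Rightarrow> 'x list pmf" and rel :: "('y1 list \<Rightarrow> 'x1) pmf" and dec1 dec2
  have "\<exists>M1 M2 enc rel dec1 dec2. Q n M1 M2 enc rel dec1 dec2" for n
  proof (cases "\<exists>M1 M2 enc rel dec1 dec2. good_code W n R1 R2 Re1 Re2 (e n) M1 M2 enc rel dec1 dec2")
    case True
    then show ?thesis unfolding Q_def good_code_def by blast
  next
    case False
    have "valid_code n 1 1 (\<lambda>_ _. return_pmf (replicate n undefined) :: 'x list pmf)"
      by (simp add: valid_code_def)
    then show ?thesis using False unfolding Q_def by blast
  qed
  then obtain M1 M2 enc rel dec1 dec2 where Q: "\<And>n. Q n (M1 n) (M2 n) (enc n) (rel n) (dec1 n) (dec2 n)"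
    by metis
  have good: "\<forall>\<^sub>F n in sequentially. good_code W n R1 R2 Re1 Re2 (e n) (M1 n) (M2 n) (enc n) (rel n) (dec1 n) (dec2 n)"
    using ev by (rule eventually_mono) (use Q in \<open>auto simp: Q_def\<close>)
  have small: "\<forall>\<^sub>F n in sequentially. e n < \<epsilon>" if "0 < \<epsilon>" for \<epsilon>
    using e that by (rule order_tendstoD(2))
  have "(\<lambda>n. log 2 (real (M1 n)) / real n - R1) \<longlonglongrightarrow> 0"
    by (rule Lim_null_comparison[OF _ e], rule eventually_mono[OF good]) (simp add: good_code_def)
  then have r1: "(\<lambda>n. log 2 (real (M1 n)) / real n) \<longlonglongrightarrow> R1" by (simp add: LIM_zero_iff)
  have "(\<lambda>n. log 2 (real (M2 n)) / real n - R2) \<longlonglongrightarrow> 0"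
    by (rule Lim_null_comparison[OF _ e], rule eventually_mono[OF good]) (simp add: good_code_def)
  then have r2: "(\<lambda>n. log 2 (real (M2 n)) / real n) \<longlonglongrightarrow> R2" by (simp add: LIM_zero_iff)
  have d1: "\<forall>\<^sub>F n in sequentially. Delta1 W n (M1 n) (M2 n) (enc n) (rel n) \<ge> Re1 - \<delta>" if "0 < \<delta>" for \<delta>
    using good small[OF that] by eventually_elim (auto simp: good_code_def)
  have d2: "\<forall>\<^sub>F n in sequentially. Delta2 W n (M1 n) (M2 n) (enc n) (rel n) \<ge> Re2 - \<delta>" if "0 < \<delta>" for \<delta>
    using good small[OF that] by eventually_elim (auto simp: good_code_def)
  have pe: "\<forall>\<^sub>F n in sequentially. Pe1 W (M1 n) (M2 n) (enc n) (rel n) (dec1 n) \<le> \<epsilon> \<and>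
      Pe2 W (M1 n) (M2 n) (enc n) (rel n) (dec2 n) \<le> \<epsilon>" if "0 < \<epsilon>" for \<epsilon>
    using good small[OF that] by eventually_elim (auto simp: good_code_def)
  have v: "valid_code n (M1 n) (M2 n) (enc n)" for n using Q by (simp add: Q_def)
  show ?thesis
    unfolding achievable_region_def
    using pos v r1 r2 d1 d2 pe by blast
qed

section \<open>Exchanging the receivers\<close>

definition swapW :: "('x,'x1,'y,'y1,'z) channel \<Rightarrow> ('x,'x1,'z,'y1,'y) channel" where
  "swapW W x x1 = map_pmf (\<lambda>(y, y1, z). (z, y1, y)) (W x x1)"

definition swap_trace :: "'x1 \<times> 'y \<times> 'y1 \<times> 'z \<Rightarrow> 'x1 \<times> 'z \<times> 'y1 \<times> 'y" where
  "swap_trace t = (fst t, snd (snd (snd t)), fst (snd (snd t)), fst (snd t))"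

lemma chan_run_swap: "chan_run W s past xs = map_pmf (map swap_trace) (chan_run (swapW W) s past xs)"
proof (induction xs arbitrary: past)
  case (Cons x xs)
  show ?case
    by (simp add: swapW_def bind_map_pmf map_bind_pmf pmf.map_comp o_def case_prod_unfold swap_trace_def Cons)
qed simp

definition swap_outcome :: "nat \<times> nat \<times> ('x1 \<times> 'y \<times> 'y1 \<times> 'z) list \<Rightarrow> nat \<times> nat \<times> ('x1 \<times> 'z \<times> 'y1 \<times> 'y) list" where
  "swap_outcome t = (fst (snd t), fst t, map swap_trace (snd (snd t)))"

lemma code_pmf_swap:
  "code_pmf W M1 M2 (\<lambda>w1 w2. enc w2 w1) rel = map_pmf swap_outcome (code_pmf (swapW W) M2 M1 enc rel)"
proof -
  have "code_pmf W M1 M2 (\<lambda>w1 w2. enc w2 w1) rel =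
     bind_pmf (pmf_of_set {..<M2}) (\<lambda>w2. bind_pmf (pmf_of_set {..<M1}) (\<lambda>w1.
     bind_pmf (enc w2 w1) (\<lambda>xs. bind_pmf rel (\<lambda>s. map_pmf (\<lambda>os. (w1, w2, os)) (chan_run W s [] xs)))))"
    unfolding code_pmf_def by (rule bind_commute_pmf)
  then show ?thesis
    by (simp add: code_pmf_def map_bind_pmf pmf.map_comp o_def swap_outcome_def chan_run_swap[of W])
qed

lemma outYZ_swap: "outY (swap_outcome t) = outZ t" "outZ (swap_outcome t) = outY t"
  by (simp_all add: outY_def outZ_def swap_outcome_def swap_trace_def case_prod_unfold)

lemma good_code_swap:
  assumes "good_code (swapW W) n R2 R1 Re2 Re1 \<epsilon> M2 M1 enc rel dec2 dec1"
  shows "good_code W n R1 R2 Re1 Re2 \<epsilon> M1 M2 (\<lambda>w1 w2. enc w2 w1) rel dec1 dec2"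
proof -
  have "Pe1 W M1 M2 (\<lambda>w1 w2. enc w2 w1) rel dec1 = Pe2 (swapW W) M2 M1 enc rel dec1"
    "Pe2 W M1 M2 (\<lambda>w1 w2. enc w2 w1) rel dec2 = Pe1 (swapW W) M2 M1 enc rel dec2"
    by (simp_all add: Pe1_def Pe2_def code_pmf_swap[of W M1 M2 enc rel] vimage_def outYZ_swap) (simp_all add: swap_outcome_def)
  moreover have "Delta1 W n M1 M2 (\<lambda>w1 w2. enc w2 w1) rel = Delta2 (swapW W) n M2 M1 enc rel"
    "Delta2 W n M1 M2 (\<lambda>w1 w2. enc w2 w1) rel = Delta1 (swapW W) n M2 M1 enc rel"
    by (simp_all add: Delta1_def Delta2_def code_pmf_swap[of W M1 M2 enc rel] cent_map outYZ_swap) (simp_all add: swap_outcome_def)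
  moreover have "valid_code n M2 M1 enc \<longleftrightarrow> valid_code n M1 M2 (\<lambda>w1 w2. enc w2 w1)"
    by (auto simp: valid_code_def)
  ultimately show ?thesis using assms by (simp add: good_code_def)
qed

definition swap_smp :: "('x,'x1,'y,'y1,'z) smp \<Rightarrow> ('x,'x1,'z,'y1,'y) smp" where
  "swap_smp w = \<lparr>sU = sU w, sV1 = sV2 w, sV2 = sV1 w, sX = sX w, sX1 = sX1 w, sY = sZ w, sY1 = sY1 w, sZ = sY w\<rparr>"

lemma swap_smp_sel [simp]:
  "sU (swap_smp w) = sU w" "sV1 (swap_smp w) = sV2 w" "sV2 (swap_smp w) = sV1 w" "sX1 (swap_smp w) = sX1 w"
  "sY (swap_smp w) = sZ w" "sZ (swap_smp w) = sY w"
  by (simp_all add: swap_smp_def)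

lemma joint_swap:
  "joint (swapW W) (map_pmf (\<lambda>(u, v1, v2). (u, v2, v1)) PUV) (\<lambda>(u, v1, v2). PX (u, v2, v1)) PX1
   = map_pmf swap_smp (joint W PUV PX PX1)"
  by (simp add: joint_def swapW_def bind_map_pmf map_bind_pmf pmf.map_comp o_def case_prod_unfold swap_smp_def)

lemma cmi_commute: "finite (set_pmf P) \<Longrightarrow> cmi P A B C = cmi P B A C"
  unfolding cmi_def by (subst ent_cong[of P "A \<star> B \<star> C" "B \<star> A \<star> C"]) auto

lemma cmi_cond_cong:
  assumes fin: "finite (set_pmf P)" and C: "\<And>w v. C w = C v \<longleftrightarrow> D w = D v"
  shows "cmi P A B C = cmi P A B D"
proof -
  have "ent P (A \<star> C) = ent P (A \<star> D)" "ent P (B \<star> C) = ent P (B \<star> D)"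
    "ent P (A \<star> B \<star> C) = ent P (A \<star> B \<star> D)" "ent P C = ent P D"
    by (rule ent_cong[OF fin]; simp add: C)+
  then show ?thesis by (simp add: cmi_def)
qed

text \<open>Exchanging Y with Z and V1 with V2 turns one list of inequalities into the other, up to
  the symmetry of I(V1;V2|U) and the order of conditioning variables.\<close>

lemma L6_swap:
  fixes W :: "'x::finite \<Rightarrow> 'x1::finite \<Rightarrow> ('y::finite \<times> 'y1::finite \<times> 'z::finite) pmf"
  assumes "(R1, R2, Re1, Re2) \<in> L6 W"
  shows "(R2, R1, Re2, Re1) \<in> L5 (swapW W)"
proof -
  obtain PUV PX PX1 where fin: "finite (set_pmf PUV)"
    and L: "let J = joint W PUV PX PX1;
          M2 = min (cmi J sU sZ sX1) (mi J sU sY)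
      in mi J sX1 sZ \<ge> cmi J sX1 sY (sU \<star> sV1) \<and>
         R1 > 0 \<and> R2 > 0 \<and> Re1 > 0 \<and> Re2 > 0 \<and>
         Re1 \<le> R1 \<and> Re2 \<le> R2 \<and>
         R1 \<le> M2 + cmi J sV1 sY sU \<and>
         R2 \<le> M2 + cmi J sV2 sZ (sU \<star> sX1) \<and>
         R1 + R2 \<le> M2 + cmi J sV1 sY sU + cmi J sV2 sZ (sU \<star> sX1)
                   - cmi J sV1 sV2 sU \<and>
         Re1 \<le> cmi J sV1 sY sU - cmi J sV1 sV2 sU
               - cmi J sV1 sZ (sU \<star> sV2 \<star> sX1) \<and>
         Re2 \<le> min (cmi J sX1 sY (sU \<star> sV1 \<star> sV2)) (mi J sX1 sZ)
               + cmi J sV2 sZ (sU \<star> sX1) - cmi J sV1 sV2 sU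
               - cmi J (sX1 \<star> sV2) sY (sU \<star> sV1)"
    using assms unfolding L6_def by blast
  let ?J = "joint W PUV PX PX1"
  have finJ: "finite (set_pmf ?J)" by (rule finite_joint[OF fin])
  have 1: "cmi ?J sV2 sV1 sU = cmi ?J sV1 sV2 sU" by (rule cmi_commute[OF finJ])
  have 2: "cmi ?J sX1 sY (sU \<star> sV2 \<star> sV1) = cmi ?J sX1 sY (sU \<star> sV1 \<star> sV2)"
    by (rule cmi_cond_cong[OF finJ]) auto
  have 3: "cmi ?J sV1 sZ (sU \<star> sX1 \<star> sV2) = cmi ?J sV1 sZ (sU \<star> sV2 \<star> sX1)"
    by (rule cmi_cond_cong[OF finJ]) auto
  show ?thesis
    unfolding L5_def
    apply (simp only: mem_Collect_eq case_prod_conv)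
    apply (rule exI[of _ "map_pmf (\<lambda>(u, v1, v2). (u, v2, v1)) PUV"], rule exI[of _ "\<lambda>(u, v1, v2). PX (u, v2, v1)"], rule exI[of _ PX1])
    using fin L unfolding joint_swap Let_def
    by (simp add: cmi_map mi_map 1 2 3 add_ac)
qed

theorem theorem7:
  fixes W :: "'x::finite \<Rightarrow> 'x1::finite \<Rightarrow> ('y::finite \<times> 'y1::finite \<times> 'z::finite) pmf"
  shows "L5 W \<union> L6 W \<subseteq> achievable_region W"
proof (rule subsetI)
  fix r assume r: "r \<in> L5 W \<union> L6 W"
  obtain R1 R2 Re1 Re2 where R: "r = (R1, R2, Re1, Re2)" by (metis prod.exhaust)
  show "r \<in> achievable_region W"
    using r
  proof
    assume L: "r \<in> L5 W"
    then have "0 < R1" "0 < R2" "0 < Re1" "0 < Re2" unfolding R L5_def Let_def by auto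
    then show ?thesis unfolding R using L5_good_codes[OF L[unfolded R]] by (rule achievableI)
  next
    assume L: "r \<in> L6 W"
    then have pos: "0 < R1" "0 < R2" "0 < Re1" "0 < Re2" unfolding R L6_def Let_def by auto
    show ?thesis
      unfolding R
    proof (rule achievableI[OF pos])
      fix \<epsilon> :: real assume "0 < \<epsilon>"
      from L5_good_codes[OF L6_swap[OF L[unfolded R]] this]
      show "\<forall>\<^sub>F n in sequentially. \<exists>M1 M2 enc rel dec1 dec2. good_code W n R1 R2 Re1 Re2 \<epsilon> M1 M2 enc rel dec1 dec2"
        by (rule eventually_mono) (blast intro: good_code_swap)
    qed
  qed
qed

end
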